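(* Let $(X,Y)$ be a bivariate random vector such that $X-Y$ (equivalently $Y-X$) has a continuous distribution function, and let $\{(X_i,Y_i)\}_{i=1}^n$ be a paired random sample (i.i.d. copies) of $(X,Y)$. Let $\overline F(t)=P(X-Y>t)$ and $\overline G(t)=P(Y-X>t)$, and for $n\ge 1$ let $$\overline F_n(t)=\frac1n\sum_{i=1}^n I_{(t,+\infty)}(X_i-Y_i),\qquad \overline G_n(t)=\frac1n\sum_{i=1}^n I_{(t,+\infty)}(Y_i-X_i),\qquad S_n^{st:wj}=\sqrt n\,\sup_{t\in[0,+\infty)}\{\overline F_n(t)-\overline G_n(t)\}.$$ Suppose the null hypothesis $H_0: X\le_{\mathrm{st:wj}}Y$ holds. Then $$\lim_{n\to\infty}P\left(S_n^{st:wj}>c\right)\le P\left(\sup_{t\in[0,+\infty)}\{GP(t)\}>c\right)$$ for any $c\in\mathbb R$, where $GP=\{GP(t): t\in[0,+\infty)\}$ is a Gaussian process such that, for given $t_1,t_2,\ldots,t_k\in[0,+\infty)$, the vector $(GP(t_1),GP(t_2),\ldots,GP(t_k))$ is a $k$-dimensional multivariate normal random vector with zero mean vector and covariance matrix $\Sigma$ given by $$\Sigma_{ii}=\mathrm{Var}[GP(t_i)]=\overline F(t_i)+\overline G(t_i)-\left(\overline F(t_i)-\overline G(t_i)\right)^2,\quad i=1,2,\ldots,k,$$ and $$\Sigma_{ij}=\mathrm{Cov}(GP(t_i),GP(t_j))=\overline F(t_i\vee t_j)+\overline G(t_i\vee t_j)-(\overline F(t_i)-\overline G(t_i))(\overline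 F(t_j)-\overline G(t_j)),$$ with $x\vee y=\max\{x,y\}$.
   Context: For a bivariate random vector $(X,Y)$, $X$ is smaller than $Y$ in the weak joint stochastic dominance, written $X\le_{\mathrm{st:wj}}Y$, if $P(X-Y>t)\le P(Y-X>t)$ for all $t\in\mathbb R$. $I_{(t,+\infty)}$ denotes the indicator function of the interval $(t,+\infty)$. The process $GP$ arises as the weak limit, in the Skorokhod space $D([0,+\infty))$ of càdlàg real-valued functions on $[0,+\infty)$ with the uniform metric, of the processes $\Delta_n(t)=\sqrt n\left(\overline F_n(t)-\overline G_n(t)-(\overline F(t)-\overline G(t))\right)$, $t\in[0,+\infty)$.
   Formalization: For c = 0 the limit of P(S_n > c) need not exist under the stated assumptions, so there the inequality is proved with limsup in place of lim; for every c ≠ 0 the limit is proved to exist and to satisfy the stated bound. *)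

theory Defs
  imports "HOL-Probability.Probability"
begin

text \<open>
  \<open>diff_surv M X Y t\<close> is $P(X - Y > t)$.  Thus $\overline F$ is \<open>diff_surv M X Y\<close> and
  $\overline G$ is \<open>diff_surv M Y X\<close>; the empirical versions follow the same convention.
\<close>

definition diff_surv :: "'a measure \<Rightarrow> ('a \<Rightarrow> real) \<Rightarrow> ('a \<Rightarrow> real) \<Rightarrow> real \<Rightarrow> real" where
  "diff_surv M X Y t = measure M {\<omega> \<in> space M. X \<omega> - Y \<omega> > t}"

definition st_wj_le :: "'a measure \<Rightarrow> ('a \<Rightarrow> real) \<Rightarrow> ('a \<Rightarrow> real) \<Rightarrow> bool" where
  "st_wj_le M X Y \<longleftrightarrow> (\<forall>t. diff_surv M X Y t \<le> diff_surv M Y X t)"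

definition paired_sample ::
    "'a measure \<Rightarrow> ('a \<Rightarrow> real) \<Rightarrow> ('a \<Rightarrow> real) \<Rightarrow> (nat \<Rightarrow> 'a \<Rightarrow> real) \<Rightarrow> (nat \<Rightarrow> 'a \<Rightarrow> real) \<Rightarrow> bool"
where
  "paired_sample M X Y Xs Ys \<longleftrightarrow>
     prob_space.indep_vars M (\<lambda>_. borel) (\<lambda>i \<omega>. (Xs i \<omega>, Ys i \<omega>)) {1..} \<and>
     (\<forall>i\<ge>1. distr M borel (\<lambda>\<omega>. (Xs i \<omega>, Ys i \<omega>)) = distr M borel (\<lambda>\<omega>. (X \<omega>, Y \<omega>)))"

definition emp_surv ::
    "(nat \<Rightarrow> 'a \<Rightarrow> real) \<Rightarrow> (nat \<Rightarrow> 'a \<Rightarrow> real) \<Rightarrow> nat \<Rightarrow> 'a \<Rightarrow> real \<Rightarrow> real" where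
  "emp_surv Xs Ys n \<omega> t = (1 / real n) * (\<Sum>i = 1..n. indicator {t<..} (Xs i \<omega> - Ys i \<omega>))"

definition S_wj ::
    "(nat \<Rightarrow> 'a \<Rightarrow> real) \<Rightarrow> (nat \<Rightarrow> 'a \<Rightarrow> real) \<Rightarrow> nat \<Rightarrow> 'a \<Rightarrow> real" where
  "S_wj Xs Ys n \<omega> = sqrt (real n) * (SUP t\<in>{0..}. emp_surv Xs Ys n \<omega> t - emp_surv Ys Xs n \<omega> t)"

text \<open>Univariate normal laws; the degenerate ones (variance $0$) are included, since the
  covariance matrices below may be singular.\<close>

definition normal_rv :: "'b measure \<Rightarrow> ('b \<Rightarrow> real) \<Rightarrow> bool" where
  "normal_rv N Z \<longleftrightarrow> Z \<in> borel_measurable N \<and>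
     ((\<exists>m. distr N borel Z = return borel m) \<or>
      (\<exists>m s. 0 < s \<and> distributed N lborel Z (\<lambda>x. ennreal (normal_density m s x))))"

text \<open>
  The vector $(V_1,\dots,V_k)$ is multivariate normal (possibly degenerate) if all linear
  combinations of its components are normal.  All \<open>V i\<close> and their products are then integrable,
  so that the integrals are the genuine means and covariances.
\<close>

definition multivariate_normal ::
    "'b measure \<Rightarrow> nat \<Rightarrow> (nat \<Rightarrow> 'b \<Rightarrow> real) \<Rightarrow> (nat \<Rightarrow> real) \<Rightarrow> (nat \<Rightarrow> nat \<Rightarrow> real) \<Rightarrow> bool"
where
  "multivariate_normal N k V \<mu> \<Sigma> \<longleftrightarrow>
     (\<forall>i\<in>{1..k}. V i \<in> borel_measurable N) \<and>
     (\<forall>a. normal_rv N (\<lambda>\<omega>. \<Sum>i = 1..k. a i * V i \<omega>)) \<and>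
     (\<forall>i\<in>{1..k}. (\<integral>\<omega>. V i \<omega> \<partial>N) = \<mu> i) \<and>
     (\<forall>i\<in>{1..k}. \<forall>j\<in>{1..k}. (\<integral>\<omega>. (V i \<omega> - \<mu> i) * (V j \<omega> - \<mu> j) \<partial>N) = \<Sigma> i j)"

text \<open>Membership in $D([0,\infty))$; values at negative arguments are irrelevant.\<close>

definition cadlag :: "(real \<Rightarrow> real) \<Rightarrow> bool" where
  "cadlag f \<longleftrightarrow> (\<forall>t\<ge>0. (f \<longlongrightarrow> f t) (at_right t)) \<and> (\<forall>t>0. \<exists>l. (f \<longlongrightarrow> l) (at_left t))"

text \<open>On the diagonal this is $\overline F(s) + \overline G(s) - (\overline F(s) - \overline G(s))^2$.\<close>

definition GP_cov :: "'a measure \<Rightarrow> ('a \<Rightarrow> real) \<Rightarrow> ('a \<Rightarrow> real) \<Rightarrow> real \<Rightarrow> real \<Rightarrow> real" where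
  "GP_cov M X Y s t =
     diff_surv M X Y (max s t) + diff_surv M Y X (max s t)
     - (diff_surv M X Y s - diff_surv M Y X s) * (diff_surv M X Y t - diff_surv M Y X t)"

text \<open>
  A random element \<open>GP\<close> of $D([0,\infty))$ that is a centred Gaussian process with covariance
  \<open>GP_cov\<close>.  The path regularity together with the finite-dimensional laws determines the
  law of \<open>GP\<close> on $D([0,\infty))$; without it the law of the supremum would not be determined.
\<close>

definition is_GP ::
    "'a measure \<Rightarrow> ('a \<Rightarrow> real) \<Rightarrow> ('a \<Rightarrow> real) \<Rightarrow> 'b measure \<Rightarrow> (real \<Rightarrow> 'b \<Rightarrow> real) \<Rightarrow> bool"
where
  "is_GP M X Y N GP \<longleftrightarrow>
     (\<forall>\<omega>\<in>space N. cadlag (\<lambda>t. GP t \<omega>)) \<and>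
     (\<forall>k t. (\<forall>i\<in>{1..k}. t i \<ge> 0) \<longrightarrow>
        multivariate_normal N k (\<lambda>i. GP (t i)) (\<lambda>_. 0) (\<lambda>i j. GP_cov M X Y (t i) (t j)))"

end

theory Submission
  imports Defs
begin

text \<open>
  Write $H = \overline F - \overline G \le 0$ and $\Delta_n$ for the centred empirical process, so that
  $S_n = \sup_t (\Delta_n(t) + \sqrt n\, H(t))$.  Where $H < 0$ the drift tends to $-\infty$, so for
  $c > 0$ only the contact set $E = \{H = 0\}$ contributes to the limit, and the limit is bounded by the
  tail of $\sup_E GP \le \sup GP$.  To make this rigorous, $\Delta_n$ is reduced to finitely many
  points by a chaining bound on its oscillation (fourth moments on a dyadic grid), and the
  finite-dimensional laws converge because all characteristic functions do.

  The limit exists because $\sup_E GP$ has no atom at $c > 0$: on $E$ the covariance of $GP(t)$ and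
  $GP(T_0)$, $t \le T_0$, does not depend on $t$, so $\max_t GP(t)$ is the sum of a nondegenerate
  normal variable and an independent one.  For $c \le 0$ one has $P(\sup GP > c) = 1$: normalised
  values $GP(s_n)$ along $s_n \to \infty$ become independent of any finite part of the process, so
  $\alpha = P(\forall n.\, GP(s_n) \le 0)$ satisfies $\alpha \le \theta \alpha$ with $\theta < 1$.
\<close>

section \<open>Convergence of characteristic functions and expectations of products\<close>

text \<open>The event that a maximum over finitely many points stays below c is an intersection of
  one-coordinate events. After smoothing, only expectations of products of one-coordinate functions
  are needed, and these can be treated one coordinate at a time, starting from cosines of linear
  combinations. Second moments are too weak for the chaining: 2^k increments of variance about 2^-k
  give a union bound of order at least 1 on every level, while fourth moments gain a further factor
  2^-k. The gain lasts only as long as 2^k \<le> n, so the grid stops at the level K with 2^K \<le>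
  n < 2^(K+1), and monotonicity closes the remaining gap. The limit is never named: for c > 0 and
  every e, finitely many contact points give a number r \<le> q such that the probabilities are
  eventually within e of r, and a Cauchy argument does the rest. The threshold 0 stands apart,
  because the statistic is nonnegative and may converge to 0, so that its limit law may have an atom
  there.\<close>

inductive trig_poly :: "(real \<Rightarrow> real) \<Rightarrow> bool" where
  cos: "trig_poly (\<lambda>x. c * cos (\<theta> * x + \<phi>))"
| add: "trig_poly p \<Longrightarrow> trig_poly q \<Longrightarrow> trig_poly (\<lambda>x. p x + q x)"

lemma trig_poly_const: "trig_poly (\<lambda>x. c)"
  using trig_poly.cos[of c 0 0] by simp

text \<open>The product-to-sum formula is the whole content. The free phase of the constructor
  \<open>cos\<close> covers constants (\<open>\<theta> = 0\<close>) and sines, so the span of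
  phase-shifted cosines is an algebra.\<close>

lemma trig_poly_mult_cos:
  assumes "trig_poly p" shows "trig_poly (\<lambda>x. p x * (c * cos (\<theta> * x + \<phi>)))"
  using assms
proof induction
  case (cos d \<theta>' \<phi>')
  have "(\<lambda>x. d * cos (\<theta>' * x + \<phi>') * (c * cos (\<theta> * x + \<phi>)))
      = (\<lambda>x. (c * d / 2) * cos ((\<theta>' - \<theta>) * x + (\<phi>' - \<phi>)) + (c * d / 2) * cos ((\<theta>' + \<theta>) * x + (\<phi>' + \<phi>)))"
  proof
    fix x
    have "cos (\<theta>' * x + \<phi>') * cos (\<theta> * x + \<phi>) =
        (cos ((\<theta>' - \<theta>) * x + (\<phi>' - \<phi>)) + cos ((\<theta>' + \<theta>) * x + (\<phi>' + \<phi>))) / 2"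
      by (subst cos_times_cos) (simp add: algebra_simps)
    then have "d * c * (cos (\<theta>' * x + \<phi>') * cos (\<theta> * x + \<phi>)) =
        d * c * ((cos ((\<theta>' - \<theta>) * x + (\<phi>' - \<phi>)) + cos ((\<theta>' + \<theta>) * x + (\<phi>' + \<phi>))) / 2)"
      by (simp only:)
    then show "d * cos (\<theta>' * x + \<phi>') * (c * cos (\<theta> * x + \<phi>)) =
        (c * d / 2) * cos ((\<theta>' - \<theta>) * x + (\<phi>' - \<phi>)) + (c * d / 2) * cos ((\<theta>' + \<theta>) * x + (\<phi>' + \<phi>))"
      by (simp add: field_simps)
  qed
  then show ?case by (simp only: trig_poly.intros)
next
  case (add p q)
  then show ?case by (simp add: distrib_right trig_poly.add)
qed

lemma trig_poly_mult:
  assumes "trig_poly q" "trig_poly p" shows "trig_poly (\<lambda>x. p x * q x)"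
  using assms
  by (induction) (auto simp: distrib_left intro: trig_poly_mult_cos trig_poly.add)

lemma trig_poly_polynomial_sin:
  assumes "real_polynomial_function p" shows "trig_poly (\<lambda>x. p (sin (a * x)))"
  using assms
proof induction
  case (linear f)
  have f: "f y = f 1 * y" for y
    using linear_cmul[OF bounded_linear.linear[OF linear], of y 1] by (simp add: mult.commute)
  have "f (sin (a * x)) = f 1 * cos (a * x + (- (pi / 2)))" for x
    by (subst f) (simp add: cos_diff)
  then show ?case by (simp only: trig_poly.cos)
qed (auto intro: trig_poly_const trig_poly.add trig_poly_mult)

lemma trig_poly_continuous: "trig_poly p \<Longrightarrow> continuous_on UNIV p"
  by (induction rule: trig_poly.induct) (auto intro!: continuous_intros)

text \<open>Approximating \<open>y \<mapsto> g (L * arcsin y)\<close> by polynomials, instead of \<open>g\<close> by trigonometric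
  polynomials of some period, keeps the approximant bounded off \<open>[-L, L]\<close>.\<close>

lemma trig_poly_approx:
  fixes g :: "real \<Rightarrow> real"
  assumes g: "continuous_on UNIV g" "\<And>x. \<bar>g x\<bar> \<le> 1" and "0 < e" "0 < L"
  obtains q where "trig_poly q" "\<And>x. \<bar>x\<bar> \<le> L \<Longrightarrow> \<bar>g x - q x\<bar> \<le> e" "\<And>x. \<bar>q x\<bar> \<le> 1 + e"
proof -
  have "continuous_on {-1..1} (\<lambda>y. g (L * arcsin y))"
    by (rule continuous_on_compose2[OF g(1)]) (auto intro!: continuous_intros)
  then obtain p where p: "real_polynomial_function p" "\<And>y. y \<in> {-1..1} \<Longrightarrow> \<bar>g (L * arcsin y) - p y\<bar> < e"
    using Stone_Weierstrass_real_polynomial_function[of "{-1..1::real}" "\<lambda>y. g (L * arcsin y)" e] \<open>0 < e\<close>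
    by auto
  let ?q = "\<lambda>x. p (sin (1 / L * x))"
  have 1: "\<bar>g (L * arcsin (sin (1 / L * x))) - ?q x\<bar> \<le> e" for x
    using p(2)[of "sin (1 / L * x)"] by (simp add: less_imp_le)
  show thesis
  proof
    show "trig_poly ?q" using trig_poly_polynomial_sin[OF p(1)] .
    show "\<bar>g x - ?q x\<bar> \<le> e" if "\<bar>x\<bar> \<le> L" for x
    proof -
      \<comment> \<open>Since 1 < pi/2, \<open>arcsin\<close> inverts \<open>sin\<close> on the
        whole range of x / L; this fixes the scale L inside the sine.\<close>
      have "\<bar>1 / L * x\<bar> \<le> 1" using that \<open>0 < L\<close> by (simp add: abs_mult)
      then have "arcsin (sin (1 / L * x)) = 1 / L * x"
        using pi_gt3 by (intro arcsin_sin) linarith+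
      then have "L * arcsin (sin (1 / L * x)) = x" using \<open>0 < L\<close> by simp
      then show ?thesis using 1[of x] by metis
    qed
    show "\<bar>?q x\<bar> \<le> 1 + e" for x using 1[of x] g(2)[of "L * arcsin (sin (1 / L * x))"] by linarith
  qed
qed

lemma LIMSEQ_approx:
  fixes x :: "nat \<Rightarrow> real"
  assumes "\<And>e. 0 < e \<Longrightarrow> \<exists>y y'. y \<longlonglongrightarrow> y' \<and> (\<forall>n. \<bar>x n - y n\<bar> \<le> e) \<and> \<bar>x' - y'\<bar> \<le> e"
  shows "x \<longlonglongrightarrow> x'"
proof (rule LIMSEQ_I)
  fix e :: real assume "0 < e"
  then obtain y y' where y: "y \<longlonglongrightarrow> y'" "\<And>n. \<bar>x n - y n\<bar> \<le> e / 4" "\<bar>x' - y'\<bar> \<le> e / 4"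
    using assms[of "e / 4"] by auto
  obtain n0 where n0: "\<And>n. n \<ge> n0 \<Longrightarrow> \<bar>y n - y'\<bar> < e / 4"
    using LIMSEQ_D[OF y(1), of "e / 4"] \<open>0 < e\<close> by auto
  have "norm (x n - x') < e" if "n \<ge> n0" for n
    unfolding real_norm_def using n0[OF that] y(2)[of n] y(3) \<open>0 < e\<close> by linarith
  then show "\<exists>no. \<forall>n\<ge>no. norm (x n - x') < e" by blast
qed

text \<open>Where |A| \<le> L the factor changes by at most e; elsewhere it changes by at most 2 +
  e, on an event of probability at most e. The sum e + (2 + e) e is at most 4 e because e \<le> 1.
  The function u stands for the remaining factors of a product.\<close>

lemma (in prob_space) expectation_replace_factor:
  fixes A :: "'a \<Rightarrow> real"
  assumes [measurable]: "u \<in> borel_measurable M" "A \<in> borel_measurable M"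
    "g \<in> borel_measurable borel" "q \<in> borel_measurable borel"
  assumes u: "\<And>\<omega>. \<bar>u \<omega>\<bar> \<le> 1" and g: "\<And>x. \<bar>g x\<bar> \<le> 1"
    and q: "\<And>x. \<bar>x\<bar> \<le> L \<Longrightarrow> \<bar>g x - q x\<bar> \<le> e" "\<And>x. \<bar>q x\<bar> \<le> 1 + e" and e: "0 < e" "e \<le> 1"
    and P: "prob {\<omega> \<in> space M. \<bar>A \<omega>\<bar> > L} \<le> e"
  shows "\<bar>(\<integral>\<omega>. u \<omega> * g (A \<omega>) \<partial>M) - (\<integral>\<omega>. u \<omega> * q (A \<omega>) \<partial>M)\<bar> \<le> 4 * e"
proof -
  have "\<bar>u \<omega> * g (A \<omega>)\<bar> \<le> 1 * 1" for \<omega>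
    unfolding abs_mult by (intro mult_mono u g) auto
  then have i1: "integrable M (\<lambda>\<omega>. u \<omega> * g (A \<omega>))"
    by (intro integrable_const_bound[where B=1]) auto
  have "\<bar>u \<omega> * q (A \<omega>)\<bar> \<le> 1 * (1 + e)" for \<omega>
    unfolding abs_mult by (intro mult_mono u q) auto
  then have i2: "integrable M (\<lambda>\<omega>. u \<omega> * q (A \<omega>))"
    by (intro integrable_const_bound[where B="1 + e"]) auto
  let ?I = "\<lambda>\<omega>. indicator {\<omega> \<in> space M. \<bar>A \<omega>\<bar> > L} \<omega> :: real"
  have S: "{\<omega> \<in> space M. \<bar>A \<omega>\<bar> > L} \<in> events" by measurable
  have Ii: "integrable M (\<lambda>\<omega>. (2 + e) * ?I \<omega>)"
    by (intro integrable_mult_right integrable_real_indicator S) (simp add: less_top[symmetric])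
  have "\<bar>(\<integral>\<omega>. u \<omega> * g (A \<omega>) \<partial>M) - (\<integral>\<omega>. u \<omega> * q (A \<omega>) \<partial>M)\<bar>
      = \<bar>\<integral>\<omega>. u \<omega> * g (A \<omega>) - u \<omega> * q (A \<omega>) \<partial>M\<bar>"
    using i1 i2 by simp
  also have "\<dots> \<le> (\<integral>\<omega>. \<bar>u \<omega> * g (A \<omega>) - u \<omega> * q (A \<omega>)\<bar> \<partial>M)"
    by (rule integral_abs_bound)
  also have "\<dots> \<le> (\<integral>\<omega>. e + (2 + e) * ?I \<omega> \<partial>M)"
  proof (rule integral_mono)
    show "integrable M (\<lambda>\<omega>. \<bar>u \<omega> * g (A \<omega>) - u \<omega> * q (A \<omega>)\<bar>)" using i1 i2 by simp
    show "integrable M (\<lambda>\<omega>. e + (2 + e) * ?I \<omega>)"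
      using Ii by simp
    fix \<omega> assume \<omega>: "\<omega> \<in> space M"
    have "\<bar>u \<omega> * g (A \<omega>) - u \<omega> * q (A \<omega>)\<bar> = \<bar>u \<omega>\<bar> * \<bar>g (A \<omega>) - q (A \<omega>)\<bar>"
      by (simp add: abs_mult flip: right_diff_distrib)
    also have "\<dots> \<le> 1 * \<bar>g (A \<omega>) - q (A \<omega>)\<bar>" by (intro mult_right_mono u) auto
    also have "\<dots> \<le> e + (2 + e) * ?I \<omega>"
    proof (cases "\<bar>A \<omega>\<bar> > L")
      case True
      then show ?thesis using \<omega> g[of "A \<omega>"] q(2)[of "A \<omega>"] e by simp
    next
      case False
      then show ?thesis using q(1)[of "A \<omega>"] by simp
    qed
    finally show "\<bar>u \<omega> * g (A \<omega>) - u \<omega> * q (A \<omega>)\<bar> \<le> e + (2 + e) * ?I \<omega>" .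
  qed
  also have "\<dots> = e + (2 + e) * prob {\<omega> \<in> space M. \<bar>A \<omega>\<bar> > L}"
    using Ii S by (simp add: prob_space)
  also have "\<dots> \<le> e + (2 + e) * e" using P e by (intro add_left_mono mult_left_mono) auto
  also have "\<dots> \<le> e + (2 + 1) * e" using e by (intro add_left_mono mult_right_mono) auto
  finally show ?thesis by simp
qed

text \<open>Induction over the set J of factors already present. A cosine of an arbitrary linear
  combination of all coordinates is carried along: replacing g k by a trigonometric polynomial in
  coordinate k and applying the product-to-sum formula returns expressions of the same shape with
  other coefficients, to which the induction hypothesis applies. Tightness makes the replacement
  uniform in n. With a constant sequence the result becomes a uniqueness statement.\<close>

lemma tendsto_expectation_prod_of_cos:
  fixes A :: "nat \<Rightarrow> 'i \<Rightarrow> 'a \<Rightarrow> real" and B :: "'i \<Rightarrow> 'b \<Rightarrow> real" and g :: "'i \<Rightarrow> real \<Rightarrow> real"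
  assumes "prob_space M" "prob_space N" "finite I"
    and A[measurable]: "\<And>n j. j \<in> I \<Longrightarrow> A n j \<in> borel_measurable M"
    and B[measurable]: "\<And>j. j \<in> I \<Longrightarrow> B j \<in> borel_measurable N"
    and conv: "\<And>a b. (\<lambda>n. \<integral>\<omega>. cos ((\<Sum>j\<in>I. a j * A n j \<omega>) + b) \<partial>M)
                 \<longlonglongrightarrow> (\<integral>\<omega>. cos ((\<Sum>j\<in>I. a j * B j \<omega>) + b) \<partial>N)"
    and tight: "\<And>j e. j \<in> I \<Longrightarrow> 0 < e \<Longrightarrow> \<exists>L>0. (\<forall>n. measure M {\<omega> \<in> space M. \<bar>A n j \<omega>\<bar> > L} \<le> e)
                  \<and> measure N {\<omega> \<in> space N. \<bar>B j \<omega>\<bar> > L} \<le> e"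
    and g: "\<And>j. j \<in> I \<Longrightarrow> continuous_on UNIV (g j)" "\<And>j x. j \<in> I \<Longrightarrow> \<bar>g j x\<bar> \<le> 1"
  shows "(\<lambda>n. \<integral>\<omega>. (\<Prod>j\<in>I. g j (A n j \<omega>)) \<partial>M) \<longlonglongrightarrow> (\<integral>\<omega>. (\<Prod>j\<in>I. g j (B j \<omega>)) \<partial>N)"
proof -
  interpret M: prob_space M by fact
  interpret N: prob_space N by fact
  have gm[measurable]: "g j \<in> borel_measurable borel" if "j \<in> I" for j
    using g(1)[OF that] by (rule borel_measurable_continuous_onI)
  have "(\<lambda>n. \<integral>\<omega>. cos ((\<Sum>j\<in>I. a j * A n j \<omega>) + b) * (\<Prod>j\<in>J. g j (A n j \<omega>)) \<partial>M)
        \<longlonglongrightarrow> (\<integral>\<omega>. cos ((\<Sum>j\<in>I. a j * B j \<omega>) + b) * (\<Prod>j\<in>J. g j (B j \<omega>)) \<partial>N)"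
    if "finite J" "J \<subseteq> I" for J a b
    using that
  proof (induction J arbitrary: a b rule: finite_induct)
    case empty
    then show ?case using conv[of a b] by simp
  next
    case (insert k J)
    then have k: "k \<in> I" and J: "J \<subseteq> I" "finite J" by auto
    define u where "u a b n \<omega> = cos ((\<Sum>j\<in>I. a j * A n j \<omega>) + b) * (\<Prod>j\<in>J. g j (A n j \<omega>))" for a b n \<omega>
    define v where "v a b \<omega> = cos ((\<Sum>j\<in>I. a j * B j \<omega>) + b) * (\<Prod>j\<in>J. g j (B j \<omega>))" for a b \<omega>
    have IH: "(\<lambda>n. \<integral>\<omega>. u a b n \<omega> \<partial>M) \<longlonglongrightarrow> (\<integral>\<omega>. v a b \<omega> \<partial>N)" for a b
      unfolding u_def v_def using insert.IH[OF J(1)] .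
    have um[measurable]: "u a b n \<in> borel_measurable M" for a b n
      unfolding u_def using A J
      by (intro borel_measurable_times borel_measurable_prod measurable_compose[OF _ gm]
            borel_measurable_cos borel_measurable_add borel_measurable_sum borel_measurable_const) auto
    have vm[measurable]: "v a b \<in> borel_measurable N" for a b
      unfolding v_def using B J
      by (intro borel_measurable_times borel_measurable_prod measurable_compose[OF _ gm]
            borel_measurable_cos borel_measurable_add borel_measurable_sum borel_measurable_const) auto
    have prod1: "\<bar>\<Prod>j\<in>J. g j (f j)\<bar> \<le> 1" for f
      unfolding abs_prod using J g(2) by (intro prod_le_1) auto
    have u1: "\<bar>u a b n \<omega>\<bar> \<le> 1" for a b n \<omega>
      unfolding u_def abs_mult using mult_mono[OF abs_cos_le_one prod1] by simp
    have v1: "\<bar>v a b \<omega>\<bar> \<le> 1" for a b \<omega>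
      unfolding v_def abs_mult using mult_mono[OF abs_cos_le_one prod1] by simp
    have ui: "integrable M (u a b n)" for a b n
      by (rule M.integrable_const_bound[where B=1]) (auto simp: u1)
    have vi: "integrable N (v a b)" for a b
      by (rule N.integrable_const_bound[where B=1]) (auto simp: v1)
    have Ak[measurable]: "A n k \<in> borel_measurable M" for n using A k by auto
    have Bk[measurable]: "B k \<in> borel_measurable N" using B k by auto
    \<comment> \<open>\<open>a1\<close> and \<open>a2\<close> are the coefficients of the new angle
      \<theta> x k + \<phi> minus, respectively plus, the angle of the old cosine; only the
      coefficient of coordinate k mixes the two.\<close>
    define a1 where "a1 a \<theta> = (\<lambda>j. if j = k then \<theta> - a k else - a j)" for a :: "'i \<Rightarrow> real" and \<theta>
    define a2 where "a2 a \<theta> = a(k := \<theta> + a k)" for a :: "'i \<Rightarrow> real" and \<theta>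
    have shift': "cos (\<theta> * x k + \<phi>) * cos ((\<Sum>j\<in>I. a j * x j) + b)
        = cos ((\<Sum>j\<in>I. a1 a \<theta> j * x j) + (\<phi> - b)) / 2
        + cos ((\<Sum>j\<in>I. a2 a \<theta> j * x j) + (\<phi> + b)) / 2" for \<theta> \<phi> x a b
    proof -
      note r = sum.remove[OF \<open>finite I\<close> k]
      have e2: "(\<Sum>j\<in>I. a2 a \<theta> j * x j) = \<theta> * x k + (\<Sum>j\<in>I. a j * x j)"
        using r[of "\<lambda>j. a2 a \<theta> j * x j"] r[of "\<lambda>j. a j * x j"]
        by (simp add: a2_def algebra_simps)
      have e1: "(\<Sum>j\<in>I. a1 a \<theta> j * x j) = \<theta> * x k - (\<Sum>j\<in>I. a j * x j)"
        using r[of "\<lambda>j. a1 a \<theta> j * x j"] r[of "\<lambda>j. a j * x j"]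
        by (simp add: a1_def algebra_simps sum_negf)
      show ?thesis unfolding e1 e2 cos_times_cos by (simp add: algebra_simps add_divide_distrib)
    qed
    have su: "u a b n \<omega> * (c * cos (\<theta> * A n k \<omega> + \<phi>))
        = c / 2 * u (a1 a \<theta>) (\<phi> - b) n \<omega> + c / 2 * u (a2 a \<theta>) (\<phi> + b) n \<omega>" for a b n \<omega> c \<theta> \<phi>
    proof -
      have "u a b n \<omega> * (c * cos (\<theta> * A n k \<omega> + \<phi>)) = c * (\<Prod>j\<in>J. g j (A n j \<omega>)) *
          (cos (\<theta> * A n k \<omega> + \<phi>) * cos ((\<Sum>j\<in>I. a j * A n j \<omega>) + b))"
        unfolding u_def by simp
      then show ?thesis unfolding shift'[of \<theta> "\<lambda>j. A n j \<omega>"] u_def by (simp add: field_simps)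
    qed
    have sv: "v a b \<omega> * (c * cos (\<theta> * B k \<omega> + \<phi>))
        = c / 2 * v (a1 a \<theta>) (\<phi> - b) \<omega> + c / 2 * v (a2 a \<theta>) (\<phi> + b) \<omega>" for a b \<omega> c \<theta> \<phi>
    proof -
      have "v a b \<omega> * (c * cos (\<theta> * B k \<omega> + \<phi>)) = c * (\<Prod>j\<in>J. g j (B j \<omega>)) *
          (cos (\<theta> * B k \<omega> + \<phi>) * cos ((\<Sum>j\<in>I. a j * B j \<omega>) + b))"
        unfolding v_def by simp
      then show ?thesis unfolding shift'[of \<theta> "\<lambda>j. B j \<omega>"] v_def by (simp add: field_simps)
    qed
    have trig: "(\<forall>n. integrable M (\<lambda>\<omega>. u a b n \<omega> * q (A n k \<omega>))) \<and> integrable N (\<lambda>\<omega>. v a b \<omega> * q (B k \<omega>))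
       \<and> (\<lambda>n. \<integral>\<omega>. u a b n \<omega> * q (A n k \<omega>) \<partial>M) \<longlonglongrightarrow> (\<integral>\<omega>. v a b \<omega> * q (B k \<omega>) \<partial>N)"
      if "trig_poly q" for q
      using that
    proof induction
      case (cos c \<theta> \<phi>)
      show ?case unfolding su sv using ui vi by (auto intro!: tendsto_intros IH)
    next
      case (add p q)
      then show ?case by (auto simp: distrib_left intro!: tendsto_intros)
    qed
    have "(\<lambda>n. \<integral>\<omega>. u a b n \<omega> * g k (A n k \<omega>) \<partial>M) \<longlonglongrightarrow> (\<integral>\<omega>. v a b \<omega> * g k (B k \<omega>) \<partial>N)"
    proof (rule LIMSEQ_approx)
      fix e0 :: real assume "0 < e0"
      define e where "e = min 1 (e0 / 4)"
      have e: "0 < e" "e \<le> 1" "4 * e \<le> e0" using \<open>0 < e0\<close> by (auto simp: e_def)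
      obtain L where L: "0 < L" "\<And>n. measure M {\<omega> \<in> space M. \<bar>A n k \<omega>\<bar> > L} \<le> e"
          "measure N {\<omega> \<in> space N. \<bar>B k \<omega>\<bar> > L} \<le> e"
        using tight[OF k e(1)] by blast
      obtain q where q: "trig_poly q" "\<And>x. \<bar>x\<bar> \<le> L \<Longrightarrow> \<bar>g k x - q x\<bar> \<le> e" "\<And>x. \<bar>q x\<bar> \<le> 1 + e"
        using trig_poly_approx[OF g(1)[OF k] g(2)[OF k] e(1) L(1)] by blast
      have qm: "q \<in> borel_measurable borel"
        using trig_poly_continuous[OF q(1)] by (rule borel_measurable_continuous_onI)
      have "\<bar>(\<integral>\<omega>. u a b n \<omega> * g k (A n k \<omega>) \<partial>M) - (\<integral>\<omega>. u a b n \<omega> * q (A n k \<omega>) \<partial>M)\<bar> \<le> 4 * e" for n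
        by (rule M.expectation_replace_factor[OF um Ak gm[OF k] qm u1 g(2)[OF k] q(2,3) e(1,2) L(2)])
      moreover have "\<bar>(\<integral>\<omega>. v a b \<omega> * g k (B k \<omega>) \<partial>N) - (\<integral>\<omega>. v a b \<omega> * q (B k \<omega>) \<partial>N)\<bar> \<le> 4 * e"
        by (rule N.expectation_replace_factor[OF vm Bk gm[OF k] qm v1 g(2)[OF k] q(2,3) e(1,2) L(3)])
      ultimately show "\<exists>y y'. y \<longlonglongrightarrow> y' \<and> (\<forall>n. \<bar>(\<integral>\<omega>. u a b n \<omega> * g k (A n k \<omega>) \<partial>M) - y n\<bar> \<le> e0)
          \<and> \<bar>(\<integral>\<omega>. v a b \<omega> * g k (B k \<omega>) \<partial>N) - y'\<bar> \<le> e0"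
        using trig[OF q(1)] e(3) order_trans[OF _ e(3)]
        by (intro exI[of _ "\<lambda>n. \<integral>\<omega>. u a b n \<omega> * q (A n k \<omega>) \<partial>M"]
              exI[of _ "\<integral>\<omega>. v a b \<omega> * q (B k \<omega>) \<partial>N"]) simp
    qed
    then show ?case using insert.hyps by (simp add: u_def v_def mult_ac)
  qed
  \<comment> \<open>With all coefficients 0 the auxiliary cosine is 1.\<close>
  from this[OF \<open>finite I\<close> order_refl, of "\<lambda>_. 0" 0] show ?thesis by simp
qed

section \<open>Gaussian processes\<close>

text \<open>The phase b lets one real integral carry both the real and the imaginary part of the
  characteristic function, which is why cosines with phases replace complex exponentials
  throughout.\<close>

lemma (in prob_space) expectation_cos_eq_char:
  assumes [measurable]: "X \<in> borel_measurable M"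
  shows "(\<integral>\<omega>. cos (t * X \<omega> + b) \<partial>M)
    = cos b * Re (char (distr M borel X) t) - sin b * Im (char (distr M borel X) t)"
proof -
  have i: "integrable M (\<lambda>\<omega>. iexp (t * X \<omega>))"
    by (rule integrable_const_bound[where B=1]) auto
  have c: "char (distr M borel X) t = (\<integral>\<omega>. iexp (t * X \<omega>) \<partial>M)"
    unfolding char_def by (subst integral_distr) auto
  have R: "Re (char (distr M borel X) t) = (\<integral>\<omega>. cos (t * X \<omega>) \<partial>M)"
    unfolding c using integral_Re[OF i] by (simp add: Re_exp)
  have I: "Im (char (distr M borel X) t) = (\<integral>\<omega>. sin (t * X \<omega>) \<partial>M)"
    unfolding c using integral_Im[OF i] by (simp add: Im_exp)
  have 1: "integrable M (\<lambda>\<omega>. cos (t * X \<omega>))" "integrable M (\<lambda>\<omega>. sin (t * X \<omega>))"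
    by (auto intro!: integrable_const_bound[where B=1])
  have "(\<integral>\<omega>. cos (t * X \<omega> + b) \<partial>M) = (\<integral>\<omega>. cos b * cos (t * X \<omega>) - sin b * sin (t * X \<omega>) \<partial>M)"
    by (simp add: cos_add mult.commute)
  also have "\<dots> = cos b * (\<integral>\<omega>. cos (t * X \<omega>) \<partial>M) - sin b * (\<integral>\<omega>. sin (t * X \<omega>) \<partial>M)"
    using 1 by simp
  finally show ?thesis unfolding R I .
qed

lemma (in prob_space) second_moment_tail:
  fixes X :: "'a \<Rightarrow> real"
  assumes [measurable]: "X \<in> borel_measurable M" and "integrable M (\<lambda>\<omega>. (X \<omega>)\<^sup>2)"
    and "expectation (\<lambda>\<omega>. (X \<omega>)\<^sup>2) \<le> C" "0 < L"
  shows "prob {\<omega> \<in> space M. \<bar>X \<omega>\<bar> > L} \<le> C / L\<^sup>2"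
proof -
  have "prob {\<omega> \<in> space M. \<bar>X \<omega>\<bar> > L} \<le> prob {\<omega> \<in> space M. (X \<omega>)\<^sup>2 \<ge> L\<^sup>2}"
  proof (rule finite_measure_mono)
    show "{\<omega> \<in> space M. \<bar>X \<omega>\<bar> > L} \<subseteq> {\<omega> \<in> space M. (X \<omega>)\<^sup>2 \<ge> L\<^sup>2}"
      using assms(4) by (auto simp flip: abs_le_square_iff)
  qed measurable
  also have "\<dots> \<le> expectation (\<lambda>\<omega>. (X \<omega>)\<^sup>2) / L\<^sup>2"
    by (rule integral_Markov_inequality_measure[where A="space M - space M"]) (use assms in auto)
  also have "\<dots> \<le> C / L\<^sup>2" using assms(3) by (intro divide_right_mono) auto
  finally show ?thesis .
qed

lemma exists_tail_bound:
  fixes C e :: real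
  assumes "0 < e" "0 \<le> C" obtains L where "0 < L" "C / L\<^sup>2 \<le> e"
proof
  show "0 < sqrt ((C + 1) / e)" using assms by simp
  show "C / (sqrt ((C + 1) / e))\<^sup>2 \<le> e" using assms by (simp add: field_simps)
qed

lemma normal_rv_integrable_square:
  assumes "prob_space N" "normal_rv N Z"
  shows "integrable N (\<lambda>\<omega>. (Z \<omega>)\<^sup>2)"
proof -
  interpret prob_space N by fact
  have [measurable]: "Z \<in> borel_measurable N" using assms by (auto simp: normal_rv_def)
  from assms(2) consider m where "distr N borel Z = return borel m"
    | m s where "0 < s" "distributed N lborel Z (\<lambda>x. ennreal (normal_density m s x))"
    unfolding normal_rv_def by blast
  then show ?thesis
  proof cases
    case 1
    interpret R: prob_space "return borel m" by (rule prob_space_return) simp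
    have "integrable (distr N borel Z) (\<lambda>x. x\<^sup>2)" unfolding 1
      by (subst integrable_cong_AE[where g="\<lambda>_. m\<^sup>2"]) (auto simp: AE_return)
    then show ?thesis by (simp add: integrable_distr_eq)
  next
    case 2
    \<comment> \<open>x^2 is expanded about m, so that only central moments of the density
      occur.\<close>
    have "integrable lborel (\<lambda>x. normal_density m s x * (x - m)^2 + 2 * m * (normal_density m s x * (x - m)^1)
        + m\<^sup>2 * normal_density m s x)"
      using 2(1) by (intro Bochner_Integration.integrable_add integrable_mult_right integrable_normal_moment) auto
    then have "integrable lborel (\<lambda>x. normal_density m s x * x\<^sup>2)"
      by (rule Bochner_Integration.integrable_cong[THEN iffD1, rotated -1])
        (auto simp: power2_eq_square algebra_simps)
    then show ?thesis using distributed_integrable[OF 2(2), of "\<lambda>x. x\<^sup>2"] by simp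
  qed
qed

text \<open>Standardising reduces the density case to the characteristic function of the standard
  normal law at s. A point mass with mean 0 sits at 0 and satisfies the same formula with variance
  0, so singular covariances need no separate treatment below.\<close>

lemma normal_rv_expectation_cos:
  assumes "prob_space N" "normal_rv N Z" and Z0: "(\<integral>\<omega>. Z \<omega> \<partial>N) = 0"
  shows "(\<integral>\<omega>. cos (Z \<omega> + b) \<partial>N) = cos b * exp (- (\<integral>\<omega>. (Z \<omega>)\<^sup>2 \<partial>N) / 2)"
proof -
  interpret prob_space N by fact
  have [measurable]: "Z \<in> borel_measurable N" using assms by (auto simp: normal_rv_def)
  from assms(2) consider m where "distr N borel Z = return borel m"
    | m s where "0 < s" "distributed N lborel Z (\<lambda>x. ennreal (normal_density m s x))"
    unfolding normal_rv_def by blast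
  then show ?thesis
  proof cases
    case 1
    have e: "(\<integral>\<omega>. f (Z \<omega>) \<partial>N) = f m" if [measurable]: "f \<in> borel_measurable borel" for f :: "real \<Rightarrow> real"
      using integral_distr[of Z N borel f] integral_return[of m borel f] unfolding 1 by simp
    have "m = 0" using e[of "\<lambda>x. x"] Z0 by simp
    then show ?thesis using e[of "\<lambda>x. cos (x + b)"] e[of "\<lambda>x. x\<^sup>2"] by simp
  next
    case 2
    have m: "m = 0" using normal_distributed_expectation[OF 2] Z0 by simp
    have v: "(\<integral>\<omega>. (Z \<omega>)\<^sup>2 \<partial>N) = s\<^sup>2" using normal_distributed_variance[OF 2] Z0 by simp
    have D: "distributed N lborel (\<lambda>x. Z x / s) (\<lambda>x. ennreal (std_normal_density x))"
      using 2 normal_standard_normal_convert[OF 2(1), of Z m] m by simp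
    have "distr N borel (\<lambda>x. Z x / s) = std_normal_distribution"
      using distributed_distr_eq_density[OF D]
      by (simp cong: distr_cong)
    then have "char (distr N borel (\<lambda>x. Z x / s)) s = complex_of_real (exp (- (s\<^sup>2) / 2))"
      by (simp add: char_std_normal_distribution)
    then show ?thesis using expectation_cos_eq_char[of "\<lambda>x. Z x / s" s b] 2(1) by (simp add: v)
  qed
qed

definition quad_form :: "('t \<Rightarrow> 't \<Rightarrow> real) \<Rightarrow> 't set \<Rightarrow> ('t \<Rightarrow> real) \<Rightarrow> real" where
  "quad_form K T a = (\<Sum>s\<in>T. \<Sum>t\<in>T. a s * a t * K s t)"

lemma expectation_square_sum:
  fixes a :: "'t \<Rightarrow> real"
  assumes "finite T" "\<And>s t. s \<in> T \<Longrightarrow> t \<in> T \<Longrightarrow> integrable N (\<lambda>\<omega>. V s \<omega> * V t \<omega>)"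
  shows "(\<integral>\<omega>. (\<Sum>t\<in>T. a t * V t \<omega>)\<^sup>2 \<partial>N) = quad_form (\<lambda>s t. \<integral>\<omega>. V s \<omega> * V t \<omega> \<partial>N) T a"
proof -
  have "(\<integral>\<omega>. (\<Sum>t\<in>T. a t * V t \<omega>)\<^sup>2 \<partial>N) = (\<integral>\<omega>. (\<Sum>s\<in>T. \<Sum>t\<in>T. a s * a t * (V s \<omega> * V t \<omega>)) \<partial>N)"
    by (simp add: power2_eq_square sum_product mult_ac)
  also have "\<dots> = (\<Sum>s\<in>T. \<Sum>t\<in>T. a s * a t * (\<integral>\<omega>. V s \<omega> * V t \<omega> \<partial>N))"
    using assms by (subst Bochner_Integration.integral_sum) (auto intro!: sum.cong)
  finally show ?thesis by (simp add: quad_form_def)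
qed

text \<open>\<open>GP_cos\<close> for all coefficients and phases is the joint characteristic
  function of \<open>GP\<close> on a finite set of times. Indexing by finite sets instead of tuples
  removes repetitions, and the symmetry of K merges the two cross terms of the quadratic
  form.\<close>

locale gaussian_process = prob_space N for N :: "'b measure" +
  fixes GP :: "real \<Rightarrow> 'b \<Rightarrow> real" and K :: "real \<Rightarrow> real \<Rightarrow> real"
  assumes cov_commute: "K s t = K t s"
    and GP_measurable: "0 \<le> t \<Longrightarrow> GP t \<in> borel_measurable N"
    and GP_square_integrable: "0 \<le> t \<Longrightarrow> integrable N (\<lambda>\<omega>. (GP t \<omega>)\<^sup>2)"
    and GP_normal: "0 \<le> t \<Longrightarrow> normal_rv N (GP t)"
    and GP_mean: "0 \<le> t \<Longrightarrow> (\<integral>\<omega>. GP t \<omega> \<partial>N) = 0"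
    and GP_variance: "0 \<le> t \<Longrightarrow> (\<integral>\<omega>. (GP t \<omega>)\<^sup>2 \<partial>N) = K t t"
    and GP_cos: "finite T \<Longrightarrow> T \<subseteq> {0..} \<Longrightarrow>
      (\<integral>\<omega>. cos ((\<Sum>t\<in>T. a t * GP t \<omega>) + b) \<partial>N) = cos b * exp (- quad_form K T a / 2)"

text \<open>Enumerating a finite set of times gives a tuple as in \<open>is_GP\<close>; the linear
  combination is then normal, and its variance is the quadratic form. The inequality |x y| \<le> x^2
  + y^2 makes the mixed products integrable, which the expansion of the variance requires.\<close>

lemma is_GP_gaussian_process:
  assumes "prob_space N" and GP: "is_GP M X Y N GP"
  shows "gaussian_process N GP (GP_cov M X Y)"
proof -
  interpret prob_space N by fact
  have mv: "multivariate_normal N k (\<lambda>i. GP (t i)) (\<lambda>_. 0) (\<lambda>i j. GP_cov M X Y (t i) (t j))"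
    if "\<And>i. i \<in> {1..k} \<Longrightarrow> t i \<ge> 0" for k t
    using GP that unfolding is_GP_def by blast
  have one: "normal_rv N (GP t) \<and> GP t \<in> borel_measurable N \<and> (\<integral>\<omega>. GP t \<omega> \<partial>N) = 0
     \<and> (\<integral>\<omega>. (GP t \<omega>)\<^sup>2 \<partial>N) = GP_cov M X Y t t" if "0 \<le> t" for t
  proof -
    have m: "multivariate_normal N 1 (\<lambda>i. GP t) (\<lambda>_. 0) (\<lambda>i j. GP_cov M X Y t t)"
      using mv[of 1 "\<lambda>_. t"] that by simp
    then have "normal_rv N (\<lambda>\<omega>. \<Sum>i=1..1::nat. 1 * GP t \<omega>)"
      unfolding multivariate_normal_def by (elim conjE allE[of _ "\<lambda>_. 1"])
    then show ?thesis using m unfolding multivariate_normal_def by (simp add: power2_eq_square)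
  qed
  have cos: "(\<integral>\<omega>. cos ((\<Sum>t\<in>T. a t * GP t \<omega>) + b) \<partial>N) = cos b * exp (- quad_form (GP_cov M X Y) T a / 2)"
    if T: "finite T" "T \<subseteq> {0..}" for T a b
  proof -
    obtain f where f: "bij_betw f {1..card T} T" using ex_bij_betw_nat_finite_1[OF T(1)] by blast
    let ?k = "card T"
    have fT: "f i \<in> T" if "i \<in> {1..?k}" for i using f that by (auto dest: bij_betwE)
    have m: "multivariate_normal N ?k (\<lambda>i. GP (f i)) (\<lambda>_. 0) (\<lambda>i j. GP_cov M X Y (f i) (f j))"
      using fT T(2) by (intro mv) auto
    have "normal_rv N (\<lambda>\<omega>. \<Sum>i=1..?k. a (f i) * GP (f i) \<omega>)"
      using m unfolding multivariate_normal_def by (elim conjE allE[of _ "\<lambda>i. a (f i)"])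
    then have nrv: "normal_rv N (\<lambda>\<omega>. \<Sum>t\<in>T. a t * GP t \<omega>)"
      using sum.reindex_bij_betw[OF f, of "\<lambda>t. a t * GP t _"] by simp
    have i: "integrable N (GP t)" "integrable N (\<lambda>\<omega>. GP s \<omega> * GP t \<omega>)" if "s \<in> T" "t \<in> T" for s t
    proof -
      have "0 \<le> s" "0 \<le> t" using that T by auto
      then have [measurable]: "GP s \<in> borel_measurable N" "GP t \<in> borel_measurable N"
        and sq: "integrable N (\<lambda>\<omega>. (GP s \<omega>)\<^sup>2)" "integrable N (\<lambda>\<omega>. (GP t \<omega>)\<^sup>2)"
        using one normal_rv_integrable_square[OF assms(1)] by auto
      show "integrable N (GP t)" using square_integrable_imp_integrable[of "GP t"] sq by auto
      show "integrable N (\<lambda>\<omega>. GP s \<omega> * GP t \<omega>)"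
      proof (rule Bochner_Integration.integrable_bound)
        show "integrable N (\<lambda>\<omega>. (GP s \<omega>)\<^sup>2 + (GP t \<omega>)\<^sup>2)" using sq by simp
        have "\<bar>x * y\<bar> \<le> x\<^sup>2 + y\<^sup>2" for x y :: real
          using sum_squares_bound[of "\<bar>x\<bar>" "\<bar>y\<bar>"] mult_nonneg_nonneg[of "\<bar>x\<bar>" "\<bar>y\<bar>"]
          unfolding abs_mult power2_abs by linarith
        then show "AE \<omega> in N. norm (GP s \<omega> * GP t \<omega>) \<le> norm ((GP s \<omega>)\<^sup>2 + (GP t \<omega>)\<^sup>2)" by simp
      qed auto
    qed
    have cov: "(\<integral>\<omega>. GP s \<omega> * GP t \<omega> \<partial>N) = GP_cov M X Y s t" if "s \<in> T" "t \<in> T" for s t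
    proof -
      have im: "T = f ` {1..?k}" using f unfolding bij_betw_def by blast
      obtain i where i: "i \<in> {1..?k}" "s = f i" using \<open>s \<in> T\<close> im by blast
      obtain j where j: "j \<in> {1..?k}" "t = f j" using \<open>t \<in> T\<close> im by blast
      show ?thesis using m i j unfolding multivariate_normal_def by simp
    qed
    have "(\<integral>\<omega>. (\<Sum>t\<in>T. a t * GP t \<omega>) \<partial>N) = (\<Sum>t\<in>T. a t * (\<integral>\<omega>. GP t \<omega> \<partial>N))"
      using i by (subst Bochner_Integration.integral_sum) auto
    also have "\<dots> = 0" using one T by (intro sum.neutral) auto
    finally have mean: "(\<integral>\<omega>. (\<Sum>t\<in>T. a t * GP t \<omega>) \<partial>N) = 0" .
    have "(\<integral>\<omega>. (\<Sum>t\<in>T. a t * GP t \<omega>)\<^sup>2 \<partial>N) = quad_form (GP_cov M X Y) T a"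
      by (subst expectation_square_sum[OF T(1) i(2)]) (auto simp: quad_form_def cov intro!: sum.cong)
    then show ?thesis using normal_rv_expectation_cos[OF assms(1) nrv mean, of b] by simp
  qed
  show ?thesis
    using one cos normal_rv_integrable_square[OF assms(1)]
    by unfold_locales (auto simp: GP_cov_def max.commute)
qed

section \<open>Maxima of Gaussian processes\<close>

text \<open>Positive variance rules out the point mass.\<close>

lemma normal_rv_distributed:
  assumes "prob_space N" "normal_rv N Z" "(\<integral>\<omega>. Z \<omega> \<partial>N) = 0" "0 < (\<integral>\<omega>. (Z \<omega>)\<^sup>2 \<partial>N)"
  shows "distributed N lborel Z (normal_density 0 (sqrt (\<integral>\<omega>. (Z \<omega>)\<^sup>2 \<partial>N)))"
proof -
  interpret prob_space N by fact
  have [measurable]: "Z \<in> borel_measurable N" using assms by (auto simp: normal_rv_def)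
  from assms(2) consider m where "distr N borel Z = return borel m"
    | m s where "0 < s" "distributed N lborel Z (\<lambda>x. ennreal (normal_density m s x))"
    unfolding normal_rv_def by blast
  then show ?thesis
  proof cases
    case 1
    have e: "(\<integral>\<omega>. f (Z \<omega>) \<partial>N) = f m" if [measurable]: "f \<in> borel_measurable borel" for f :: "real \<Rightarrow> real"
      using integral_distr[of Z N borel f] integral_return[of m borel f] unfolding 1 by simp
    have False using e[of "\<lambda>x. x"] e[of "\<lambda>x. x\<^sup>2"] assms(3,4) by simp
    then show ?thesis ..
  next
    case 2
    have m: "m = 0" using normal_distributed_expectation[OF 2] assms(3) by simp
    have "(\<integral>\<omega>. (Z \<omega>)\<^sup>2 \<partial>N) = s\<^sup>2" using normal_distributed_variance[OF 2] assms(3) by simp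
    then show ?thesis using 2 m by simp
  qed
qed

text \<open>The density is at most 1 / (\<sigma> sqrt (2 pi)), hence at most 1 / \<sigma>. Only the
  order (v - u) / \<sigma> matters for anticoncentration.\<close>

lemma (in prob_space) normal_interval_bound:
  assumes "distributed M lborel Z (normal_density \<mu> \<sigma>)" "0 < \<sigma>" "u \<le> v"
  shows "prob {\<omega> \<in> space M. u \<le> Z \<omega> \<and> Z \<omega> \<le> v} \<le> (v - u) / \<sigma>"
proof -
  have d: "normal_density \<mu> \<sigma> x \<le> 1 / \<sigma>" for x
  proof -
    have "\<sigma> \<le> sqrt (2 * pi * \<sigma>\<^sup>2)"
      using pi_gt3 assms(2) by (intro real_le_rsqrt) simp
    then have "1 / sqrt (2 * pi * \<sigma>\<^sup>2) * exp (- (x - \<mu>)\<^sup>2 / (2 * \<sigma>\<^sup>2)) \<le> 1 / \<sigma> * 1"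
      using assms(2) by (intro mult_mono frac_le) auto
    then show ?thesis by (simp add: normal_density_def)
  qed
  have "emeasure M {\<omega> \<in> space M. u \<le> Z \<omega> \<and> Z \<omega> \<le> v} = emeasure M (Z -` {u..v} \<inter> space M)"
    by (rule arg_cong[where f="emeasure M"]) auto
  also have "\<dots> = (\<integral>\<^sup>+x. ennreal (normal_density \<mu> \<sigma> x) * indicator {u..v} x \<partial>lborel)"
    by (rule distributed_emeasure[OF assms(1)]) simp
  also have "\<dots> \<le> (\<integral>\<^sup>+x. ennreal (1 / \<sigma>) * indicator {u..v} x \<partial>lborel)"
    by (intro nn_integral_mono mult_right_mono ennreal_leI d) simp
  also have "\<dots> = ennreal (1 / \<sigma>) * ennreal (v - u)"
    using assms(3) by (simp add: nn_integral_cmult)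
  also have "\<dots> = ennreal ((v - u) / \<sigma>)"
    using assms by (simp add: ennreal_mult[symmetric])
  finally show ?thesis
    using assms by (simp add: emeasure_eq_measure)
qed

text \<open>The density is strictly positive everywhere; this is what will make the contraction
  factor \<theta> smaller than 1.\<close>

lemma (in prob_space) normal_exceeds:
  assumes D: "distributed M lborel Z (normal_density \<mu> \<sigma>)" and "0 < \<sigma>"
  shows "0 < prob {\<omega> \<in> space M. Z \<omega> > a}"
proof (rule ccontr)
  have [measurable]: "Z \<in> borel_measurable M" using distributed_measurable[OF D] by simp
  assume "\<not> ?thesis"
  then have "emeasure M {\<omega> \<in> space M. Z \<omega> > a} = 0"
    using measure_nonneg[of M "{\<omega> \<in> space M. Z \<omega> > a}"] by (simp add: emeasure_eq_measure)
  also have "{\<omega> \<in> space M. Z \<omega> > a} = Z -` {a<..} \<inter> space M" by auto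
  finally have "(\<integral>\<^sup>+x. ennreal (normal_density \<mu> \<sigma> x) * indicator {a<..} x \<partial>lborel) = 0"
    using distributed_emeasure[OF D, of "{a<..}"] by simp
  then have "AE x in lborel. ennreal (normal_density \<mu> \<sigma> x) * indicator {a<..} x = 0"
    by (subst (asm) nn_integral_0_iff_AE) auto
  then have "AE x in lborel. x \<notin> {a<..}"
  proof eventually_elim
    case (elim x)
    show ?case
    proof
      assume "x \<in> {a<..}"
      then have "normal_density \<mu> \<sigma> x \<le> 0" using elim by (simp add: ennreal_eq_0_iff)
      then show False using normal_density_pos[OF \<open>0 < \<sigma>\<close>, of \<mu> x] by linarith
    qed
  qed
  then have "emeasure lborel {a<..} = 0"
    using AE_iff_measurable[of "{a<..}" lborel "\<lambda>x. x \<notin> {a<..}"] by auto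
  moreover have "emeasure lborel {a<..a+1} \<le> emeasure lborel {a<..}"
    by (rule emeasure_mono) auto
  ultimately show False by simp
qed

text \<open>Continuity from above along the events |X| > n. The bound is stated for all L' beyond L
  so that the constants of two variables can be merged by a maximum.\<close>

lemma (in prob_space) tight_single:
  fixes X :: "'a \<Rightarrow> real"
  assumes [measurable]: "X \<in> borel_measurable M" and "0 < e"
  obtains L where "0 < L" "\<And>L'. L \<le> L' \<Longrightarrow> prob {\<omega> \<in> space M. \<bar>X \<omega>\<bar> > L'} \<le> e"
proof -
  have "(\<lambda>n. prob {\<omega> \<in> space M. \<bar>X \<omega>\<bar> > real n}) \<longlonglongrightarrow> prob (\<Inter>n. {\<omega> \<in> space M. \<bar>X \<omega>\<bar> > real n})"
    by (rule finite_Lim_measure_decseq) (auto simp: decseq_def)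
  also have "(\<Inter>n. {\<omega> \<in> space M. \<bar>X \<omega>\<bar> > real n}) = {}"
  proof (rule equals0I)
    fix \<omega> assume \<omega>: "\<omega> \<in> (\<Inter>n. {\<omega> \<in> space M. \<bar>X \<omega>\<bar> > real n})"
    obtain n where "\<bar>X \<omega>\<bar> \<le> real n" using real_arch_simple by blast
    moreover have "\<bar>X \<omega>\<bar> > real n" using \<omega> by blast
    ultimately show False by linarith
  qed
  finally have "eventually (\<lambda>n. prob {\<omega> \<in> space M. \<bar>X \<omega>\<bar> > real n} < e) sequentially"
    using order_tendstoD(2)[of _ "0::real"] \<open>0 < e\<close> by simp
  then obtain n where n: "prob {\<omega> \<in> space M. \<bar>X \<omega>\<bar> > real n} < e"
    by (auto simp: eventually_sequentially)
  show thesis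
  proof (rule that[of "real n + 1"])
    fix L' :: real assume "real n + 1 \<le> L'"
    then have "prob {\<omega> \<in> space M. \<bar>X \<omega>\<bar> > L'} \<le> prob {\<omega> \<in> space M. \<bar>X \<omega>\<bar> > real n}"
      by (intro finite_measure_mono) auto
    then show "prob {\<omega> \<in> space M. \<bar>X \<omega>\<bar> > L'} \<le> e" using n by simp
  qed simp
qed

text \<open>For h > 0 this is 1 up to c, linear in between and 0 from c + h on. A product of ramps
  over T lies between the indicators of the events that the maximum over T is at most c and at most
  c + h, and its factors are continuous.\<close>

definition ramp :: "real \<Rightarrow> real \<Rightarrow> real \<Rightarrow> real" where
  "ramp c h x = max 0 (min 1 ((c + h - x) / h))"

lemma ramp_range: "0 \<le> ramp c h x" "ramp c h x \<le> 1" "\<bar>ramp c h x\<bar> \<le> 1"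
  by (auto simp: ramp_def)

lemma ramp_eq_1: "0 < h \<Longrightarrow> x \<le> c \<Longrightarrow> ramp c h x = 1"
  by (auto simp: ramp_def field_simps min_def max_def)

lemma ramp_eq_0: "0 < h \<Longrightarrow> c + h \<le> x \<Longrightarrow> ramp c h x = 0"
  by (auto simp: ramp_def field_simps min_def max_def)

lemma continuous_ramp: "0 < h \<Longrightarrow> continuous_on A (ramp c h)"
  unfolding ramp_def[abs_def] by (intro continuous_intros) auto

lemma ramp_measurable[measurable]: "ramp c h \<in> borel_measurable borel"
  unfolding ramp_def[abs_def] by measurable

lemma prod_ramp_range:
  "0 \<le> (\<Prod>t\<in>T. ramp c h (x t))" "(\<Prod>t\<in>T. ramp c h (x t)) \<le> 1" "\<bar>\<Prod>t\<in>T. ramp c h (x t)\<bar> \<le> 1"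
  using prod_nonneg[of T "\<lambda>t. ramp c h (x t)"] prod_le_1[of T "\<lambda>t. ramp c h (x t)"]
  by (auto simp: ramp_range)

text \<open>Let m be the maximum of v on T. If z + m < c - d both products are 1, and if z + m > c +
  h the first is 0, so the difference can be positive only for z in an interval of length d + h.
  This turns a statement about a maximum into one about the single variable z.\<close>

lemma prod_ramp_diff_le:
  fixes v :: "'t \<Rightarrow> real"
  assumes T: "finite T" "T \<noteq> {}" and "0 < h" "0 \<le> d"
  shows "(\<Prod>t\<in>T. ramp c h (z + v t)) - (\<Prod>t\<in>T. ramp (c - d) h (z + v t))
    \<le> indicator {c - d - Max (v ` T)..c + h - Max (v ` T)} z"
proof -
  let ?m = "Max (v ` T)"
  have "?m \<in> v ` T" using T by (intro Max_in) auto
  then obtain t where t: "t \<in> T" "?m = v t" by blast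
  have le: "v u \<le> ?m" if "u \<in> T" for u using that T by simp
  consider "z + ?m < c - d" | "z + ?m > c + h" | "c - d \<le> z + ?m" "z + ?m \<le> c + h" by linarith
  then show ?thesis
  proof cases
    case 1
    have "ramp c h (z + v u) = 1" "ramp (c - d) h (z + v u) = 1" if "u \<in> T" for u
      using le[OF that] 1 assms(3,4) by (auto intro!: ramp_eq_1)
    then show ?thesis by simp
  next
    case 2
    then have "ramp c h (z + v t) = 0" using t assms(3) by (intro ramp_eq_0) auto
    then have "(\<Prod>t\<in>T. ramp c h (z + v t)) = 0" using T(1) t(1) by (meson prod_zero)
    then show ?thesis using prod_ramp_range(1)[of "c - d" h "\<lambda>t. z + v t" T]
      by (simp add: indicator_def)
  next
    case 3
    then have "z \<in> {c - d - ?m..c + h - ?m}" by auto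
    then show ?thesis
      using prod_ramp_range(2)[of c h "\<lambda>t. z + v t" T] prod_ramp_range(1)[of "c - d" h "\<lambda>t. z + v t" T] by simp
  qed
qed

section \<open>Maxima with a shared component, and asymptotic independence\<close>

context gaussian_process
begin

text \<open>The point s may already belong to T, so the coefficients are extended by 0 in
  \<open>b0\<close> and \<mu> is added at s in \<open>b1\<close>. The extra point contributes a
  cross term, counted twice by symmetry, and \<mu>^2 K s s.\<close>

lemma GP_cos_add:
  assumes T: "finite T" "T \<subseteq> {0..}" and s: "0 \<le> s"
  shows "expectation (\<lambda>\<omega>. cos ((\<Sum>t\<in>T. b t * GP t \<omega>) + \<mu> * GP s \<omega> + \<beta>))
     = cos \<beta> * exp (- (quad_form K T b + 2 * \<mu> * (\<Sum>t\<in>T. b t * K t s) + \<mu>\<^sup>2 * K s s) / 2)"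
proof -
  let ?I = "insert s T"
  define b0 where "b0 t = (if t \<in> T then b t else 0)" for t
  define b1 where "b1 t = b0 t + (if t = s then \<mu> else 0)" for t
  have I: "finite ?I" "?I \<subseteq> {0..}" using T s by auto
  have ext: "(\<Sum>t\<in>?I. b0 t * f t) = (\<Sum>t\<in>T. b t * f t)" for f
    using T(1) by (intro sum.mono_neutral_cong_right) (auto simp: b0_def)
  have split: "(\<Sum>t\<in>?I. b1 t * f t) = (\<Sum>t\<in>T. b t * f t) + \<mu> * f s" for f
  proof -
    have "(\<Sum>t\<in>?I. b1 t * f t) = (\<Sum>t\<in>?I. b0 t * f t) + (\<Sum>t\<in>?I. if t = s then \<mu> * f t else 0)"
      unfolding sum.distrib[symmetric] by (intro sum.cong) (auto simp: b1_def distrib_right)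
    then show ?thesis using I(1) by (simp only: ext sum.delta) simp
  qed
  have sym: "(\<Sum>t\<in>T. b t * K s t) = (\<Sum>t\<in>T. b t * K t s)"
    by (intro sum.cong refl arg_cong2[where f="(*)"] cov_commute)
  have "quad_form K ?I b1 = (\<Sum>u\<in>?I. b1 u * (\<Sum>t\<in>?I. b1 t * K u t))"
    unfolding quad_form_def by (simp only: sum_distrib_left mult.assoc)
  also have "\<dots> = (\<Sum>u\<in>T. b u * ((\<Sum>t\<in>T. b t * K u t) + \<mu> * K u s)) + \<mu> * ((\<Sum>t\<in>T. b t * K s t) + \<mu> * K s s)"
    unfolding split ..
  also have "\<dots> = quad_form K T b + 2 * \<mu> * (\<Sum>t\<in>T. b t * K t s) + \<mu>\<^sup>2 * K s s"
    unfolding quad_form_def sym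
    by (simp add: sum.distrib distrib_left sum_distrib_left power2_eq_square mult_ac)
  finally have q: "quad_form K ?I b1 = quad_form K T b + 2 * \<mu> * (\<Sum>t\<in>T. b t * K t s) + \<mu>\<^sup>2 * K s s" .
  have "expectation (\<lambda>\<omega>. cos ((\<Sum>t\<in>?I. b1 t * GP t \<omega>) + \<beta>)) = cos \<beta> * exp (- quad_form K ?I b1 / 2)"
    by (rule GP_cos[OF I])
  then show ?thesis unfolding q split .
qed

text \<open>The second factor supplies an independent copy of the process.\<close>

sublocale NN: pair_prob_space N N ..

text \<open>Integrating out the second component first treats everything in the first as a phase.
  Independence shows in the absence of cross terms with \<rho>.\<close>

lemma GP_cos_pair:
  assumes T: "finite T" "T \<subseteq> {0..}" and s: "0 \<le> s" "0 \<le> s'"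
  shows "(\<integral>z. cos ((\<Sum>t\<in>T. b t * GP t (fst z)) + \<mu> * GP s (fst z) + \<rho> * GP s' (snd z) + \<beta>) \<partial>(N \<Otimes>\<^sub>M N))
     = cos \<beta> * exp (- (quad_form K T b + 2 * \<mu> * (\<Sum>t\<in>T. b t * K t s) + \<mu>\<^sup>2 * K s s + \<rho>\<^sup>2 * K s' s') / 2)"
proof -
  have [measurable]: "t \<in> T \<Longrightarrow> GP t \<in> borel_measurable N" for t using T by (auto intro: GP_measurable)
  have [measurable]: "GP s \<in> borel_measurable N" "GP s' \<in> borel_measurable N" using s by (auto intro: GP_measurable)
  let ?w = "\<lambda>x. (\<Sum>t\<in>T. b t * GP t x) + \<mu> * GP s x"
  have "integrable (N \<Otimes>\<^sub>M N) (\<lambda>z. cos (?w (fst z) + \<rho> * GP s' (snd z) + \<beta>))"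
    by (rule NN.integrable_const_bound[where B=1]) auto
  then have "(\<integral>z. cos (?w (fst z) + \<rho> * GP s' (snd z) + \<beta>) \<partial>(N \<Otimes>\<^sub>M N))
      = (\<integral>x. (\<integral>y. cos (?w x + \<rho> * GP s' y + \<beta>) \<partial>N) \<partial>N)"
    by (subst NN.integral_fst'[symmetric]) auto
  also have "\<dots> = (\<integral>x. cos (?w x + \<beta>) * exp (- (\<rho>\<^sup>2 * K s' s') / 2) \<partial>N)"
  proof (rule Bochner_Integration.integral_cong[OF refl])
    fix x
    show "(\<integral>y. cos (?w x + \<rho> * GP s' y + \<beta>) \<partial>N) = cos (?w x + \<beta>) * exp (- (\<rho>\<^sup>2 * K s' s') / 2)"
      using GP_cos_add[of "{}" s' "\<lambda>_. 0" \<rho> "?w x + \<beta>"] s by (simp add: quad_form_def add_ac)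
  qed
  also have "\<dots> = cos \<beta> * exp (- (quad_form K T b + 2 * \<mu> * (\<Sum>t\<in>T. b t * K t s) + \<mu>\<^sup>2 * K s s) / 2)
      * exp (- (\<rho>\<^sup>2 * K s' s') / 2)"
    using GP_cos_add[OF T s(1), of b \<mu> \<beta>] by simp
  also have "\<dots> = cos \<beta> * exp (- (quad_form K T b + 2 * \<mu> * (\<Sum>t\<in>T. b t * K t s) + \<mu>\<^sup>2 * K s s + \<rho>\<^sup>2 * K s' s') / 2)"
    by (simp add: mult.assoc add_divide_distrib flip: exp_add)
  finally show ?thesis .
qed

text \<open>If \<open>GP s\<close> has the same covariance with all \<open>GP t\<close>, then \<open>GP t = a * GP s + V t\<close> with the same
  \<open>a\<close> for all \<open>t\<close> and \<open>V\<close> independent of \<open>GP s\<close>, so the maximum of \<open>GP\<close> is \<open>a * GP s\<close> plus an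
  independent variable.\<close>

lemma max_anticoncentration:
  assumes T: "finite T" "T \<noteq> {}" "T \<subseteq> {0..}" and s: "0 \<le> s" "0 < K s s"
    and \<kappa>: "0 < \<kappa>" "\<And>t. t \<in> T \<Longrightarrow> K t s = \<kappa>" and h: "0 < h" "0 \<le> d"
  shows "expectation (\<lambda>\<omega>. \<Prod>t\<in>T. ramp c h (GP t \<omega>)) - expectation (\<lambda>\<omega>. \<Prod>t\<in>T. ramp (c - d) h (GP t \<omega>))
     \<le> (d + h) * sqrt (K s s) / \<kappa>"
proof -
  have [measurable]: "t \<in> T \<Longrightarrow> GP t \<in> borel_measurable N" for t using T by (auto intro: GP_measurable)
  have [measurable]: "GP s \<in> borel_measurable N" using s by (auto intro: GP_measurable)
  define a where "a = \<kappa> / K s s"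
  have a: "0 < a" using s \<kappa> by (simp add: a_def)
  \<comment> \<open>\<open>B\<close> is the process with its component along \<open>GP s\<close>
    resampled from the independent copy; a is the regression coefficient of \<open>GP t\<close> on
    \<open>GP s\<close>, the same for all t in T.\<close>
  define B where "B t z = a * GP s (snd z) + (GP t (fst z) - a * GP s (fst z))" for t z
  have Bm[measurable]: "t \<in> T \<Longrightarrow> B t \<in> borel_measurable (N \<Otimes>\<^sub>M N)" for t unfolding B_def by measurable
  have cos_eq: "(\<integral>z. cos ((\<Sum>t\<in>T. b t * B t z) + \<beta>) \<partial>(N \<Otimes>\<^sub>M N)) = expectation (\<lambda>\<omega>. cos ((\<Sum>t\<in>T. b t * GP t \<omega>) + \<beta>))" for b \<beta>
  proof -
    define \<rho> where "\<rho> = (\<Sum>t\<in>T. b t) * a"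
    have "(\<Sum>t\<in>T. b t * B t z) = (\<Sum>t\<in>T. b t * GP t (fst z)) + (- \<rho>) * GP s (fst z) + \<rho> * GP s (snd z)" for z
    proof -
      have "(\<Sum>t\<in>T. b t * B t z) = (\<Sum>t\<in>T. b t * GP t (fst z) + b t * (a * (GP s (snd z) - GP s (fst z))))"
        by (intro sum.cong) (auto simp: B_def algebra_simps)
      also have "\<dots> = (\<Sum>t\<in>T. b t * GP t (fst z)) + (\<Sum>t\<in>T. b t) * (a * (GP s (snd z) - GP s (fst z)))"
        by (simp only: sum.distrib sum_distrib_right)
      finally show ?thesis by (simp add: \<rho>_def algebra_simps)
    qed
    then have "(\<integral>z. cos ((\<Sum>t\<in>T. b t * B t z) + \<beta>) \<partial>(N \<Otimes>\<^sub>M N))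
      = cos \<beta> * exp (- (quad_form K T b + 2 * (- \<rho>) * (\<Sum>t\<in>T. b t * K t s) + (- \<rho>)\<^sup>2 * K s s + \<rho>\<^sup>2 * K s s) / 2)"
      using GP_cos_pair[OF T(1,3) s(1) s(1), of b "- \<rho>" \<rho> \<beta>] by simp
    \<comment> \<open>The variance removed with the old component equals the variance brought in by
      the new one, so \<open>B\<close> has the finite-dimensional law of \<open>GP\<close> on
      T.\<close>
    also have "2 * (- \<rho>) * (\<Sum>t\<in>T. b t * K t s) + (- \<rho>)\<^sup>2 * K s s + \<rho>\<^sup>2 * K s s = 0"
    proof -
      have "(\<Sum>t\<in>T. b t * K t s) = \<rho> * K s s"
      proof -
        have "(\<Sum>t\<in>T. b t * K t s) = (\<Sum>t\<in>T. b t) * \<kappa>"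
          using \<kappa>(2) by (simp add: sum_distrib_right)
        then show ?thesis using s(2) by (simp add: \<rho>_def a_def)
      qed
      then show ?thesis by (simp add: power2_eq_square)
    qed
    then have "quad_form K T b + 2 * (- \<rho>) * (\<Sum>t\<in>T. b t * K t s) + (- \<rho>)\<^sup>2 * K s s + \<rho>\<^sup>2 * K s s = quad_form K T b"
      by linarith
    finally show ?thesis using GP_cos[OF T(1,3), of b \<beta>] by simp
  qed
  have eq: "(\<integral>z. (\<Prod>t\<in>T. ramp c h (B t z)) \<partial>(N \<Otimes>\<^sub>M N)) = expectation (\<lambda>\<omega>. \<Prod>t\<in>T. ramp c h (GP t \<omega>))" for c
  proof -
    \<comment> \<open>A constant sequence converging to the other side yields the equality of the
      two expectations.\<close>
    have "(\<lambda>n. expectation (\<lambda>\<omega>. \<Prod>t\<in>T. ramp c h (GP t \<omega>))) \<longlonglongrightarrow> (\<integral>z. (\<Prod>t\<in>T. ramp c h (B t z)) \<partial>(N \<Otimes>\<^sub>M N))"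
    proof (rule tendsto_expectation_prod_of_cos[OF prob_space_axioms NN.prob_space_axioms T(1),
          where A="\<lambda>n. GP" and B=B and g="\<lambda>_. ramp c h"])
      show "\<exists>L>0. (\<forall>n::nat. prob {\<omega> \<in> space N. \<bar>GP t \<omega>\<bar> > L} \<le> e) \<and> NN.prob {\<omega> \<in> space (N \<Otimes>\<^sub>M N). \<bar>B t \<omega>\<bar> > L} \<le> e"
        if t: "t \<in> T" and "0 < e" for t e
      proof -
        have "GP t \<in> borel_measurable N" using t by measurable
        then obtain L1 where L1: "0 < L1" "\<And>L'. L1 \<le> L' \<Longrightarrow> prob {\<omega> \<in> space N. \<bar>GP t \<omega>\<bar> > L'} \<le> e"
          using tight_single[OF _ \<open>0 < e\<close>] by blast
        obtain L2 where L2: "0 < L2" "\<And>L'. L2 \<le> L' \<Longrightarrow> NN.prob {\<omega> \<in> space (N \<Otimes>\<^sub>M N). \<bar>B t \<omega>\<bar> > L'} \<le> e"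
          using NN.tight_single[OF Bm[OF t] \<open>0 < e\<close>] by blast
        show ?thesis using L1 L2 by (intro exI[of _ "max L1 L2"] conjI allI L1(2) L2(2)) auto
      qed
    qed (auto simp: cos_eq ramp_range intro: continuous_ramp h)
    then show ?thesis by (simp add: LIMSEQ_const_iff)
  qed
  have int: "integrable (N \<Otimes>\<^sub>M N) (\<lambda>z. \<Prod>t\<in>T. ramp c h (B t z))" for c
    by (rule NN.integrable_const_bound[where B=1]) (auto simp: prod_ramp_range)
  let ?f = "\<lambda>z. (\<Prod>t\<in>T. ramp c h (B t z)) - (\<Prod>t\<in>T. ramp (c - d) h (B t z))"
  let ?C = "(d + h) * sqrt (K s s) / \<kappa>"
  \<comment> \<open>With the first component x fixed, \<open>B t\<close> is a * GP s y plus a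
    constant depending on t, and m is the maximum of these constants. A positive difference of
    products forces \<open>GP s y\<close> into an interval of length (d + h) / a.\<close>
  have inner: "(\<integral>y. ?f (x, y) \<partial>N) \<le> ?C" if x: "x \<in> space N" for x
  proof -
    define m where "m = Max ((\<lambda>t. GP t x - a * GP s x) ` T)"
    have "(\<integral>y. ?f (x, y) \<partial>N) \<le> (\<integral>y. indicator {y \<in> space N. (c - d - m) / a \<le> GP s y \<and> GP s y \<le> (c + h - m) / a} y \<partial>N)"
    proof (rule integral_mono)
      have "integrable N (\<lambda>y. \<Prod>t\<in>T. ramp c h (B t (x, y)))" for c
        unfolding B_def by (rule integrable_const_bound[where B=1]) (auto simp: prod_ramp_range)
      then show "integrable N (\<lambda>y. ?f (x, y))" by simp
      show "integrable N (indicator {y \<in> space N. (c - d - m) / a \<le> GP s y \<and> GP s y \<le> (c + h - m) / a} :: _ \<Rightarrow> real)"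
        by (rule integrable_const_bound[where B=1]) auto
      fix y assume "y \<in> space N"
      then show "?f (x, y) \<le> indicator {y \<in> space N. (c - d - m) / a \<le> GP s y \<and> GP s y \<le> (c + h - m) / a} y"
        using prod_ramp_diff_le[OF T(1,2) h, of c "a * GP s y" "\<lambda>t. GP t x - a * GP s x"] a
        by (auto simp: B_def m_def[symmetric] indicator_def field_simps split: if_splits)
    qed
    also have "\<dots> = prob {y \<in> space N. (c - d - m) / a \<le> GP s y \<and> GP s y \<le> (c + h - m) / a}" by simp
    also have "\<dots> \<le> ((c + h - m) / a - (c - d - m) / a) / sqrt (K s s)"
    proof (rule normal_interval_bound)
      show "distributed N lborel (GP s) (normal_density 0 (sqrt (K s s)))"
        using normal_rv_distributed[OF prob_space_axioms GP_normal GP_mean, of s] GP_variance[of s] s by simp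
      show "(c - d - m) / a \<le> (c + h - m) / a" using a h by (intro divide_right_mono) auto
    qed (use s in simp)
    also have "\<dots> = (d + h) / a / sqrt (K s s)" by (simp flip: diff_divide_distrib)
    also have "\<dots> = ?C"
    proof -
      have "K s s = sqrt (K s s) * sqrt (K s s)" using s by simp
      then show ?thesis using s \<kappa>(1) unfolding a_def by (simp add: field_simps)
    qed
    finally show ?thesis .
  qed
  have "(\<integral>z. ?f z \<partial>(N \<Otimes>\<^sub>M N)) = (\<integral>x. (\<integral>y. ?f (x, y) \<partial>N) \<partial>N)"
    using int by (intro NN.integral_fst'[symmetric]) simp
  also have "\<dots> \<le> (\<integral>x. ?C \<partial>N)"
    using int by (intro integral_mono inner NN.integrable_fst') auto
  also have "\<dots> = ?C" by (simp add: prob_space)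
  finally show ?thesis using int eq[of c] eq[of "c - d"] by simp
qed

text \<open>All normalised variables \<open>V n\<close> are standard normal, so the copy of
  \<open>V 0\<close> on the second factor can stand for their limit: for a finite set T of times, GP
  on T together with \<open>V n\<close> converges in law to GP on T together with an independent
  \<open>V 0\<close>. The event A forces GP \<le> 0 on T and \<open>V n\<close> \<le> 0, so its
  probability is at most a product; letting T grow while the smoothing width h shrinks turns the
  first factor back into \<open>prob A\<close>.\<close>

lemma prob_all_nonpositive_eq_0:
  fixes s :: "nat \<Rightarrow> real"
  assumes s: "\<And>n. 0 \<le> s n" "\<And>n. 0 < K (s n) (s n)"
    and lim: "\<And>t. 0 \<le> t \<Longrightarrow> (\<lambda>n. K t (s n) / sqrt (K (s n) (s n))) \<longlonglongrightarrow> 0"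
  shows "prob {\<omega> \<in> space N. \<forall>n. GP (s n) \<omega> \<le> 0} = 0"
proof -
  have [measurable]: "GP (s n) \<in> borel_measurable N" for n using s by (auto intro: GP_measurable)
  define V where "V n \<omega> = GP (s n) \<omega> / sqrt (K (s n) (s n))" for n \<omega>
  have Vm[measurable]: "V n \<in> borel_measurable N" for n unfolding V_def by measurable
  define A where "A = {\<omega> \<in> space N. \<forall>n. GP (s n) \<omega> \<le> 0}"
  have [measurable]: "A \<in> events" unfolding A_def by measurable
  \<comment> \<open>The threshold 1 instead of 0 leaves room for \<open>ramp 0 h\<close> with h
    \<le> 1, so \<theta> does not depend on h.\<close>
  define \<theta> where "\<theta> = prob {\<omega> \<in> space N. V 0 \<omega> \<le> 1}"
  have "distributed N lborel (GP (s 0)) (normal_density 0 (sqrt (K (s 0) (s 0))))"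
    using normal_rv_distributed[OF prob_space_axioms GP_normal GP_mean, of "s 0"] GP_variance[of "s 0"] s by simp
  then have "0 < prob {\<omega> \<in> space N. GP (s 0) \<omega> > sqrt (K (s 0) (s 0))}"
    by (rule normal_exceeds) (use s in simp)
  also have "{\<omega> \<in> space N. GP (s 0) \<omega> > sqrt (K (s 0) (s 0))} = space N - {\<omega> \<in> space N. V 0 \<omega> \<le> 1}"
    using s(2)[of 0] by (auto simp: V_def field_simps)
  also have "prob \<dots> = 1 - \<theta>" unfolding \<theta>_def by (rule prob_compl) measurable
  finally have \<theta>: "\<theta> < 1" by simp
  have bound: "prob A \<le> prob {\<omega> \<in> space N. \<forall>i<k. GP (s i) \<omega> \<le> h} * \<theta>" if h: "0 < h" "h \<le> 1" for k h
  proof -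
    define T where "T = s ` {..<k}"
    have T: "finite T" "T \<subseteq> {0..}" using s by (auto simp: T_def)
    have Tm[measurable]: "t \<in> T \<Longrightarrow> GP t \<in> borel_measurable N" for t using T by (auto intro: GP_measurable)
    \<comment> \<open>Times are nonnegative, so - 1 is free to index the coordinate
      \<open>V n\<close>.\<close>
    define I where "I = insert (- 1) T"
    have nT: "- 1 \<notin> T" using T by auto
    define A' where "A' n j = (if j < 0 then V n else GP j)" for n :: nat and j :: real
    define B where "B j = (if j < 0 then (\<lambda>z. V 0 (snd z)) else (\<lambda>z. GP j (fst z)))" for j :: real
    have sumI: "(\<Sum>j\<in>I. f j) = (\<Sum>t\<in>T. f t) + f (- 1)" for f :: "real \<Rightarrow> real"
      unfolding I_def using T(1) nT by (simp add: add.commute)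
    have prodI: "(\<Prod>j\<in>I. f j) = (\<Prod>t\<in>T. f t) * f (- 1)" for f :: "real \<Rightarrow> real"
      unfolding I_def using T(1) nT by (simp add: mult.commute)
    have pos: "t \<in> T \<Longrightarrow> \<not> t < 0" for t using T by auto
    have var1: "(b / sqrt (K (s n) (s n)))\<^sup>2 * K (s n) (s n) = b\<^sup>2" for b n
      using s(2)[of n] by (simp add: power_divide)
    have "(\<lambda>n. expectation (\<lambda>\<omega>. \<Prod>j\<in>I. ramp 0 h (A' n j \<omega>))) \<longlonglongrightarrow> (\<integral>z. (\<Prod>j\<in>I. ramp 0 h (B j z)) \<partial>(N \<Otimes>\<^sub>M N))"
    proof (rule tendsto_expectation_prod_of_cos[OF prob_space_axioms NN.prob_space_axioms,
          where A=A' and B=B and g="\<lambda>_. ramp 0 h"])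
      show "finite I" using T(1) by (simp add: I_def)
      show A'm: "A' n j \<in> borel_measurable N" if "j \<in> I" for n j
        using that Tm Vm by (auto simp: A'_def I_def)
      show Bm: "B j \<in> borel_measurable (N \<Otimes>\<^sub>M N)" if "j \<in> I" for j
      proof (cases "j < 0")
        case True then show ?thesis unfolding B_def by simp
      next
        case False
        then have "j \<in> T" using that by (auto simp: I_def)
        then show ?thesis using False unfolding B_def by simp
      qed
      fix a :: "real \<Rightarrow> real" and b :: real
      have c1: "expectation (\<lambda>\<omega>. cos ((\<Sum>j\<in>I. a j * A' n j \<omega>) + b)) = cos b * exp (- (quad_form K T a
          + 2 * a (- 1) * (\<Sum>t\<in>T. a t * (K t (s n) / sqrt (K (s n) (s n)))) + (a (- 1))\<^sup>2) / 2)" for n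
      proof -
        have e: "(\<Sum>j\<in>I. a j * A' n j \<omega>) = (\<Sum>t\<in>T. a t * GP t \<omega>) + a (- 1) / sqrt (K (s n) (s n)) * GP (s n) \<omega>" for \<omega>
          unfolding sumI using pos by (simp add: A'_def V_def)
        have e2: "a (- 1) * (\<Sum>t\<in>T. a t * (K t (s n) / sqrt (K (s n) (s n))))
           = a (- 1) / sqrt (K (s n) (s n)) * (\<Sum>t\<in>T. a t * K t (s n))"
          by (simp flip: sum_divide_distrib)
        have e3: "2 * a (- 1) * (\<Sum>t\<in>T. a t * (K t (s n) / sqrt (K (s n) (s n))))
           = 2 * (a (- 1) / sqrt (K (s n) (s n))) * (\<Sum>t\<in>T. a t * K t (s n))"
          using e2 by (simp only: mult.assoc)
        show ?thesis unfolding e e3 GP_cos_add[OF T s(1)] var1 ..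
      qed
      \<comment> \<open>The expression of \<open>c1\<close> with the normalised covariances replaced
        by their limit 0.\<close>
      have c2: "(\<integral>z. cos ((\<Sum>j\<in>I. a j * B j z) + b) \<partial>(N \<Otimes>\<^sub>M N))
          = cos b * exp (- (quad_form K T a + 2 * a (- 1) * (\<Sum>t\<in>T. a t * 0) + (a (- 1))\<^sup>2) / 2)"
      proof -
        have e: "(\<Sum>j\<in>I. a j * B j z) = (\<Sum>t\<in>T. a t * GP t (fst z)) + 0 * GP (s 0) (fst z)
            + a (- 1) / sqrt (K (s 0) (s 0)) * GP (s 0) (snd z)" for z
          unfolding sumI using pos by (simp add: B_def V_def)
        show ?thesis unfolding e GP_cos_pair[OF T s(1) s(1)] var1 by simp
      qed
      show "(\<lambda>n. expectation (\<lambda>\<omega>. cos ((\<Sum>j\<in>I. a j * A' n j \<omega>) + b)))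
         \<longlonglongrightarrow> (\<integral>z. cos ((\<Sum>j\<in>I. a j * B j z) + b) \<partial>(N \<Otimes>\<^sub>M N))"
        unfolding c1 c2 using T(2) by (intro tendsto_intros lim) auto
    next
      fix j and e :: real assume j: "j \<in> I" and e: "0 < e"
      have Bj: "B j \<in> borel_measurable (N \<Otimes>\<^sub>M N)"
      proof (cases "j < 0")
        case True then show ?thesis unfolding B_def by simp
      next
        case False
        then have "j \<in> T" using j by (auto simp: I_def)
        then show ?thesis using False unfolding B_def by simp
      qed
      obtain L2 where L2: "0 < L2" "\<And>L'. L2 \<le> L' \<Longrightarrow> NN.prob {\<omega> \<in> space (N \<Otimes>\<^sub>M N). \<bar>B j \<omega>\<bar> > L'} \<le> e"
        using NN.tight_single[OF Bj e] by blast
      obtain L1 where L1: "0 < L1" "\<And>n L'. L1 \<le> L' \<Longrightarrow> prob {\<omega> \<in> space N. \<bar>A' n j \<omega>\<bar> > L'} \<le> e"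
      proof (cases "j < 0")
        case True
        obtain L where L: "0 < L" "1 / L\<^sup>2 \<le> e" using exists_tail_bound[OF e, of 1] by auto
        have "prob {\<omega> \<in> space N. \<bar>A' n j \<omega>\<bar> > L'} \<le> e" if "L \<le> L'" for n L'
        proof -
          have V2: "(V n \<omega>)\<^sup>2 = (GP (s n) \<omega>)\<^sup>2 / K (s n) (s n)" for \<omega>
            using s(2)[of n] by (simp add: V_def power_divide)
          have "prob {\<omega> \<in> space N. \<bar>V n \<omega>\<bar> > L'} \<le> 1 / L'\<^sup>2"
            using GP_variance[OF s(1)[of n]] GP_square_integrable[OF s(1)[of n]] s(2)[of n] L(1) that
            by (intro second_moment_tail) (auto simp: V2)
          also have "\<dots> \<le> 1 / L\<^sup>2" using L(1) that by (intro divide_left_mono power_mono) auto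
          finally show ?thesis using True L(2) by (simp add: A'_def)
        qed
        then show ?thesis using that L(1) by blast
      next
        case False
        then have "GP j \<in> borel_measurable N" using j by (auto simp: I_def)
        from tight_single[OF this e] obtain L where "0 < L" "\<And>L'. L \<le> L' \<Longrightarrow> prob {\<omega> \<in> space N. \<bar>GP j \<omega>\<bar> > L'} \<le> e"
          by blast
        then show ?thesis using that False by (simp add: A'_def)
      qed
      show "\<exists>L>0. (\<forall>n. prob {\<omega> \<in> space N. \<bar>A' n j \<omega>\<bar> > L} \<le> e)
          \<and> NN.prob {\<omega> \<in> space (N \<Otimes>\<^sub>M N). \<bar>B j \<omega>\<bar> > L} \<le> e"
        using L1 L2 by (intro exI[of _ "max L1 L2"] conjI allI L1(2) L2(2)) auto
    qed (auto simp: ramp_range intro: continuous_ramp h)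
    moreover have "prob A \<le> expectation (\<lambda>\<omega>. \<Prod>j\<in>I. ramp 0 h (A' n j \<omega>))" for n
    proof -
      have "expectation (indicator A) \<le> expectation (\<lambda>\<omega>. \<Prod>j\<in>I. ramp 0 h (A' n j \<omega>))"
      proof (rule integral_mono)
        show "integrable N (indicator A :: _ \<Rightarrow> real)"
          by (rule integrable_const_bound[where B=1]) auto
        have "(\<lambda>\<omega>. \<Prod>j\<in>I. ramp 0 h (A' n j \<omega>)) = (\<lambda>\<omega>. (\<Prod>t\<in>T. ramp 0 h (GP t \<omega>)) * ramp 0 h (V n \<omega>))"
          unfolding prodI using pos by (simp add: A'_def)
        moreover have "\<dots> \<in> borel_measurable N" by measurable
        ultimately show "integrable N (\<lambda>\<omega>. \<Prod>j\<in>I. ramp 0 h (A' n j \<omega>))"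
          by (intro integrable_const_bound[where B=1]) (auto simp: prod_ramp_range)
        fix \<omega> assume "\<omega> \<in> space N"
        show "indicator A \<omega> \<le> (\<Prod>j\<in>I. ramp 0 h (A' n j \<omega>))"
        proof (cases "\<omega> \<in> A")
          case True
          then have "A' n j \<omega> \<le> 0" if "j \<in> I" for j
            using that s(2)[of n] by (auto simp: A_def A'_def I_def T_def V_def divide_nonpos_pos)
          then have "(\<Prod>j\<in>I. ramp 0 h (A' n j \<omega>)) = 1" using h by (intro prod.neutral) (auto intro: ramp_eq_1)
          then show ?thesis by simp
        qed (simp add: prod_ramp_range)
      qed
      then show ?thesis by simp
    qed
    ultimately have "prob A \<le> (\<integral>z. (\<Prod>j\<in>I. ramp 0 h (B j z)) \<partial>(N \<Otimes>\<^sub>M N))"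
      by (intro LIMSEQ_le_const) auto
    also have "\<dots> = (\<integral>z. (\<Prod>t\<in>T. ramp 0 h (GP t (fst z))) * ramp 0 h (V 0 (snd z)) \<partial>(N \<Otimes>\<^sub>M N))"
      unfolding prodI using pos by (simp add: B_def)
    also have "\<dots> = (\<integral>x. (\<integral>y. (\<Prod>t\<in>T. ramp 0 h (GP t x)) * ramp 0 h (V 0 y) \<partial>N) \<partial>N)"
    proof -
      have "\<bar>(\<Prod>t\<in>T. ramp 0 h (GP t x)) * ramp 0 h (V 0 y)\<bar> \<le> 1 * 1" for x y
        unfolding abs_mult by (intro mult_mono prod_ramp_range ramp_range) auto
      then have "integrable (N \<Otimes>\<^sub>M N) (\<lambda>z. (\<Prod>t\<in>T. ramp 0 h (GP t (fst z))) * ramp 0 h (V 0 (snd z)))"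
        by (intro NN.integrable_const_bound[where B=1]) auto
      then show ?thesis by (subst NN.integral_fst'[symmetric]) auto
    qed
    also have "\<dots> = expectation (\<lambda>\<omega>. \<Prod>t\<in>T. ramp 0 h (GP t \<omega>)) * expectation (\<lambda>\<omega>. ramp 0 h (V 0 \<omega>))" by simp
    also have "\<dots> \<le> prob {\<omega> \<in> space N. \<forall>i<k. GP (s i) \<omega> \<le> h} * \<theta>"
    proof (rule mult_mono)
      have "expectation (\<lambda>\<omega>. \<Prod>t\<in>T. ramp 0 h (GP t \<omega>)) \<le> expectation (indicator {\<omega> \<in> space N. \<forall>i<k. GP (s i) \<omega> \<le> h})"
      proof (rule integral_mono)
        show "integrable N (\<lambda>\<omega>. \<Prod>t\<in>T. ramp 0 h (GP t \<omega>))"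
          by (rule integrable_const_bound[where B=1]) (auto simp: prod_ramp_range)
        show "integrable N (indicator {\<omega> \<in> space N. \<forall>i<k. GP (s i) \<omega> \<le> h} :: _ \<Rightarrow> real)"
          by (rule integrable_const_bound[where B=1]) auto
        fix \<omega> assume \<omega>: "\<omega> \<in> space N"
        show "(\<Prod>t\<in>T. ramp 0 h (GP t \<omega>)) \<le> indicator {\<omega> \<in> space N. \<forall>i<k. GP (s i) \<omega> \<le> h} \<omega>"
        proof (cases "\<forall>i<k. GP (s i) \<omega> \<le> h")
          case True then show ?thesis using \<omega> by (simp add: prod_ramp_range)
        next
          case False
          then obtain t where t: "t \<in> T" "h < GP t \<omega>" by (auto simp: T_def not_le)
          then have "ramp 0 h (GP t \<omega>) = 0" using h by (intro ramp_eq_0) auto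
          then have "(\<Prod>t\<in>T. ramp 0 h (GP t \<omega>)) = 0" using T(1) t(1) by (meson prod_zero)
          then show ?thesis by simp
        qed
      qed
      then show "expectation (\<lambda>\<omega>. \<Prod>t\<in>T. ramp 0 h (GP t \<omega>)) \<le> prob {\<omega> \<in> space N. \<forall>i<k. GP (s i) \<omega> \<le> h}" by simp
      have "expectation (\<lambda>\<omega>. ramp 0 h (V 0 \<omega>)) \<le> expectation (indicator {\<omega> \<in> space N. V 0 \<omega> \<le> 1})"
      proof (rule integral_mono)
        show "integrable N (\<lambda>\<omega>. ramp 0 h (V 0 \<omega>))"
          by (rule integrable_const_bound[where B=1]) (auto simp: ramp_range)
        show "integrable N (indicator {\<omega> \<in> space N. V 0 \<omega> \<le> 1} :: _ \<Rightarrow> real)"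
          by (rule integrable_const_bound[where B=1]) auto
        fix \<omega> assume \<omega>: "\<omega> \<in> space N"
        show "ramp 0 h (V 0 \<omega>) \<le> indicator {\<omega> \<in> space N. V 0 \<omega> \<le> 1} \<omega>"
          using \<omega> h ramp_eq_0[of h 0 "V 0 \<omega>"] by (cases "V 0 \<omega> \<le> 1") (auto simp: ramp_range)
      qed
      then show "expectation (\<lambda>\<omega>. ramp 0 h (V 0 \<omega>)) \<le> \<theta>" by (simp add: \<theta>_def)
    qed (auto simp: ramp_range)
    finally show ?thesis .
  qed
  \<comment> \<open>Here k is the number of times and, shifted by one, the inverse of the width;
    \<open>E k\<close> decreases to A.\<close>
  define E where "E k = {\<omega> \<in> space N. \<forall>i<k. GP (s i) \<omega> \<le> 1 / real (Suc k)}" for k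
  have "(\<lambda>k. prob (E k)) \<longlonglongrightarrow> prob (\<Inter>k. E k)"
  proof (rule finite_Lim_measure_decseq)
    show "range E \<subseteq> events" unfolding E_def by auto
    show "decseq E"
    proof (rule decseq_SucI)
      fix k
      have "1 / real (Suc (Suc k)) \<le> 1 / real (Suc k)" by (simp add: field_simps)
      then show "E (Suc k) \<subseteq> E k" unfolding E_def by (auto intro: order_trans less_SucI)
    qed
  qed
  also have "(\<Inter>k. E k) = A"
  proof (intro equalityI subsetI)
    fix \<omega> assume \<omega>: "\<omega> \<in> (\<Inter>k. E k)"
    have "GP (s n) \<omega> \<le> 0" for n
    proof (rule LIMSEQ_le_const)
      show "(\<lambda>k. 1 / real (Suc k)) \<longlonglongrightarrow> 0" using LIMSEQ_inverse_real_of_nat by (simp add: divide_inverse)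
      show "\<exists>k0. \<forall>k\<ge>k0. GP (s n) \<omega> \<le> 1 / real (Suc k)"
        using \<omega> by (intro exI[of _ "Suc n"]) (auto simp: E_def)
    qed
    then show "\<omega> \<in> A" using \<omega> by (auto simp: A_def E_def)
  next
    fix \<omega> assume "\<omega> \<in> A"
    then show "\<omega> \<in> (\<Inter>k. E k)" by (auto simp: A_def E_def intro: order_trans)
  qed
  finally have "(\<lambda>k. prob (E k) * \<theta>) \<longlonglongrightarrow> prob A * \<theta>" by (intro tendsto_intros)
  then have "prob A \<le> prob A * \<theta>"
    by (rule LIMSEQ_le_const) (use bound in \<open>auto simp: E_def\<close>)
  then have "prob A * (1 - \<theta>) \<le> 0" by (simp add: algebra_simps)
  then have "prob A \<le> 0" using \<theta> by (simp add: mult_le_0_iff)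
  then show ?thesis using measure_nonneg[of N A] unfolding A_def[symmetric] by linarith
qed

end

section \<open>Oscillation of the empirical process\<close>

text \<open>Induction on n, expanding (S + Y)^4. The terms with odd powers vanish by independence
  and zero means, Y^2 S^2 contributes at most s times n s, and |Y| \<le> 1 bounds Y^4 by Y^2. The
  linear term n s is the one that dominates when n s is small.\<close>

lemma (in prob_space) fourth_moment_sum:
  fixes Y :: "nat \<Rightarrow> 'a \<Rightarrow> real"
  assumes indep: "indep_vars (\<lambda>_. borel) Y UNIV"
    and bound: "\<And>i \<omega>. \<bar>Y i \<omega>\<bar> \<le> 1" and mean: "\<And>i. expectation (Y i) = 0"
    and s: "\<And>i. expectation (\<lambda>\<omega>. (Y i \<omega>)\<^sup>2) \<le> s"
  shows "expectation (\<lambda>\<omega>. (\<Sum>i<n. Y i \<omega>)\<^sup>2) \<le> n * s"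
    and "expectation (\<lambda>\<omega>. (\<Sum>i<n. Y i \<omega>) ^ 4) \<le> 3 * (n * s)\<^sup>2 + n * s"
proof -
  have [measurable]: "Y i \<in> borel_measurable M" for i
    using indep by (simp add: indep_vars_def2)
  define S where "S n \<omega> = (\<Sum>i<n. Y i \<omega>)" for n \<omega>
  have [measurable]: "S n \<in> borel_measurable M" for n unfolding S_def by measurable
  have Sb: "\<bar>S n \<omega>\<bar> \<le> n" for n \<omega>
    unfolding S_def using sum_norm_le[of "{..<n}" "\<lambda>i. Y i \<omega>" "\<lambda>_. 1"] bound by simp
  have powb: "\<bar>x\<bar> \<le> b \<Longrightarrow> \<bar>x ^ k\<bar> \<le> b ^ k" for x b :: real and k
    by (simp add: power_abs power_mono)
  have iS: "integrable M (\<lambda>\<omega>. S n \<omega> ^ k)" for n k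
    by (rule integrable_const_bound[where B="real n ^ k"]) (use powb[OF Sb] in auto)
  have iY: "integrable M (\<lambda>\<omega>. Y i \<omega> ^ k)" for i k
    by (rule integrable_const_bound[where B="1 ^ k"]) (use powb[OF bound] in auto)
  have ind: "indep_var borel (Y n) borel (S n)" for n
  proof -
    have "indep_vars (\<lambda>_. borel) Y (insert n {..<n})" using indep_vars_subset[OF indep] by simp
    from indep_vars_sum[OF _ _ this] show ?thesis unfolding S_def[abs_def] by simp
  qed
  have mult: "expectation (\<lambda>\<omega>. Y n \<omega> ^ j * S n \<omega> ^ k) = expectation (\<lambda>\<omega>. Y n \<omega> ^ j) * expectation (\<lambda>\<omega>. S n \<omega> ^ k)"
    "integrable M (\<lambda>\<omega>. Y n \<omega> ^ j * S n \<omega> ^ k)" for n j k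
  proof -
    have "indep_var borel ((\<lambda>x. x ^ j) \<circ> Y n) borel ((\<lambda>x. x ^ k) \<circ> S n)"
      by (rule indep_var_compose[OF ind]) auto
    then have i: "indep_var borel (\<lambda>\<omega>. Y n \<omega> ^ j) borel (\<lambda>\<omega>. S n \<omega> ^ k)" by (simp add: comp_def)
    show "expectation (\<lambda>\<omega>. Y n \<omega> ^ j * S n \<omega> ^ k) = expectation (\<lambda>\<omega>. Y n \<omega> ^ j) * expectation (\<lambda>\<omega>. S n \<omega> ^ k)"
      by (rule indep_var_lebesgue_integral[OF i iY iS])
    show "integrable M (\<lambda>\<omega>. Y n \<omega> ^ j * S n \<omega> ^ k)"
      by (rule indep_var_integrable[OF i iY iS])
  qed
  have ES: "expectation (S n) = 0" for n
    unfolding S_def using iY[of _ 1] mean by (subst Bochner_Integration.integral_sum) auto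
  have Ssuc: "S (Suc n) \<omega> = S n \<omega> + Y n \<omega>" for n \<omega> by (simp add: S_def)
  have Y4: "expectation (\<lambda>\<omega>. Y i \<omega> ^ 4) \<le> s" for i
  proof -
    have "x ^ 4 \<le> x\<^sup>2" if "\<bar>x\<bar> \<le> 1" for x :: real
      using power_decreasing[of 2 4 "\<bar>x\<bar>"] that by simp
    then have "expectation (\<lambda>\<omega>. Y i \<omega> ^ 4) \<le> expectation (\<lambda>\<omega>. (Y i \<omega>)\<^sup>2)"
      using bound by (intro integral_mono iY) auto
    then show ?thesis using s[of i] by linarith
  qed
  have "0 \<le> expectation (\<lambda>\<omega>. (Y 0 \<omega>)\<^sup>2)" by simp
  then have s0: "0 \<le> s" using s[of 0] by linarith
  have S2: "expectation (\<lambda>\<omega>. (S n \<omega>)\<^sup>2) \<le> n * s" for n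
  proof (induction n)
    case 0 then show ?case by (simp add: S_def)
  next
    case (Suc n)
    have "(\<lambda>\<omega>. (S (Suc n) \<omega>)\<^sup>2) = (\<lambda>\<omega>. S n \<omega> ^ 2 + 2 * (Y n \<omega> ^ 1 * S n \<omega> ^ 1) + Y n \<omega> ^ 2)"
      by (simp add: Ssuc power2_eq_square algebra_simps)
    then have "expectation (\<lambda>\<omega>. (S (Suc n) \<omega>)\<^sup>2) = expectation (\<lambda>\<omega>. S n \<omega> ^ 2)
        + 2 * expectation (\<lambda>\<omega>. Y n \<omega> ^ 1 * S n \<omega> ^ 1) + expectation (\<lambda>\<omega>. Y n \<omega> ^ 2)"
      using mult(2)[of n 1 1] iS[of n 2] iY[of n 2] by simp
    also have "expectation (\<lambda>\<omega>. Y n \<omega> ^ 1 * S n \<omega> ^ 1) = 0" using mult(1)[of n 1 1] ES by simp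
    finally show ?case using Suc s[of n] by (simp add: algebra_simps)
  qed
  have S4: "expectation (\<lambda>\<omega>. S n \<omega> ^ 4) \<le> 3 * (n * s)\<^sup>2 + n * s" for n
  proof (induction n)
    case 0 then show ?case by (simp add: S_def)
  next
    case (Suc n)
    have e: "(\<lambda>\<omega>. S (Suc n) \<omega> ^ 4) = (\<lambda>\<omega>. S n \<omega> ^ 4 + 4 * (Y n \<omega> ^ 1 * S n \<omega> ^ 3)
        + 6 * (Y n \<omega> ^ 2 * S n \<omega> ^ 2) + 4 * (Y n \<omega> ^ 3 * S n \<omega> ^ 1) + Y n \<omega> ^ 4)"
      by (simp add: Ssuc eval_nat_numeral algebra_simps)
    have "expectation (\<lambda>\<omega>. S (Suc n) \<omega> ^ 4) = expectation (\<lambda>\<omega>. S n \<omega> ^ 4)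
        + 4 * expectation (\<lambda>\<omega>. Y n \<omega> ^ 1 * S n \<omega> ^ 3)
        + 6 * expectation (\<lambda>\<omega>. Y n \<omega> ^ 2 * S n \<omega> ^ 2)
        + 4 * expectation (\<lambda>\<omega>. Y n \<omega> ^ 3 * S n \<omega> ^ 1) + expectation (\<lambda>\<omega>. Y n \<omega> ^ 4)"
      unfolding e using mult(2)[of n 1 3] mult(2)[of n 2 2] mult(2)[of n 3 1] iS[of n 4] iY[of n 4] by simp
    also have "expectation (\<lambda>\<omega>. Y n \<omega> ^ 1 * S n \<omega> ^ 3) = 0" using mult(1)[of n 1 3] mean by simp
    also have "expectation (\<lambda>\<omega>. Y n \<omega> ^ 3 * S n \<omega> ^ 1) = 0" using mult(1)[of n 3 1] ES by simp
    also have "expectation (\<lambda>\<omega>. Y n \<omega> ^ 2 * S n \<omega> ^ 2) \<le> s * (n * s)"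
      unfolding mult(1) by (intro mult_mono s S2 s0) auto
    finally have "expectation (\<lambda>\<omega>. S (Suc n) \<omega> ^ 4) \<le> 3 * (n * s)\<^sup>2 + n * s + 6 * (s * (n * s)) + s"
      using Suc Y4[of n] by simp
    \<comment> \<open>3 (n + 1)^2 s^2 exceeds 3 n^2 s^2 by at least the cross term 6 n s^2.\<close>
    also have "\<dots> \<le> 3 * (Suc n * s)\<^sup>2 + Suc n * s"
      by (simp add: power2_eq_square algebra_simps)
    finally show ?case .
  qed
  show "expectation (\<lambda>\<omega>. (\<Sum>i<n. Y i \<omega>)\<^sup>2) \<le> n * s" using S2[of n] by (simp add: S_def)
  show "expectation (\<lambda>\<omega>. (\<Sum>i<n. Y i \<omega>) ^ 4) \<le> 3 * (n * s)\<^sup>2 + n * s" using S4[of n] by (simp add: S_def)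
qed

section \<open>Dyadic chaining on quantile levels\<close>

locale iid_sample = prob_space M for M :: "'a measure" +
  fixes Z :: "nat \<Rightarrow> 'a \<Rightarrow> real" and D :: "real measure"
  assumes indep_Z: "indep_vars (\<lambda>_. borel) Z UNIV"
    and distr_Z: "distr M borel (Z i) = D"
    and continuous_cdf: "continuous_on UNIV (cdf D)"
begin

lemma Z_measurable[measurable]: "Z i \<in> borel_measurable M"
  using indep_Z by (simp add: indep_vars_def2)

lemma real_distribution_D: "real_distribution D"
  using real_distribution_distr[OF Z_measurable] distr_Z by metis

sublocale D: real_distribution D by (rule real_distribution_D)

lemma expectation_Z:
  fixes f :: "real \<Rightarrow> real"
  shows "f \<in> borel_measurable borel \<Longrightarrow> expectation (\<lambda>\<omega>. f (Z i \<omega>)) = integral\<^sup>L D f"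
  by (subst distr_Z[symmetric, of i], subst integral_distr) auto

text \<open>Continuity of the cdf enters here: by the intermediate value theorem every level in (0,
  1) is attained.\<close>

lemma cdf_surj:
  assumes "0 < u" "u < 1" obtains t where "cdf D t = u"
proof -
  have "eventually (\<lambda>t. cdf D t < u) at_bot"
    using order_tendstoD(2)[OF D.cdf_lim_at_bot assms(1)] .
  then obtain a where a: "cdf D a < u" by (auto simp: eventually_at_bot_linorder)
  have "eventually (\<lambda>t. cdf D t > u) at_top"
    using order_tendstoD(1)[OF D.cdf_lim_at_top_prob assms(2)] .
  then obtain b where b: "u < cdf D b" by (auto simp: eventually_at_top_linorder)
  have "a \<le> b"
    by (rule ccontr) (use D.cdf_nondecreasing[of b a] a b in linarith)
  then show ?thesis
    using IVT'[of "cdf D" a u b] a b continuous_on_subset[OF continuous_cdf] that by force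
qed

text \<open>Where the cdf is flat any point of level u will do: the arguments use only that the
  chosen point has level u.\<close>

definition quantile :: "real \<Rightarrow> real" where "quantile u = (SOME t. cdf D t = u)"

lemma cdf_quantile: "0 < u \<Longrightarrow> u < 1 \<Longrightarrow> cdf D (quantile u) = u"
  unfolding quantile_def using cdf_surj by (metis (mono_tags) someI)

text \<open>\<open>lower u\<close> is a half-line of \<open>D\<close>-measure \<open>u\<close>, with the two end cases (where no quantile
  need exist) filled in.\<close>

definition lower :: "real \<Rightarrow> real set" where
  "lower u = (if u \<le> 0 then {} else if 1 \<le> u then UNIV else {..quantile u})"

lemma lower_borel[measurable]: "lower u \<in> sets borel" by (simp add: lower_def)

lemma measure_lower: "0 \<le> u \<Longrightarrow> u \<le> 1 \<Longrightarrow> measure D (lower u) = u"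
  using cdf_quantile[of u] D.prob_space by (auto simp: lower_def cdf_def)

lemma lower_mono: assumes "u \<le> v" shows "lower u \<subseteq> lower v"
proof -
  have "quantile u \<le> quantile v" if "0 < u" "v < 1" "u < v"
    using D.cdf_nondecreasing[of "quantile v" "quantile u"] cdf_quantile[of u] cdf_quantile[of v] that
    by force
  then show ?thesis using assms by (cases "u = v") (auto simp: lower_def)
qed

text \<open>The empirical process with time measured by the level u. Since \<open>lower u\<close>
  has D-measure u on [0, 1], it behaves like the uniform empirical process, and one dyadic grid
  serves every D. It counts points in lower half-lines and is therefore compared with minus
  \<open>surv_process\<close>.\<close>

definition level_process :: "nat \<Rightarrow> real \<Rightarrow> 'a \<Rightarrow> real" where
  "level_process n u \<omega> = (\<Sum>i<n. indicator (lower u) (Z i \<omega>) - u) / sqrt n"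

definition surv_process :: "nat \<Rightarrow> real \<Rightarrow> 'a \<Rightarrow> real" where
  "surv_process n t \<omega> = (\<Sum>i<n. indicator {t<..} (Z i \<omega>) - measure D {t<..}) / sqrt n"

lemma level_process_measurable[measurable]: "level_process n u \<in> borel_measurable M"
  unfolding level_process_def by measurable

text \<open>The increment is a normalised sum of centred indicators of
  \<open>lower v - lower u\<close>, whose variance is at most v - u. The second term is harmless as
  long as v - u \<ge> 1/n.\<close>

lemma level_process_fourth_moment:
  assumes "0 \<le> u" "u \<le> v" "v \<le> 1" "0 < n"
  shows "expectation (\<lambda>\<omega>. (level_process n v \<omega> - level_process n u \<omega>) ^ 4) \<le> 3 * (v - u)\<^sup>2 + (v - u) / n"
proof -
  let ?B = "lower v - lower u"
  let ?p = "v - u"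
  have pB: "measure D ?B = ?p"
    using D.finite_measure_Diff[of "lower v" "lower u"] lower_mono[OF assms(2)] measure_lower[of u] measure_lower[of v] assms
    by simp
  define Y where "Y i \<omega> = indicator ?B (Z i \<omega>) - ?p" for i \<omega>
  have ind: "indep_vars (\<lambda>_. borel) Y UNIV"
    unfolding Y_def by (rule indep_vars_compose2[OF indep_Z]) measurable
  have Yb: "\<bar>Y i \<omega>\<bar> \<le> 1" for i \<omega> using assms by (auto simp: Y_def indicator_def)
  have intB: "integrable D (indicator ?B :: real \<Rightarrow> real)"
    by (rule D.integrable_const_bound[where B=1]) auto
  have mean: "expectation (Y i) = 0" for i
    unfolding Y_def using expectation_Z[of "\<lambda>x. indicator ?B x - ?p" i] intB D.prob_space pB by simp
  have var: "expectation (\<lambda>\<omega>. (Y i \<omega>)\<^sup>2) \<le> ?p" for i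
  proof -
    have "(\<lambda>x. (indicator ?B x - ?p)\<^sup>2) = (\<lambda>x. (1 - 2 * ?p) * indicator ?B x + ?p\<^sup>2)"
      by (auto simp: fun_eq_iff indicator_def power2_eq_square algebra_simps)
    then have "expectation (\<lambda>\<omega>. (Y i \<omega>)\<^sup>2) = (1 - 2 * ?p) * ?p + ?p\<^sup>2"
      unfolding Y_def using expectation_Z[of "\<lambda>x. (indicator ?B x - ?p)\<^sup>2" i] intB D.prob_space pB by simp
    also have "\<dots> = ?p - ?p\<^sup>2" by (simp add: power2_eq_square algebra_simps)
    finally show ?thesis by simp
  qed
  have diff: "level_process n v \<omega> - level_process n u \<omega> = (\<Sum>i<n. Y i \<omega>) / sqrt n" for \<omega>
  proof -
    have e: "indicator (lower v) x - v - (indicator (lower u) x - u) = (indicator ?B x - ?p :: real)" for x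
      using lower_mono[OF assms(2)] by (auto simp: indicator_def)
    show ?thesis
      unfolding level_process_def Y_def diff_divide_distrib[symmetric] sum_subtractf[symmetric] e ..
  qed
  have "expectation (\<lambda>\<omega>. (level_process n v \<omega> - level_process n u \<omega>) ^ 4)
      = expectation (\<lambda>\<omega>. (\<Sum>i<n. Y i \<omega>) ^ 4) / (real n)\<^sup>2"
  proof -
    have "sqrt n ^ 4 = (real n)\<^sup>2" using power_mult[of "sqrt n" 2 2] by simp
    then show ?thesis unfolding diff power_divide by simp
  qed
  also have "\<dots> \<le> (3 * (n * ?p)\<^sup>2 + n * ?p) / (real n)\<^sup>2"
    by (intro divide_right_mono fourth_moment_sum(2)[OF ind Yb mean var]) auto
  also have "\<dots> = 3 * ?p\<^sup>2 + ?p / n"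
    using assms(4) by (simp add: power2_eq_square field_simps)
  finally show ?thesis .
qed

text \<open>Any ratio \<open>r\<close> with \<open>1/2 < r ^ 4 < 1\<close> could replace \<open>9/10\<close>: the thresholds \<open>r ^ k\<close> and the
  probabilities, of order \<open>(2 * r ^ 4) powi - k\<close>, are then both summable over the levels \<open>k\<close>.\<close>

definition bad :: "nat \<Rightarrow> nat \<Rightarrow> 'a set" where
  "bad n k = {\<omega> \<in> space M. \<exists>j<2^k. \<bar>level_process n (real (Suc j) / 2^k) \<omega> - level_process n (real j / 2^k) \<omega>\<bar> \<ge> (9/10)^k}"

lemma bad_measurable[measurable]: "bad n k \<in> events"
  unfolding bad_def by measurable

text \<open>With p = 2^-k \<ge> 1/n the fourth moment of one increment is at most 4 p^2. Markov's
  inequality at (9/10)^k and a union over 2^k = 1/p increments leave 4 p / (9/10)^(4k), that is 4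
  (5000/6561)^k, and 5000/6561 < 4/5.\<close>

lemma prob_bad:
  assumes "2 ^ k \<le> n"
  shows "prob (bad n k) \<le> 4 * (4/5) ^ k"
proof -
  have "0 < n" using assms by (metis gr0I le_zero_eq power_not_zero zero_neq_numeral)
  define W where "W j \<omega> = level_process n (real (Suc j) / 2^k) \<omega> - level_process n (real j / 2^k) \<omega>" for j \<omega>
  have [measurable]: "W j \<in> borel_measurable M" for j unfolding W_def by measurable
  define p :: real where "p = 1 / 2 ^ k"
  have p: "0 < p" "1 / n \<le> p" "2 ^ k * p = 1"
    using assms \<open>0 < n\<close> by (auto simp: p_def field_simps)
  have one: "prob {\<omega> \<in> space M. \<bar>W j \<omega>\<bar> \<ge> (9/10)^k} \<le> 4 * p\<^sup>2 / ((9/10)^k)^4" if "j < 2^k" for j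
  proof -
    have d: "real (Suc j) / 2^k - real j / 2^k = p" by (simp add: p_def field_simps)
    have "real (Suc j) \<le> 2 ^ k" using that by (metis Suc_leI of_nat_le_iff of_nat_numeral of_nat_power)
    then have "expectation (\<lambda>\<omega>. (level_process n (real (Suc j) / 2^k) \<omega> - level_process n (real j / 2^k) \<omega>) ^ 4)
        \<le> 3 * (real (Suc j) / 2^k - real j / 2^k)\<^sup>2 + (real (Suc j) / 2^k - real j / 2^k) / n"
      using \<open>0 < n\<close> by (intro level_process_fourth_moment) (auto intro: divide_right_mono)
    then have "expectation (\<lambda>\<omega>. W j \<omega> ^ 4) \<le> 3 * p\<^sup>2 + p / n"
      unfolding d W_def .
    also have "p / n \<le> p\<^sup>2" using mult_left_mono[OF p(2), of p] p(1) by (simp add: power2_eq_square)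
    finally have E: "expectation (\<lambda>\<omega>. W j \<omega> ^ 4) \<le> 4 * p\<^sup>2" by simp
    \<comment> \<open>A crude bound, used only for integrability.\<close>
    have Wb: "\<bar>W j \<omega>\<bar> \<le> 4 * n / sqrt n" for \<omega>
    proof -
      have l: "\<bar>level_process n u \<omega>\<bar> \<le> 2 * n / sqrt n" if "0 \<le> u" "u \<le> 1" for u
      proof -
        have "\<bar>\<Sum>i<n. indicator (lower u) (Z i \<omega>) - u\<bar> \<le> (\<Sum>i<n. 2)"
          using that by (intro order_trans[OF sum_abs] sum_mono) (auto simp: indicator_def)
        then show ?thesis unfolding level_process_def abs_divide by (auto intro!: divide_right_mono)
      qed
      have "\<bar>level_process n (real (Suc j) / 2^k) \<omega>\<bar> \<le> 2 * n / sqrt n" "\<bar>level_process n (real j / 2^k) \<omega>\<bar> \<le> 2 * n / sqrt n"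
        using \<open>real (Suc j) \<le> 2 ^ k\<close> \<open>j < 2 ^ k\<close> by (intro l; simp)+
      moreover have "4 * n / sqrt n = 2 * n / sqrt n + 2 * n / sqrt n" by simp
      ultimately show ?thesis unfolding W_def by linarith
    qed
    have int: "integrable M (\<lambda>\<omega>. W j \<omega> ^ 4)"
      by (rule integrable_const_bound[where B="(4 * real n / sqrt n) ^ 4"])
        (use power_mono[OF Wb, where n=4] in \<open>auto simp: power_abs\<close>)
    have "prob {\<omega> \<in> space M. \<bar>W j \<omega>\<bar> \<ge> (9/10)^k} \<le> prob {\<omega> \<in> space M. W j \<omega> ^ 4 \<ge> ((9/10)^k)^4}"
    proof (rule finite_measure_mono)
      show "{\<omega> \<in> space M. \<bar>W j \<omega>\<bar> \<ge> (9/10)^k} \<subseteq> {\<omega> \<in> space M. W j \<omega> ^ 4 \<ge> ((9/10)^k)^4}"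
        using power_mono[of "(9/10)^k" "\<bar>W j _\<bar>" 4] by (auto simp: power_even_abs)
    qed measurable
    also have "\<dots> \<le> expectation (\<lambda>\<omega>. W j \<omega> ^ 4) / ((9/10)^k)^4"
      by (rule integral_Markov_inequality_measure[where A="space M - space M"]) (use int in auto)
    also have "\<dots> \<le> 4 * p\<^sup>2 / ((9/10)^k)^4" using E by (intro divide_right_mono) auto
    finally show ?thesis .
  qed
  have "bad n k = (\<Union>j<2^k. {\<omega> \<in> space M. \<bar>W j \<omega>\<bar> \<ge> (9/10)^k})" unfolding bad_def W_def by auto
  then have "prob (bad n k) \<le> (\<Sum>j<2^k. prob {\<omega> \<in> space M. \<bar>W j \<omega>\<bar> \<ge> (9/10)^k})"
    by (auto intro!: finite_measure_subadditive_finite)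
  also have "\<dots> \<le> (\<Sum>j<2^k::nat. 4 * p\<^sup>2 / ((9/10)^k)^4)" by (intro sum_mono one) simp
  also have "\<dots> = 4 * p / ((9/10)^k)^4" using p(3) by (simp add: power2_eq_square)
  also have "\<dots> = 4 * (5000/6561) ^ k"
  proof -
    have "((9/10::real)^k)^4 = ((9/10)^4)^k" by (simp only: mult.commute[of k] flip: power_mult)
    also have "(9/10::real)^4 = 6561/10000" by (simp add: power_divide)
    finally have "p / ((9/10)^k)^4 = ((1/2) / (6561/10000))^k" by (simp only: p_def power_divide power_one)
    then show ?thesis by simp
  qed
  also have "\<dots> \<le> 4 * (4/5) ^ k" by (intro mult_left_mono power_mono) auto
  finally show ?thesis .
qed

text \<open>The point j / 2^k is linked to its ancestor at level m by repeatedly halving j. One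
  halving keeps the point or moves it to the left neighbour on the finer grid, at a cost below the
  threshold of that level. The geometric sum of the costs is 9 ((9/10)^m - (9/10)^k); the factor 10
  rounds it up.\<close>

lemma level_process_chain:
  assumes "m \<le> k" "k \<le> K" "\<omega> \<in> space M" "\<And>l. m \<le> l \<Longrightarrow> l \<le> K \<Longrightarrow> \<omega> \<notin> bad n l" "j \<le> 2 ^ k"
  shows "\<bar>level_process n (real j / 2^k) \<omega> - level_process n (real (j div 2^(k-m)) / 2^m) \<omega>\<bar>
     \<le> 10 * ((9/10)^m - (9/10)^k)"
  using assms(1,2,5)
proof (induction k arbitrary: j rule: dec_induct)
  case base
  then show ?case by simp
next
  case (step k)
  let ?j = "j div 2"
  have nb: "\<omega> \<notin> bad n (Suc k)" using assms(4) step by simp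
  have t1: "\<bar>level_process n (real j / 2^Suc k) \<omega> - level_process n (real ?j / 2^k) \<omega>\<bar> \<le> (9/10)^Suc k"
  proof (cases "even j")
    case True
    then show ?thesis by (simp add: real_of_nat_div)
  next
    case False
    then have j: "j = Suc (2 * ?j)" by presburger
    then have "2 * ?j < 2 ^ Suc k" using step.prems by linarith
    then have "\<bar>level_process n (real j / 2^Suc k) \<omega> - level_process n (real (2 * ?j) / 2^Suc k) \<omega>\<bar> < (9/10)^Suc k"
      using nb assms(3) j unfolding bad_def by (metis (mono_tags, lifting) mem_Collect_eq not_less)
    moreover have "real (2 * ?j) / 2 ^ Suc k = real ?j / 2 ^ k" by simp
    ultimately show ?thesis by simp
  qed
  have t2: "\<bar>level_process n (real ?j / 2^k) \<omega> - level_process n (real (?j div 2^(k-m)) / 2^m) \<omega>\<bar>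
     \<le> 10 * ((9/10)^m - (9/10)^k)"
    using step.IH[of ?j] step.prems by simp
  have dd: "?j div 2^(k-m) = j div 2^(Suc k - m)"
    using step.hyps by (simp add: Suc_diff_le div_mult2_eq)
  have "10 * ((9/10)^m - (9/10)^k) + (9/10)^Suc k \<le> 10 * ((9/10)^m - (9/10 :: real)^Suc k)" by simp
  moreover have "\<bar>x - z\<bar> \<le> A + B" if "\<bar>x - y\<bar> \<le> B" "\<bar>y - z\<bar> \<le> A" for x y z A B :: real
    using that by linarith
  ultimately show ?case using t1 t2[unfolded dd] by (blast intro: order_trans)
qed

lemma level_process_neighbours:
  assumes "\<omega> \<in> space M" "\<omega> \<notin> bad n m" "i + d \<le> 2 ^ m"
  shows "\<bar>level_process n (real (i + d) / 2^m) \<omega> - level_process n (real i / 2^m) \<omega>\<bar> \<le> d * (9/10)^m"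
  using assms(3)
proof (induction d)
  case (Suc d)
  have "\<bar>level_process n (real (Suc (i + d)) / 2^m) \<omega> - level_process n (real (i + d) / 2^m) \<omega>\<bar> < (9/10)^m"
    using assms(1,2) Suc.prems unfolding bad_def
    by (metis (mono_tags, lifting) mem_Collect_eq not_less Suc_le_lessD add_Suc_right)
  with Suc show ?case by (simp add: algebra_simps)
qed simp

text \<open>Indices at most 4 * 2^(K-m) apart have ancestors at level m at most 4 steps apart. The
  two chains cost 10 (9/10)^m each and the steps 4 (9/10)^m; 25 rounds up the total of 24.\<close>

lemma level_process_close:
  assumes "m \<le> K" "\<omega> \<in> space M" "\<And>l. m \<le> l \<Longrightarrow> l \<le> K \<Longrightarrow> \<omega> \<notin> bad n l"
    and ij: "i \<le> j" "j \<le> 2 ^ K" "j \<le> i + 4 * 2 ^ (K - m)"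
  shows "\<bar>level_process n (real i / 2^K) \<omega> - level_process n (real j / 2^K) \<omega>\<bar> \<le> 25 * (9/10)^m"
proof -
  let ?i = "i div 2^(K-m)" and ?j = "j div 2^(K-m)"
  have "?j \<le> (i + 4 * 2 ^ (K - m)) div 2 ^ (K - m)" using ij(3) by (rule div_le_mono)
  also have "\<dots> = ?i + 4" by simp
  finally have d: "?j - ?i \<le> 4" by simp
  have le: "?i \<le> ?j" using ij(1) by (rule div_le_mono)
  have "?j \<le> 2 ^ K div 2 ^ (K - m)" using ij(2) by (rule div_le_mono)
  also have "\<dots> = 2 ^ m" using assms(1) by (simp flip: power_diff)
  finally have "\<bar>level_process n (real ?j / 2^m) \<omega> - level_process n (real ?i / 2^m) \<omega>\<bar> \<le> (?j - ?i) * (9/10)^m"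
    using level_process_neighbours[OF assms(2), of n m ?i "?j - ?i"] assms(1,3) le by simp
  also have "\<dots> \<le> 4 * (9/10)^m" using d by (intro mult_right_mono) auto
  finally have "\<bar>level_process n (real ?j / 2^m) \<omega> - level_process n (real ?i / 2^m) \<omega>\<bar> \<le> 4 * (9/10)^m" .
  moreover have c: "\<bar>level_process n (real h / 2^K) \<omega> - level_process n (real (h div 2^(K-m)) / 2^m) \<omega>\<bar> \<le> 10 * (9/10)^m"
    if "h \<le> 2 ^ K" for h
  proof -
    have "\<bar>level_process n (real h / 2^K) \<omega> - level_process n (real (h div 2^(K-m)) / 2^m) \<omega>\<bar> \<le> 10 * ((9/10)^m - (9/10)^K)"
      using level_process_chain[OF assms(1) order_refl assms(2,3) that] .
    also have "\<dots> \<le> 10 * (9/10)^m" by simp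
    finally show ?thesis .
  qed
  moreover have "0 \<le> (9/10 :: real)^m" by simp
  ultimately show ?thesis using c[of i] c[of j] ij by linarith
qed

text \<open>Monotonicity of half-lines closes the gap below the finest grid: \<open>{..x}\<close>
  lies between two sets \<open>lower\<close> whose levels differ from \<open>cdf D x\<close> by at
  most 2 / 2^K. Recentring costs sqrt n * 2 / 2^K, at most 4 / sqrt n because n < 2^(K+1); doing so
  at s and at t gives 8 / sqrt n.\<close>

lemma surv_process_close:
  assumes "m \<le> K" "\<omega> \<in> space M" "\<And>l. m \<le> l \<Longrightarrow> l \<le> K \<Longrightarrow> \<omega> \<notin> bad n l"
    and n: "2 ^ K \<le> n" "n < 2 ^ Suc K" and st: "\<bar>cdf D s - cdf D t\<bar> \<le> 1 / 2 ^ m"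
  shows "surv_process n s \<omega> - surv_process n t \<omega> \<le> 25 * (9/10)^m + 8 / sqrt n"
proof -
  have n0: "0 < n" using n(1) by (metis gr0I le_zero_eq power_not_zero zero_neq_numeral)
  let ?N = "2 ^ K :: nat"
  define h where "h x = nat \<lfloor>cdf D x * ?N\<rfloor>" for x
  have F: "0 \<le> cdf D x" "cdf D x \<le> 1" for x by (simp_all add: D.cdf_nonneg D.cdf_bounded_prob)
  have h: "real (h x) \<le> cdf D x * ?N" "cdf D x * ?N < real (h x) + 1" for x
    unfolding h_def using F(1)[of x] by (auto simp: of_nat_nat)
  have hN: "h x \<le> ?N" for x
  proof -
    have "real (h x) \<le> real ?N" using h(1)[of x] mult_right_mono[OF F(2)[of x], of "real ?N"] by linarith
    then show ?thesis by linarith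
  qed
  \<comment> \<open>Stepping off the rounded level makes the comparison with \<open>cdf D x\<close>
    strict, as the inclusion of half-lines requires where the cdf is flat. At the ends, truncated
    subtraction gives level 0, whose set is empty, and the minimum gives level 1, whose set is
    everything.\<close>
  define a where "a x = h x - 1" for x
  define b where "b x = min (h x + 1) ?N" for x
  have surv: "measure D {x<..} = 1 - cdf D x" for x
    using D.prob_compl[of "{..x}"] by (simp add: cdf_def Compl_eq_Diff_UNIV[symmetric])
  have sets: "lower (real (a x) / ?N) \<subseteq> {..x}" "{..x} \<subseteq> lower (real (b x) / ?N)" for x
  proof -
    show "lower (real (a x) / ?N) \<subseteq> {..x}"
    proof (cases "a x = 0")
      case True then show ?thesis by (simp add: lower_def)
    next
      case False
      then have "real (a x) < cdf D x * ?N" using h(1)[of x] by (auto simp: a_def)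
      then have l: "real (a x) / ?N < cdf D x" by (simp add: field_simps)
      have u: "0 < real (a x) / ?N" "real (a x) / ?N < 1" using False l F(2)[of x] by (simp, linarith)
      have "quantile (real (a x) / ?N) < x"
        using D.cdf_nondecreasing[of x "quantile (real (a x) / ?N)"] cdf_quantile[OF u] l by force
      then show ?thesis using u by (auto simp: lower_def)
    qed
    show "{..x} \<subseteq> lower (real (b x) / ?N)"
    proof (cases "b x = ?N")
      case True then show ?thesis by (simp add: lower_def)
    next
      case False
      then have bx: "b x = h x + 1" "b x < ?N" by (auto simp: b_def)
      then have l: "cdf D x < real (b x) / ?N" using h(2)[of x] by (simp add: field_simps)
      have "real (b x) < real ?N" using bx(2) by (simp only: of_nat_less_iff)
      then have u: "0 < real (b x) / ?N" "real (b x) / ?N < 1" using bx(1) by auto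
      have "x < quantile (real (b x) / ?N)"
        using D.cdf_nondecreasing[of "quantile (real (b x) / ?N)" x] cdf_quantile[OF u] l by force
      then show ?thesis using u by (auto simp: lower_def)
    qed
  qed
  have ab: "cdf D x * ?N - 2 \<le> a x" "a x \<le> cdf D x * ?N" "cdf D x * ?N - 1 \<le> b x" "b x \<le> cdf D x * ?N + 1" for x
  proof -
    show "cdf D x * ?N - 2 \<le> a x" "a x \<le> cdf D x * ?N" "b x \<le> cdf D x * ?N + 1"
      using h[of x] F(1)[of x] by (auto simp: a_def b_def)
    have "cdf D x * real ?N \<le> 1 * real ?N" by (intro mult_right_mono F) simp
    moreover have "b x = h x + 1 \<or> b x = ?N" by (auto simp: b_def min_def)
    then have "real (b x) = real (h x) + 1 \<or> real (b x) = real ?N" by auto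
    ultimately show "cdf D x * ?N - 1 \<le> b x" using h[of x] by linarith
  qed
  have sqrt: "sqrt n * (2 / ?N) \<le> 4 / sqrt n"
  proof -
    have "real n \<le> real (2 ^ Suc K)" using n(2) by (simp only: of_nat_le_iff less_imp_le)
    then have "real n \<le> 2 * real ?N" by simp
    then have "sqrt n * sqrt n \<le> 2 * real ?N" by simp
    then show ?thesis using n0 by (simp add: field_simps)
  qed
  have upper: "level_process n (real (a x) / ?N) \<omega> - 4 / sqrt n \<le> - surv_process n x \<omega>"
   and lower: "- surv_process n x \<omega> \<le> level_process n (real (b x) / ?N) \<omega> + 4 / sqrt n" for x
  proof -
    have e: "- (indicator {x<..} z - (1 - cdf D x)) = (indicator {..x} z :: real) - cdf D x" for z
      by (auto simp: indicator_def)
    have sp: "- surv_process n x \<omega> = (\<Sum>i<n. indicator {..x} (Z i \<omega>) - cdf D x) / sqrt n"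
      unfolding surv_process_def surv minus_divide_left sum_negf[symmetric] e ..
    have "(\<Sum>i<n. indicator (lower (real (a x) / ?N)) (Z i \<omega>) - real (a x) / ?N) - n * (2 / ?N)
        = (\<Sum>i<n. indicator (lower (real (a x) / ?N)) (Z i \<omega>) - real (a x) / ?N - 2 / ?N)"
      by (simp add: sum_subtractf)
    also have "\<dots> \<le> (\<Sum>i<n. indicator {..x} (Z i \<omega>) - cdf D x)"
    proof (rule sum_mono)
      fix i
      have "(indicator (lower (real (a x) / ?N)) (Z i \<omega>) :: real) \<le> indicator {..x} (Z i \<omega>)"
        using sets(1)[of x] by (auto simp: indicator_def)
      moreover have "cdf D x \<le> real (a x) / ?N + 2 / ?N" using ab(1)[of x] by (simp add: field_simps)
      ultimately show "indicator (lower (real (a x) / ?N)) (Z i \<omega>) - real (a x) / ?N - 2 / ?N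
          \<le> indicator {..x} (Z i \<omega>) - cdf D x" by linarith
    qed
    finally have "level_process n (real (a x) / ?N) \<omega> - n * (2 / ?N) / sqrt n \<le> - surv_process n x \<omega>"
      unfolding sp level_process_def diff_divide_distrib[symmetric] by (intro divide_right_mono) auto
    moreover have r: "n * (2 / ?N) / sqrt n = sqrt n * (2 / ?N)" using n0 by (simp add: field_simps)
    ultimately show "level_process n (real (a x) / ?N) \<omega> - 4 / sqrt n \<le> - surv_process n x \<omega>"
      using sqrt by linarith
    have "(\<Sum>i<n. indicator {..x} (Z i \<omega>) - cdf D x)
       \<le> (\<Sum>i<n. indicator (lower (real (b x) / ?N)) (Z i \<omega>) - real (b x) / ?N + 2 / ?N)"
    proof (rule sum_mono)
      fix i
      have "(indicator {..x} (Z i \<omega>) :: real) \<le> indicator (lower (real (b x) / ?N)) (Z i \<omega>)"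
        using sets(2)[of x] by (auto simp: indicator_def)
      moreover have "real (b x) / ?N \<le> cdf D x + 2 / ?N" using ab(4)[of x] by (simp add: field_simps)
      ultimately show "indicator {..x} (Z i \<omega>) - cdf D x
          \<le> indicator (lower (real (b x) / ?N)) (Z i \<omega>) - real (b x) / ?N + 2 / ?N" by linarith
    qed
    also have "\<dots> = (\<Sum>i<n. indicator (lower (real (b x) / ?N)) (Z i \<omega>) - real (b x) / ?N) + n * (2 / ?N)"
      by (simp add: sum.distrib)
    finally have "- surv_process n x \<omega> \<le> level_process n (real (b x) / ?N) \<omega> + n * (2 / ?N) / sqrt n"
      unfolding sp level_process_def add_divide_distrib[symmetric] by (intro divide_right_mono) auto
    then show "- surv_process n x \<omega> \<le> level_process n (real (b x) / ?N) \<omega> + 4 / sqrt n"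
      using sqrt r by linarith
  qed
  \<comment> \<open>Rounding costs at most 3 grid steps and 2^(K-m) is at least 1, so 2^(K-m) + 3
    fits into 4 * 2^(K-m).\<close>
  have d: "x \<le> y + 4 * 2 ^ (K - m)" if "real x \<le> real y + \<bar>cdf D s - cdf D t\<bar> * ?N + 3" for x y :: nat
  proof -
    have e: "real (2 ^ (K - m)) = 1 / 2 ^ m * ?N"
      using assms(1) power_diff[of "2::real" m K] by simp
    have "\<bar>cdf D s - cdf D t\<bar> * ?N \<le> 1 / 2 ^ m * ?N" by (intro mult_right_mono st) auto
    moreover have "1 \<le> real (2 ^ (K - m))" by simp
    ultimately have "real x \<le> real y + 4 * real (2 ^ (K - m))" using that e by linarith
    then have "real x \<le> real (y + 4 * 2 ^ (K - m))" by simp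
    then show ?thesis by (simp only: of_nat_le_iff)
  qed
  have "\<bar>cdf D s - cdf D t\<bar> * ?N = \<bar>cdf D s * ?N - cdf D t * ?N\<bar>"
    by (simp add: abs_mult flip: left_diff_distrib)
  then have "b t \<le> a s + 4 * 2 ^ (K - m)" "a s \<le> b t + 4 * 2 ^ (K - m)"
    using ab[of s] ab[of t] by (intro d; linarith)+
  moreover have "b t \<le> 2 ^ K" "a s \<le> 2 ^ K" using hN[of s] by (auto simp: a_def b_def)
  ultimately have "\<bar>level_process n (real (b t) / 2^K) \<omega> - level_process n (real (a s) / 2^K) \<omega>\<bar> \<le> 25 * (9/10)^m"
    using level_process_close[OF assms(1-3), of "a s" "b t"] level_process_close[OF assms(1-3), of "b t" "a s"]
    by (cases "a s \<le> b t") (auto simp: abs_minus_commute)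
  then show ?thesis using upper[of s] lower[of t] by simp
qed

text \<open>The union of \<open>bad n k\<close> over m \<le> k \<le> K has probability at most 20
  (4/5)^m by the geometric series. One explicit exceptional event serves all pairs s, t, so no
  supremum over pairs has to be measurable.\<close>

lemma surv_process_oscillation:
  assumes "0 < \<eta>" "0 < \<epsilon>"
  obtains \<delta> n0 where "0 < \<delta>" "\<And>n. n \<ge> n0 \<Longrightarrow> \<exists>B\<in>events. prob B \<le> \<epsilon> \<and>
    (\<forall>\<omega>\<in>space M - B. \<forall>s t. \<bar>cdf D s - cdf D t\<bar> \<le> \<delta> \<longrightarrow> \<bar>surv_process n s \<omega> - surv_process n t \<omega>\<bar> \<le> \<eta>)"
proof -
  have "(\<lambda>m. 25 * (9/10::real)^m) \<longlonglongrightarrow> 0" "(\<lambda>m. 20 * (4/5::real)^m) \<longlonglongrightarrow> 0"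
    by (auto intro!: tendsto_mult_right_zero LIMSEQ_power_zero)
  then have "eventually (\<lambda>m. 25 * (9/10::real)^m < \<eta> / 2 \<and> 20 * (4/5::real)^m < \<epsilon>) sequentially"
    using assms by (intro eventually_conj order_tendstoD(2)[of _ "0::real"]) auto
  then obtain m :: nat where m: "25 * (9/10::real)^m < \<eta> / 2" "20 * (4/5::real)^m < \<epsilon>"
    by (auto simp: eventually_sequentially)
  have "filterlim (\<lambda>n. sqrt (real n)) at_top sequentially"
    by (rule filterlim_compose[OF sqrt_at_top filterlim_real_sequentially])
  then have "(\<lambda>n. 8 / sqrt (real n)) \<longlonglongrightarrow> 0" by (rule real_tendsto_divide_at_top[OF tendsto_const])
  then have "eventually (\<lambda>n. 8 / sqrt (real n) < \<eta> / 2) sequentially"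
    using assms by (intro order_tendstoD(2)[of _ "0::real"]) auto
  then obtain n1 where n1: "\<And>n. n \<ge> n1 \<Longrightarrow> 8 / sqrt (real n) < \<eta> / 2" by (auto simp: eventually_sequentially)
  show thesis
  proof (rule that[of "1 / 2 ^ m" "max n1 (2 ^ m)"])
    fix n assume n: "n \<ge> max n1 (2 ^ m)"
    then have "0 < n" using zero_less_power[of "2::nat" m] by linarith
    then obtain K where K: "2 ^ K \<le> n" "n < 2 ^ Suc K" using ex_power_ivl1[of 2 n] by auto
    have "(2::nat) ^ m < 2 ^ Suc K" using n K by linarith
    then have "m \<le> K" using power_strict_increasing_iff[of "2::nat" m "Suc K"] by simp
    define B where "B = (\<Union>k\<in>{m..K}. bad n k)"
    have "prob B \<le> (\<Sum>k=m..K. prob (bad n k))"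
      unfolding B_def by (intro finite_measure_subadditive_finite) auto
    also have "\<dots> \<le> (\<Sum>k=m..K. 4 * (4/5) ^ k)"
    proof (intro sum_mono prob_bad)
      fix k assume "k \<in> {m..K}"
      then have "(2::nat) ^ k \<le> 2 ^ K" by (intro power_increasing) auto
      then show "2 ^ k \<le> n" using K by linarith
    qed
    also have "\<dots> = 4 * ((4/5)^m - (4/5)^Suc K) / (1 / 5)"
      using sum_gp_multiplied[OF \<open>m \<le> K\<close>, of "4/5::real"] by (simp flip: sum_distrib_left)
    also have "\<dots> \<le> 20 * (4/5)^m" by simp
    finally have "prob B \<le> \<epsilon>" using m(2) by linarith
    moreover have "\<bar>surv_process n s \<omega> - surv_process n t \<omega>\<bar> \<le> \<eta>"
      if "\<omega> \<in> space M - B" "\<bar>cdf D s - cdf D t\<bar> \<le> 1 / 2 ^ m" for \<omega> s t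
    proof -
      have w: "\<omega> \<in> space M" "\<And>l. m \<le> l \<Longrightarrow> l \<le> K \<Longrightarrow> \<omega> \<notin> bad n l" using that(1) by (auto simp: B_def)
      show ?thesis
        using surv_process_close[OF \<open>m \<le> K\<close> w K, of s t] surv_process_close[OF \<open>m \<le> K\<close> w K, of t s]
          that(2) n1[of n] n m(1) by (simp add: abs_minus_commute)
    qed
    moreover have "B \<in> events" unfolding B_def by auto
    ultimately show "\<exists>B\<in>events. prob B \<le> \<epsilon> \<and>
      (\<forall>\<omega>\<in>space M - B. \<forall>s t. \<bar>cdf D s - cdf D t\<bar> \<le> 1 / 2 ^ m \<longrightarrow> \<bar>surv_process n s \<omega> - surv_process n t \<omega>\<bar> \<le> \<eta>)"
      by blast
  qed simp
qed

end

section \<open>The empirical process of the differences\<close>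

context iid_sample
begin

lemma isCont_cdf: "isCont (cdf D) t"
  using continuous_cdf by (simp add: continuous_on_eq_continuous_at)

lemma measure_singleton: "measure D {t} = 0"
  using isCont_cdf D.isCont_cdf by blast

lemma measure_greaterThan: "measure D {t<..} = 1 - cdf D t"
  using D.prob_compl[of "{..t}"] by (simp add: cdf_def Compl_eq_Diff_UNIV[symmetric])

lemma measure_lessThan: "measure D {..<t} = cdf D t"
proof -
  have "{..t} = {..<t} \<union> {t}" by auto
  then have "cdf D t = measure D {..<t} + measure D {t}"
    unfolding cdf_def by (simp only:) (rule D.finite_measure_Union; auto)
  then show ?thesis by (simp add: measure_singleton)
qed

lemma cdf_refl: "cdf (distr D borel uminus) t = 1 - cdf D (- t)"
proof -
  have "uminus -` {..t} = {- t..}" by auto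
  then have "cdf (distr D borel uminus) t = measure D {- t..}"
    unfolding cdf_def by (subst measure_distr) auto
  also have "\<dots> = 1 - measure D {..<- t}"
    using D.prob_compl[of "{..<- t}"] by (simp add: Compl_eq_Diff_UNIV[symmetric])
  finally show ?thesis by (simp add: measure_lessThan)
qed

end

section \<open>The signed tail process of the differences\<close>

locale paired_differences = iid_sample
begin

text \<open>The survival function of - Z is the second of the two being compared, so the oscillation
  bound applies to both survival processes and hence to their difference.\<close>

sublocale refl: iid_sample M "\<lambda>i \<omega>. - Z i \<omega>" "distr D borel uminus"
proof
  show "indep_vars (\<lambda>_. borel) (\<lambda>i \<omega>. - Z i \<omega>) UNIV"
    by (rule indep_vars_compose2[OF indep_Z]) simp
  show "distr M borel (\<lambda>\<omega>. - Z i \<omega>) = distr D borel uminus" for i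
    by (subst distr_Z[of i, symmetric], subst distr_distr) (auto simp: comp_def)
  show "continuous_on UNIV (cdf (distr D borel uminus))"
    unfolding cdf_refl[abs_def]
    by (intro continuous_intros continuous_on_compose2[OF continuous_cdf]) auto
qed

definition surv_diff :: "real \<Rightarrow> real" where
  "surv_diff t = measure D {t<..} - measure D {..<- t}"

text \<open>For t \<ge> 0 this is P(|Z| > t). It falls continuously from 1 to 0 and serves as the
  clock in which oscillations are measured.\<close>

definition surv_sum :: "real \<Rightarrow> real" where
  "surv_sum t = measure D {t<..} + measure D {..<- t}"

text \<open>For t \<ge> 0 this is the sign of z where |z| > t and 0 elsewhere. The product at times
  s and t is therefore the indicator of |z| > max s t, the origin of the maximum in the
  covariance.\<close>

definition sgn_above :: "real \<Rightarrow> real \<Rightarrow> real" where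
  "sgn_above t z = indicator {t<..} z - indicator {..<- t} z"

definition cov :: "real \<Rightarrow> real \<Rightarrow> real" where
  "cov s t = surv_sum (max s t) - surv_diff s * surv_diff t"

definition diff_process :: "nat \<Rightarrow> real \<Rightarrow> 'a \<Rightarrow> real" where
  "diff_process n t \<omega> = (\<Sum>i<n. sgn_above t (Z i \<omega>) - surv_diff t) / sqrt n"

lemma sgn_above_measurable[measurable]: "sgn_above t \<in> borel_measurable borel"
  unfolding sgn_above_def by measurable

lemma diff_process_measurable[measurable]: "diff_process n t \<in> borel_measurable M"
  unfolding diff_process_def by measurable

lemma surv_diff_cdf: "surv_diff t = 1 - cdf D t - cdf D (- t)"
  and surv_sum_cdf: "surv_sum t = 1 - cdf D t + cdf D (- t)"
  by (simp_all add: surv_diff_def surv_sum_def measure_greaterThan measure_lessThan)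

lemma surv_sum_0: "surv_sum 0 = 1" by (simp add: surv_sum_cdf)

lemma surv_sum_antimono: "s \<le> t \<Longrightarrow> surv_sum t \<le> surv_sum s"
  unfolding surv_sum_cdf using D.cdf_nondecreasing[of s t] D.cdf_nondecreasing[of "- t" "- s"] by simp

lemma surv_sum_nonneg: "0 \<le> surv_sum t" by (simp add: surv_sum_def)

lemma surv_diff_le_sum: "\<bar>surv_diff t\<bar> \<le> surv_sum t" by (simp add: surv_diff_def surv_sum_def abs_le_iff)

lemma surv_diff_bounded: "\<bar>surv_diff t\<bar> \<le> 1"
  unfolding surv_diff_cdf
  using D.cdf_nonneg[of t] D.cdf_bounded_prob[of t] D.cdf_nonneg[of "- t"] D.cdf_bounded_prob[of "- t"]
  by (simp add: abs_le_iff)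

lemma surv_sum_le_1: "0 \<le> t \<Longrightarrow> surv_sum t \<le> 1" using surv_sum_antimono[of 0 t] surv_sum_0 by simp

lemma continuous_surv_sum: "continuous_on A surv_sum"
  unfolding surv_sum_cdf[abs_def]
  by (intro continuous_intros continuous_on_compose2[OF continuous_cdf]) auto

lemma continuous_surv_diff: "continuous_on A surv_diff"
  unfolding surv_diff_cdf[abs_def]
  by (intro continuous_intros continuous_on_compose2[OF continuous_cdf]) auto

lemma surv_sum_tendsto_0: "(surv_sum \<longlongrightarrow> 0) at_top"
proof -
  have "((\<lambda>t. cdf D (- t)) \<longlongrightarrow> 0) at_top"
    using D.cdf_lim_at_bot by (simp add: filterlim_at_bot_mirror)
  then have "(surv_sum \<longlongrightarrow> 1 - 1 + 0) at_top"
    unfolding surv_sum_cdf[abs_def] by (intro tendsto_intros D.cdf_lim_at_top_prob)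
  then show ?thesis by simp
qed

lemma surv_sum_surj:
  assumes "0 < u" "u \<le> 1" obtains t where "0 \<le> t" "surv_sum t = u"
proof -
  have "eventually (\<lambda>t. surv_sum t < u) at_top"
    using order_tendstoD(2)[OF surv_sum_tendsto_0 assms(1)] .
  then obtain b where b: "\<And>t. t \<ge> b \<Longrightarrow> surv_sum t < u" by (auto simp: eventually_at_top_linorder)
  have "\<exists>t\<ge>0. t \<le> max b 0 \<and> surv_sum t = u"
    using IVT2'[of surv_sum "max b 0" u 0] b[of "max b 0"] assms(2) surv_sum_0 continuous_surv_sum
    by force
  then show ?thesis using that by blast
qed

lemma surv_process_diff: "diff_process n t \<omega> = surv_process n t \<omega> - refl.surv_process n t \<omega>"
proof -
  have "uminus -` {t<..} = {..<- t}" by auto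
  then have m: "measure (distr D borel uminus) {t<..} = measure D {..<- t}"
    by (subst measure_distr) auto
  have i: "indicator {t<..} (- z) = (indicator {..<- t} z :: real)" for z by (auto simp: indicator_def)
  have e: "(\<Sum>i<n. sgn_above t (Z i \<omega>) - surv_diff t)
    = (\<Sum>i<n. (indicator {t<..} (Z i \<omega>) - measure D {t<..}) - (indicator {..<- t} (Z i \<omega>) - measure D {..<- t}))"
    by (intro sum.cong refl) (simp add: sgn_above_def surv_diff_def)
  show ?thesis
    unfolding diff_process_def surv_process_def refl.surv_process_def m i
      diff_divide_distrib[symmetric] sum_subtractf[symmetric]
    by (subst e) rule
qed

lemma sgn_above_bounded: "\<bar>sgn_above t z\<bar> \<le> 1"
  by (auto simp: sgn_above_def indicator_def)

lemma integrable_sgn_above: "integrable D (sgn_above t)"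
  by (rule D.integrable_const_bound[where B=1]) (auto simp: sgn_above_bounded)

lemma integral_sgn_above: "integral\<^sup>L D (sgn_above t) = surv_diff t"
proof -
  have "integrable D (indicator {t<..} :: real \<Rightarrow> real)" "integrable D (indicator {..<- t} :: real \<Rightarrow> real)"
    by (auto intro!: D.integrable_const_bound[where B=1])
  then show ?thesis unfolding sgn_above_def[abs_def] surv_diff_def by simp
qed

lemma integral_sgn_above_mult:
  assumes "0 \<le> s" "0 \<le> t"
  shows "(\<integral>z. (sgn_above s z - surv_diff s) * (sgn_above t z - surv_diff t) \<partial>D) = cov s t"
proof -
  have "integrable D (indicator {max s t<..} :: real \<Rightarrow> real)" "integrable D (indicator {..<- max s t} :: real \<Rightarrow> real)"
    by (auto intro!: D.integrable_const_bound[where B=1])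
  note int = this integrable_sgn_above
  have "sgn_above s z * sgn_above t z = indicator {max s t<..} z + indicator {..<- max s t} z" for z
    using assms by (auto simp: sgn_above_def indicator_def)
  then have "(\<integral>z. (sgn_above s z - surv_diff s) * (sgn_above t z - surv_diff t) \<partial>D)
    = (\<integral>z. indicator {max s t<..} z + indicator {..<- max s t} z
        - surv_diff t * sgn_above s z - surv_diff s * sgn_above t z + surv_diff s * surv_diff t \<partial>D)"
    by (intro Bochner_Integration.integral_cong) (auto simp: algebra_simps)
  also have "\<dots> = surv_sum (max s t) - surv_diff t * surv_diff s - surv_diff s * surv_diff t + surv_diff s * surv_diff t"
    using int D.prob_space by (simp add: integral_sgn_above surv_sum_def)
  finally show ?thesis by (simp add: cov_def)
qed

text \<open>Cramer-Wold: a linear combination of coordinates is a normalised sum of i.i.d. bounded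
  variables f (Z i) with mean 0 and variance v, the quadratic form, so the one-dimensional central
  limit theorem applies. It requires v > 0; for v = 0 the summands vanish almost surely.\<close>

lemma diff_process_cos:
  assumes T: "finite T" "T \<subseteq> {0..}"
  shows "(\<lambda>n. expectation (\<lambda>\<omega>. cos ((\<Sum>t\<in>T. a t * diff_process n t \<omega>) + b)))
    \<longlonglongrightarrow> cos b * exp (- quad_form cov T a / 2)"
proof -
  define f where "f z = (\<Sum>t\<in>T. a t * (sgn_above t z - surv_diff t))" for z
  have [measurable]: "f \<in> borel_measurable borel" unfolding f_def by measurable
  define \<zeta> where "\<zeta> i \<omega> = f (Z i \<omega>)" for i \<omega>
  have [measurable]: "\<zeta> i \<in> borel_measurable M" for i unfolding \<zeta>_def by measurable
  define v where "v = quad_form cov T a"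
  have int: "integrable D (\<lambda>z. sgn_above t z - surv_diff t)" for t
    by (intro Bochner_Integration.integrable_diff integrable_sgn_above) simp
  have b2: "\<bar>sgn_above t z - surv_diff t\<bar> \<le> 2" for t z
    using sgn_above_bounded[of t z] surv_diff_bounded[of t] by linarith
  have fb: "\<bar>f z\<bar> \<le> (\<Sum>t\<in>T. \<bar>a t\<bar> * 2)" for z
    unfolding f_def
    by (intro order_trans[OF sum_abs] sum_mono) (auto simp: abs_mult intro!: mult_left_mono b2)
  have iz: "integrable M (\<zeta> i)" "integrable M (\<lambda>\<omega>. (\<zeta> i \<omega>)\<^sup>2)" for i
    unfolding \<zeta>_def
     apply (rule integrable_const_bound[where B="\<Sum>t\<in>T. \<bar>a t\<bar> * 2"]; use fb in auto)
    apply (rule integrable_const_bound[where B="(\<Sum>t\<in>T. \<bar>a t\<bar> * 2)\<^sup>2"])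
     apply (use power_mono[OF fb, where n=2] in auto)
    done
  have mean: "expectation (\<zeta> i) = 0" for i
    unfolding \<zeta>_def expectation_Z[of f i, simplified] unfolding f_def
    using int D.prob_space integrable_sgn_above
    by (subst Bochner_Integration.integral_sum) (auto simp: integral_sgn_above)
  have var: "expectation (\<lambda>\<omega>. (\<zeta> i \<omega>)\<^sup>2) = v" for i
  proof -
    have "expectation (\<lambda>\<omega>. (\<zeta> i \<omega>)\<^sup>2) = (\<integral>z. (f z)\<^sup>2 \<partial>D)"
      unfolding \<zeta>_def by (rule expectation_Z) measurable
    also have "\<dots> = quad_form (\<lambda>s t. \<integral>z. (sgn_above s z - surv_diff s) * (sgn_above t z - surv_diff t) \<partial>D) T a"
      unfolding f_def
    proof (rule expectation_square_sum[OF T(1)])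
      fix s t
      have "\<bar>(sgn_above s z - surv_diff s) * (sgn_above t z - surv_diff t)\<bar> \<le> 2 * 2" for z
        unfolding abs_mult by (intro mult_mono b2) auto
      then show "integrable D (\<lambda>z. (sgn_above s z - surv_diff s) * (sgn_above t z - surv_diff t))"
        by (intro D.integrable_const_bound[where B="2 * 2"]) auto
    qed
    also have "\<dots> = v"
      unfolding v_def quad_form_def using T integral_sgn_above_mult by (intro sum.cong refl) (auto simp: subset_iff)
    finally show ?thesis .
  qed
  have sum_eq: "(\<Sum>t\<in>T. a t * diff_process n t \<omega>) = (\<Sum>i<n. \<zeta> i \<omega>) / sqrt n" for n \<omega>
  proof -
    have "(\<Sum>t\<in>T. a t * diff_process n t \<omega>) = (\<Sum>t\<in>T. \<Sum>i<n. a t * (sgn_above t (Z i \<omega>) - surv_diff t)) / sqrt n"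
      unfolding diff_process_def by (simp only: times_divide_eq_right sum_divide_distrib sum_distrib_left)
    also have "(\<Sum>t\<in>T. \<Sum>i<n. a t * (sgn_above t (Z i \<omega>) - surv_diff t)) = (\<Sum>i<n. \<zeta> i \<omega>)"
      unfolding \<zeta>_def f_def by (rule sum.swap)
    finally show ?thesis .
  qed
  have v0: "0 \<le> v" unfolding var[of 0, symmetric] by simp
  show ?thesis
  proof (cases "v = 0")
    case True
    have "AE \<omega> in M. \<zeta> i \<omega> = 0" for i
      using integral_nonneg_eq_0_iff_AE[OF iz(2)[of i]] var[of i] True by simp
    then have "AE \<omega> in M. \<forall>i. \<zeta> i \<omega> = 0" by (simp add: AE_all_countable)
    then have "expectation (\<lambda>\<omega>. cos ((\<Sum>i<n. \<zeta> i \<omega>) / sqrt n + b)) = expectation (\<lambda>\<omega>. cos b)" for n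
      by (intro integral_cong_AE) auto
    then show ?thesis unfolding sum_eq using True by (simp add: v_def prob_space)
  next
    case False
    define \<sigma> where "\<sigma> = sqrt v"
    have \<sigma>: "0 < \<sigma>" "\<sigma>\<^sup>2 = v" using False v0 by (auto simp: \<sigma>_def)
    define S where "S n \<omega> = (\<Sum>i<n. \<zeta> i \<omega>) / sqrt (n * \<sigma>\<^sup>2)" for n \<omega>
    have [measurable]: "S n \<in> borel_measurable M" for n unfolding S_def by measurable
    have "weak_conv_m (\<lambda>n. distr M borel (\<lambda>\<omega>. (\<Sum>i<n. \<zeta> i \<omega> - 0) / sqrt (n * \<sigma>\<^sup>2))) std_normal_distribution"
    proof (rule central_limit_theorem[OF _ mean \<sigma>(1) iz(2)])
      show "indep_vars (\<lambda>_. borel) \<zeta> UNIV"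
        unfolding \<zeta>_def by (rule indep_vars_compose2[OF indep_Z]) measurable
      show "variance (\<zeta> i) = \<sigma>\<^sup>2" for i using var[of i] \<sigma>(2) mean by simp
      show "distr M borel (\<zeta> i) = distr D borel f" for i
        unfolding \<zeta>_def by (subst distr_Z[of i, symmetric], subst distr_distr) (auto simp: comp_def)
    qed
    then have w: "weak_conv_m (\<lambda>n. distr M borel (S n)) std_normal_distribution"
      by (simp add: S_def[abs_def])
    \<comment> \<open>Evaluating at \<sigma> undoes the standardisation of
      \<open>S n\<close>.\<close>
    have c: "(\<lambda>n. char (distr M borel (S n)) \<sigma>) \<longlonglongrightarrow> complex_of_real (exp (- (\<sigma>\<^sup>2) / 2))"
      using levy_continuity1[OF _ _ w, of \<sigma>] real_dist_normal_dist by (simp add: char_std_normal_distribution)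
    have "(\<lambda>n. cos b * Re (char (distr M borel (S n)) \<sigma>) - sin b * Im (char (distr M borel (S n)) \<sigma>))
      \<longlonglongrightarrow> cos b * Re (complex_of_real (exp (- (\<sigma>\<^sup>2) / 2))) - sin b * Im (complex_of_real (exp (- (\<sigma>\<^sup>2) / 2)))"
      by (intro tendsto_intros c)
    then have "(\<lambda>n. expectation (\<lambda>\<omega>. cos (\<sigma> * S n \<omega> + b))) \<longlonglongrightarrow> cos b * exp (- v / 2)"
      by (simp add: expectation_cos_eq_char \<sigma>(2))
    moreover have "\<sigma> * S n \<omega> = (\<Sum>i<n. \<zeta> i \<omega>) / sqrt n" for n \<omega>
      using \<sigma>(1) by (simp add: S_def real_sqrt_mult)
    ultimately show ?thesis unfolding sum_eq v_def by simp
  qed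
qed

text \<open>Halving the summands makes them bounded by 1, as the moment bound for sums requires; the
  constant 4 is the square of this 2.\<close>

lemma diff_process_second_moment:
  "integrable M (\<lambda>\<omega>. (diff_process n t \<omega>)\<^sup>2)" "expectation (\<lambda>\<omega>. (diff_process n t \<omega>)\<^sup>2) \<le> 4"
proof -
  define Y where "Y i \<omega> = (sgn_above t (Z i \<omega>) - surv_diff t) / 2" for i \<omega>
  have [measurable]: "Y i \<in> borel_measurable M" for i unfolding Y_def by measurable
  have Yb: "\<bar>Y i \<omega>\<bar> \<le> 1" for i \<omega>
    unfolding Y_def using sgn_above_bounded[of t "Z i \<omega>"] surv_diff_bounded[of t] by (simp add: abs_le_iff)
  have ind: "indep_vars (\<lambda>_. borel) Y UNIV"
    unfolding Y_def by (rule indep_vars_compose2[OF indep_Z]) measurable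
  have mean: "expectation (Y i) = 0" for i
    unfolding Y_def using expectation_Z[of "\<lambda>z. (sgn_above t z - surv_diff t) / 2" i] integrable_sgn_above[of t]
      D.prob_space by (simp add: integral_sgn_above)
  have var: "expectation (\<lambda>\<omega>. (Y i \<omega>)\<^sup>2) \<le> 1" for i
  proof -
    have y: "(Y i \<omega>)\<^sup>2 \<le> 1" for \<omega> using Yb[of i \<omega>] by (simp add: abs_square_le_1)
    have "integrable M (\<lambda>\<omega>. (Y i \<omega>)\<^sup>2)" by (rule integrable_const_bound[where B=1]) (use y in auto)
    then have "expectation (\<lambda>\<omega>. (Y i \<omega>)\<^sup>2) \<le> expectation (\<lambda>\<omega>. 1)" by (rule integral_mono) (use y in auto)
    then show ?thesis by (simp add: prob_space)
  qed
  have e: "(diff_process n t \<omega>)\<^sup>2 = 4 / n * (\<Sum>i<n. Y i \<omega>)\<^sup>2" for \<omega>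
    unfolding diff_process_def Y_def sum_divide_distrib[symmetric] by (simp add: power_divide)
  have "\<bar>\<Sum>i<n. Y i \<omega>\<bar> \<le> n" for \<omega>
    using sum_norm_le[of "{..<n}" "\<lambda>i. Y i \<omega>" "\<lambda>_. 1"] Yb by simp
  then have i: "integrable M (\<lambda>\<omega>. (\<Sum>i<n. Y i \<omega>)\<^sup>2)"
    by (intro integrable_const_bound[where B="(real n)\<^sup>2"]) (auto simp flip: abs_le_square_iff)
  then show "integrable M (\<lambda>\<omega>. (diff_process n t \<omega>)\<^sup>2)" unfolding e by simp
  have "4 / n * expectation (\<lambda>\<omega>. (\<Sum>i<n. Y i \<omega>)\<^sup>2) \<le> 4 / n * (real n * 1)"
    by (intro mult_left_mono fourth_moment_sum(1)[OF ind Yb mean var]) auto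
  also have "\<dots> \<le> 4" by simp
  finally show "expectation (\<lambda>\<omega>. (diff_process n t \<omega>)\<^sup>2) \<le> 4" unfolding e using i by simp
qed

lemma diff_process_tail: "0 < L \<Longrightarrow> prob {\<omega> \<in> space M. \<bar>diff_process n t \<omega>\<bar> > L} \<le> 4 / L\<^sup>2"
  by (rule second_moment_tail[OF _ diff_process_second_moment]) auto

lemma diff_process_tendsto_0: "((\<lambda>t. diff_process n t \<omega>) \<longlongrightarrow> 0) at_top"
proof -
  have s: "((\<lambda>t. sgn_above t z) \<longlongrightarrow> 0) at_top" for z
  proof (rule tendsto_eventually)
    show "eventually (\<lambda>t. sgn_above t z = 0) at_top"
      using eventually_gt_at_top[of "\<bar>z\<bar>"] by eventually_elim (auto simp: sgn_above_def indicator_def)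
  qed
  have h: "(surv_diff \<longlongrightarrow> 0) at_top"
    by (rule Lim_null_comparison[OF _ surv_sum_tendsto_0]) (simp add: surv_diff_le_sum)
  have "((\<lambda>t. diff_process n t \<omega>) \<longlongrightarrow> (\<Sum>i<n. 0 - 0) / sqrt n) at_top"
    unfolding diff_process_def divide_inverse by (intro tendsto_intros s h)
  then show ?thesis by simp
qed

text \<open>The cdf increments of Z and of - Z are both bounded by the increment of
  \<open>surv_sum\<close>, which is a sum of two nonincreasing functions. The second clause follows
  by comparing s with times tending to infinity, where the process vanishes.\<close>

lemma diff_process_oscillation:
  assumes "0 < \<eta>" "0 < \<epsilon>"
  obtains \<delta> n0 where "0 < \<delta>" "\<And>n. n \<ge> n0 \<Longrightarrow> \<exists>B\<in>events. prob B \<le> \<epsilon> \<and>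
    (\<forall>\<omega>\<in>space M - B. (\<forall>s t. \<bar>surv_sum s - surv_sum t\<bar> \<le> \<delta> \<longrightarrow> \<bar>diff_process n s \<omega> - diff_process n t \<omega>\<bar> \<le> \<eta>)
       \<and> (\<forall>s. surv_sum s \<le> \<delta> \<longrightarrow> \<bar>diff_process n s \<omega>\<bar> \<le> \<eta>))"
proof -
  have e: "0 < \<eta> / 2" "0 < \<epsilon> / 2" using assms by auto
  obtain \<delta>1 n1 where 1: "0 < \<delta>1" "\<And>n. n \<ge> n1 \<Longrightarrow> \<exists>B\<in>events. prob B \<le> \<epsilon> / 2 \<and>
    (\<forall>\<omega>\<in>space M - B. \<forall>s t. \<bar>cdf D s - cdf D t\<bar> \<le> \<delta>1 \<longrightarrow> \<bar>surv_process n s \<omega> - surv_process n t \<omega>\<bar> \<le> \<eta> / 2)"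
    using surv_process_oscillation[OF e] by metis
  obtain \<delta>2 n2 where 2: "0 < \<delta>2" "\<And>n. n \<ge> n2 \<Longrightarrow> \<exists>B\<in>events. prob B \<le> \<epsilon> / 2 \<and>
    (\<forall>\<omega>\<in>space M - B. \<forall>s t. \<bar>cdf (distr D borel uminus) s - cdf (distr D borel uminus) t\<bar> \<le> \<delta>2
        \<longrightarrow> \<bar>refl.surv_process n s \<omega> - refl.surv_process n t \<omega>\<bar> \<le> \<eta> / 2)"
    using refl.surv_process_oscillation[OF e] by metis
  show thesis
  proof (rule that)
    show "0 < min \<delta>1 \<delta>2" using 1(1) 2(1) by simp
    fix n assume n: "n \<ge> max n1 n2"
    obtain B1 where B1: "B1 \<in> events" "prob B1 \<le> \<epsilon> / 2"
      "\<And>\<omega> s t. \<omega> \<in> space M - B1 \<Longrightarrow> \<bar>cdf D s - cdf D t\<bar> \<le> \<delta>1 \<Longrightarrow> \<bar>surv_process n s \<omega> - surv_process n t \<omega>\<bar> \<le> \<eta> / 2"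
      using 1(2)[of n] n by auto
    obtain B2 where B2: "B2 \<in> events" "prob B2 \<le> \<epsilon> / 2"
      "\<And>\<omega> s t. \<omega> \<in> space M - B2 \<Longrightarrow> \<bar>cdf (distr D borel uminus) s - cdf (distr D borel uminus) t\<bar> \<le> \<delta>2
         \<Longrightarrow> \<bar>refl.surv_process n s \<omega> - refl.surv_process n t \<omega>\<bar> \<le> \<eta> / 2"
      using 2(2)[of n] n by auto
    have osc: "\<bar>diff_process n s \<omega> - diff_process n t \<omega>\<bar> \<le> \<eta>"
      if \<omega>: "\<omega> \<in> space M - (B1 \<union> B2)" and d: "\<bar>surv_sum s - surv_sum t\<bar> \<le> min \<delta>1 \<delta>2" for \<omega> s t
    proof -
      have m: "x \<le> y \<Longrightarrow> cdf D x \<le> cdf D y" for x y by (rule D.cdf_nondecreasing)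
      have "\<bar>cdf D s - cdf D t\<bar> \<le> \<bar>surv_sum s - surv_sum t\<bar> \<and> \<bar>cdf D (- s) - cdf D (- t)\<bar> \<le> \<bar>surv_sum s - surv_sum t\<bar>"
        using m[of s t] m[of t s] m[of "- s" "- t"] m[of "- t" "- s"]
        unfolding surv_sum_cdf by (cases "s \<le> t") auto
      then have c: "\<bar>cdf D s - cdf D t\<bar> \<le> \<delta>1"
        "\<bar>cdf (distr D borel uminus) s - cdf (distr D borel uminus) t\<bar> \<le> \<delta>2"
        using d by (auto simp: cdf_refl abs_minus_commute)
      have "\<omega> \<in> space M - B1" "\<omega> \<in> space M - B2" using \<omega> by auto
      from B1(3)[OF this(1) c(1)] B2(3)[OF this(2) c(2)] show ?thesis unfolding surv_process_diff by linarith
    qed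
    have tail: "\<bar>diff_process n s \<omega>\<bar> \<le> \<eta>"
      if \<omega>: "\<omega> \<in> space M - (B1 \<union> B2)" and d: "surv_sum s \<le> min \<delta>1 \<delta>2" for \<omega> s
    proof (rule tendsto_upperbound)
      show "((\<lambda>t. \<bar>diff_process n s \<omega> - diff_process n t \<omega>\<bar>) \<longlongrightarrow> \<bar>diff_process n s \<omega>\<bar>) at_top"
        using diff_process_tendsto_0[of n \<omega>] by (auto intro!: tendsto_eq_intros)
      show "eventually (\<lambda>t. \<bar>diff_process n s \<omega> - diff_process n t \<omega>\<bar> \<le> \<eta>) at_top"
        using eventually_ge_at_top[of s]
      proof eventually_elim
        case (elim t)
        then have "\<bar>surv_sum s - surv_sum t\<bar> \<le> min \<delta>1 \<delta>2"
          using surv_sum_antimono[of s t] surv_sum_nonneg[of t] d by linarith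
        then show ?case by (rule osc[OF \<omega>])
      qed
    qed simp
    have "prob (B1 \<union> B2) \<le> \<epsilon>" using measure_Un_le[OF B1(1) B2(1)] B1(2) B2(2) by linarith
    then show "\<exists>B\<in>events. prob B \<le> \<epsilon> \<and>
    (\<forall>\<omega>\<in>space M - B. (\<forall>s t. \<bar>surv_sum s - surv_sum t\<bar> \<le> min \<delta>1 \<delta>2 \<longrightarrow> \<bar>diff_process n s \<omega> - diff_process n t \<omega>\<bar> \<le> \<eta>)
       \<and> (\<forall>s. surv_sum s \<le> min \<delta>1 \<delta>2 \<longrightarrow> \<bar>diff_process n s \<omega>\<bar> \<le> \<eta>))"
      using B1(1) B2(1) osc tail by (intro bexI[of _ "B1 \<union> B2"]) auto
  qed
qed

lemma diff_process_tendsto_prod: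
  fixes g :: "real \<Rightarrow> real \<Rightarrow> real"
  assumes "gaussian_process N GP cov" and T: "finite T" "T \<subseteq> {0..}"
    and g: "\<And>t. t \<in> T \<Longrightarrow> continuous_on UNIV (g t)" "\<And>t x. t \<in> T \<Longrightarrow> \<bar>g t x\<bar> \<le> 1"
  shows "(\<lambda>n. expectation (\<lambda>\<omega>. \<Prod>t\<in>T. g t (diff_process n t \<omega>))) \<longlonglongrightarrow> (\<integral>\<omega>. (\<Prod>t\<in>T. g t (GP t \<omega>)) \<partial>N)"
proof -
  interpret G: gaussian_process N GP cov by fact
  show ?thesis
  proof (rule tendsto_expectation_prod_of_cos[OF prob_space_axioms G.prob_space_axioms T(1),
        where A=diff_process and B=GP and g=g])
    show "GP t \<in> borel_measurable N" if "t \<in> T" for t using that T by (auto intro: G.GP_measurable)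
    show "(\<lambda>n. expectation (\<lambda>\<omega>. cos ((\<Sum>j\<in>T. a j * diff_process n j \<omega>) + b)))
        \<longlonglongrightarrow> G.expectation (\<lambda>\<omega>. cos ((\<Sum>j\<in>T. a j * GP j \<omega>) + b))" for a b
      using diff_process_cos[OF T] G.GP_cos[OF T] by simp
    show "\<exists>L>0. (\<forall>n. prob {\<omega> \<in> space M. \<bar>diff_process n t \<omega>\<bar> > L} \<le> e)
        \<and> G.prob {\<omega> \<in> space N. \<bar>GP t \<omega>\<bar> > L} \<le> e" if "t \<in> T" "0 < e" for t e
    proof -
      have t: "0 \<le> t" using that T by auto
      \<comment> \<open>\<open>cov t t\<close> is at most \<open>surv_sum t\<close>, hence at most
        1; it is compared with 4 so that one L serves both processes.\<close>
      have c: "cov t t \<le> 4" using surv_sum_le_1[OF t] unfolding cov_def by (simp add: algebra_simps) (smt (verit) zero_le_square)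
      obtain L where L: "0 < L" "4 / L\<^sup>2 \<le> e" using exists_tail_bound[OF \<open>0 < e\<close>, of 4] by auto
      have "G.prob {\<omega> \<in> space N. \<bar>GP t \<omega>\<bar> > L} \<le> 4 / L\<^sup>2"
        using G.GP_variance[OF t] c L
        by (intro G.second_moment_tail G.GP_measurable G.GP_square_integrable t) auto
      then show ?thesis using L diff_process_tail[OF L(1)] order_trans by blast
    qed
  qed (use g in auto)
qed

end

section \<open>Exceedance probabilities\<close>

text \<open>Right-continuity seen along rationals makes exceedance at some t \<ge> 0 a countable
  union of events.\<close>

lemma eventually_at_right_rational:
  fixes t :: real
  assumes "eventually P (at_right t)" obtains r where "r \<in> \<rat>" "t < r" "P r"
proof -
  obtain b where "t < b" "\<And>y. t < y \<Longrightarrow> y < b \<Longrightarrow> P y"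
    using assms unfolding eventually_at_right_field by blast
  then show ?thesis using Rats_dense_in_real[of t b] that by blast
qed

lemma compact_negative_bound:
  fixes f :: "real \<Rightarrow> real"
  assumes "compact S" "continuous_on S f" "\<And>x. x \<in> S \<Longrightarrow> f x < 0"
  shows "\<exists>b<0. \<forall>x\<in>S. f x \<le> b"
proof (cases "S = {}")
  case True
  then show ?thesis by (intro exI[of _ "- 1"]) simp
next
  case False
  then obtain x where "x \<in> S" "\<And>y. y \<in> S \<Longrightarrow> f y \<le> f x"
    using continuous_attains_sup[OF assms(1) False assms(2)] by blast
  then show ?thesis using assms(3) by blast
qed

text \<open>Shifts the sample index to start at 0, so that sums run over
  \<open>{..<n}\<close>.\<close>

lemma (in prob_space) indep_vars_Suc:
  assumes "indep_vars (\<lambda>_. N) X {1..}"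
  shows "indep_vars (\<lambda>_. N) (\<lambda>i. X (Suc i)) UNIV"
  unfolding indep_vars_def2
proof (intro conjI ballI indep_setsI)
  fix i :: nat
  show "random_variable N (X (Suc i))" using assms unfolding indep_vars_def2 by auto
  then show "{X (Suc i) -` A \<inter> space M |A. A \<in> sets N} \<subseteq> events" by (auto intro: measurable_sets)
next
  fix A :: "nat \<Rightarrow> 'a set" and J :: "nat set"
  assume J: "J \<noteq> {}" "J \<subseteq> UNIV" "finite J"
    and A: "\<forall>j\<in>J. A j \<in> {X (Suc j) -` B \<inter> space M |B. B \<in> sets N}"
  have "prob (\<Inter>j\<in>Suc ` J. A (j - 1)) = (\<Prod>j\<in>Suc ` J. prob (A (j - 1)))"
    using assms J A unfolding indep_vars_def2
    by (intro indep_setsD[where F="\<lambda>i. {X i -` B \<inter> space M |B. B \<in> sets N}" and I="{1..}"]) auto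
  then show "prob (\<Inter>j\<in>J. A j) = (\<Prod>j\<in>J. prob (A j))"
    by (simp add: prod.reindex)
qed

context paired_differences
begin

text \<open>For t \<ge> 0 this is sqrt n times the difference of the two empirical survival
  functions; its supremum over these t is the test statistic.\<close>

definition signed_sum :: "nat \<Rightarrow> real \<Rightarrow> 'a \<Rightarrow> real" where
  "signed_sum n t \<omega> = (\<Sum>i<n. sgn_above t (Z i \<omega>)) / sqrt n"

lemma signed_sum_eq: "signed_sum n t \<omega> = diff_process n t \<omega> + sqrt n * surv_diff t"
proof -
  have "diff_process n t \<omega> = (\<Sum>i<n. sgn_above t (Z i \<omega>)) / sqrt n - n * surv_diff t / sqrt n"
    unfolding diff_process_def by (simp add: sum_subtractf diff_divide_distrib)
  also have "n * surv_diff t / sqrt n = n / sqrt n * surv_diff t" by simp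
  also have "n / sqrt n = sqrt n" by (rule real_div_sqrt) simp
  finally show ?thesis by (simp add: signed_sum_def)
qed

lemma signed_sum_measurable[measurable]: "signed_sum n t \<in> borel_measurable M"
  unfolding signed_sum_def by measurable

text \<open>Both intervals in \<open>sgn_above\<close> are open, so membership survives a small
  increase of t, and nonmembership survives every increase.\<close>

lemma eventually_sgn_above: "eventually (\<lambda>t'. sgn_above t' z = sgn_above t z) (at_right t)"
proof -
  have "eventually (\<lambda>t'. t < z \<longrightarrow> t' < z) (at_right t)"
    by (cases "t < z") (auto simp: eventually_at_right_field)
  moreover have "eventually (\<lambda>t'. z < - t \<longrightarrow> z < - t') (at_right t)"
    by (cases "z < - t") (auto simp: eventually_at_right_field intro!: exI[of _ "- z"])
  moreover have "eventually (\<lambda>t'. t < t') (at_right t)" by (simp add: eventually_at_right_less)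
  ultimately show ?thesis
    by eventually_elim (auto simp: sgn_above_def indicator_def)
qed

lemma signed_sum_exceeds_rational:
  "(\<exists>t\<ge>0. c < signed_sum n t \<omega>) \<longleftrightarrow> (\<exists>t\<in>\<rat> \<inter> {0..}. c < signed_sum n t \<omega>)"
proof
  assume "\<exists>t\<ge>0. c < signed_sum n t \<omega>"
  then obtain t where t: "0 \<le> t" "c < signed_sum n t \<omega>" by blast
  have "eventually (\<lambda>t'. \<forall>i\<in>{..<n}. sgn_above t' (Z i \<omega>) = sgn_above t (Z i \<omega>)) (at_right t)"
    by (intro eventually_ball_finite ballI eventually_sgn_above) simp
  then obtain r where "r \<in> \<rat>" "t < r" "\<forall>i\<in>{..<n}. sgn_above r (Z i \<omega>) = sgn_above t (Z i \<omega>)"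
    by (rule eventually_at_right_rational)
  then show "\<exists>t\<in>\<rat> \<inter> {0..}. c < signed_sum n t \<omega>"
    using t by (intro bexI[of _ r]) (auto simp: signed_sum_def)
qed auto

lemma signed_sum_exceeds_event: "{\<omega> \<in> space M. \<exists>t\<ge>0. c < signed_sum n t \<omega>} \<in> events"
proof -
  have "countable (\<rat> \<inter> {0..} :: real set)" using countable_rat by (rule countable_subset[rotated]) auto
  then show ?thesis unfolding signed_sum_exceeds_rational by measurable
qed

text \<open>Beyond all |Z i| every summand is 0. Hence the supremum is never negative and exceeds
  every c < 0 surely.\<close>

lemma signed_sum_nonneg: "\<exists>t\<ge>0. signed_sum n t \<omega> = 0"
proof -
  have "eventually (\<lambda>t. \<forall>i\<in>{..<n}. t \<ge> \<bar>Z i \<omega>\<bar>) at_top"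
    by (intro eventually_ball_finite ballI eventually_ge_at_top) simp
  then have "eventually (\<lambda>t. 0 \<le> t \<and> (\<forall>i\<in>{..<n}. t \<ge> \<bar>Z i \<omega>\<bar>)) at_top"
    by (intro eventually_conj eventually_ge_at_top)
  then obtain t where t: "0 \<le> t" "\<forall>i\<in>{..<n}. t \<ge> \<bar>Z i \<omega>\<bar>"
    by (auto simp: eventually_at_top_linorder)
  have "sgn_above t (Z i \<omega>) = 0" if "i \<in> {..<n}" for i
  proof -
    have "\<bar>Z i \<omega>\<bar> \<le> t" using t(2) that by blast
    then show ?thesis by (auto simp: sgn_above_def indicator_def)
  qed
  then show ?thesis using t by (intro exI[of _ t]) (simp add: signed_sum_def)
qed

text \<open>With u = \<open>surv_sum t\<close> the variance is at least u - u^2 and every covariance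
  with time t is at most 2 u in absolute value, so covariance over standard deviation is of order
  sqrt u and disappears as u tends to 0.\<close>

lemma cov_bounds:
  "surv_sum t - (surv_sum t)\<^sup>2 \<le> cov t t" "\<bar>cov s t\<bar> \<le> 2 * surv_sum t"
proof -
  have "(surv_diff t)\<^sup>2 \<le> (surv_sum t)\<^sup>2"
    using surv_diff_le_sum[of t] power_mono[of "\<bar>surv_diff t\<bar>" "surv_sum t" 2] by simp
  then show "surv_sum t - (surv_sum t)\<^sup>2 \<le> cov t t" by (simp add: cov_def power2_eq_square)
  have "\<bar>surv_diff s * surv_diff t\<bar> \<le> 1 * surv_sum t"
    unfolding abs_mult by (intro mult_mono surv_diff_le_sum surv_diff_bounded) auto
  then show "\<bar>cov s t\<bar> \<le> 2 * surv_sum t"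
    unfolding cov_def using surv_sum_antimono[of t "max s t"] surv_sum_nonneg[of "max s t"] by linarith
qed

text \<open>Times are chosen by their tail probability u = 1 / (n + 2) instead of by size, which
  keeps the variances positive even if |Z| is bounded. The shift by 2 gives u \<le> 1/2, so u - u^2
  \<ge> u / 2.\<close>

lemma prob_exists_GP_positive:
  assumes "gaussian_process N GP cov"
  shows "\<exists>s :: nat \<Rightarrow> real. (\<forall>n. 0 \<le> s n) \<and> measure N {\<omega> \<in> space N. \<exists>n. GP (s n) \<omega> > 0} = 1"
proof -
  interpret G: gaussian_process N GP cov by fact
  have "\<exists>t\<ge>0. surv_sum t = 1 / (real n + 2)" for n
    using surv_sum_surj[of "1 / (real n + 2)"] by (auto simp: divide_le_eq)
  then obtain s where s: "\<And>n. 0 \<le> s n" "\<And>n. surv_sum (s n) = 1 / (real n + 2)" by metis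
  have K: "1 / (2 * (real n + 2)) \<le> cov (s n) (s n)" for n
  proof -
    define x where "x = 1 / (real n + 2)"
    have "x * x \<le> x * (1 / 2)" unfolding x_def by (intro mult_left_mono frac_le) auto
    moreover have "x - x * x \<le> cov (s n) (s n)"
      using cov_bounds(1)[of "s n"] unfolding s(2) power2_eq_square x_def .
    moreover have "1 / (2 * (real n + 2)) = x / 2" by (simp add: x_def)
    ultimately show ?thesis by linarith
  qed
  have Kpos: "0 < cov (s n) (s n)" for n by (rule less_le_trans[OF _ K]) simp
  have lim: "(\<lambda>n. cov t (s n) / sqrt (cov (s n) (s n))) \<longlonglongrightarrow> 0" for t
  proof (rule Lim_null_comparison)
    show "eventually (\<lambda>n. norm (cov t (s n) / sqrt (cov (s n) (s n))) \<le> 4 / sqrt (real n + 2)) sequentially"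
    proof (rule always_eventually, rule allI)
      fix n
      let ?x = "real n + 2"
      have "norm (cov t (s n) / sqrt (cov (s n) (s n))) = \<bar>cov t (s n)\<bar> / sqrt (cov (s n) (s n))"
        using Kpos[of n] by simp
      also have "\<dots> \<le> (2 * (1 / ?x)) / sqrt (1 / (2 * ?x))"
        using cov_bounds(2)[of t "s n"] K[of n] by (intro frac_le) (auto simp: s(2))
      also have "\<dots> \<le> 2 / ?x * (2 * sqrt ?x)"
      proof -
        have "1 / sqrt (1 / (2 * x)) \<le> 2 * sqrt x" if "0 < x" for x :: real
        proof -
          have "1 / sqrt (1 / (2 * x)) = sqrt 2 * sqrt x" by (simp add: real_sqrt_divide real_sqrt_mult)
          also have "\<dots> \<le> 2 * sqrt x" using that by (intro mult_right_mono real_le_lsqrt) auto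
          finally show ?thesis .
        qed
        from this[of ?x] have "1 / sqrt (1 / (2 * ?x)) \<le> 2 * sqrt ?x" by simp
        then have "2 / ?x * (1 / sqrt (1 / (2 * ?x))) \<le> 2 / ?x * (2 * sqrt ?x)" by (intro mult_left_mono) auto
        then show ?thesis by simp
      qed
      also have "\<dots> = 4 * (sqrt ?x / ?x)" by simp
      also have "sqrt ?x / ?x = 1 / sqrt ?x" using sqrt_divide_self_eq[of ?x] by (simp add: inverse_eq_divide)
      finally show "norm (cov t (s n) / sqrt (cov (s n) (s n))) \<le> 4 / sqrt (real n + 2)" by simp
    qed
    have "filterlim (\<lambda>n. sqrt (real n + 2)) at_top sequentially"
      by (intro filterlim_compose[OF sqrt_at_top] filterlim_tendsto_add_at_top[OF tendsto_const filterlim_real_sequentially, of 2, simplified add.commute[of 2]])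
    then show "(\<lambda>n. 4 / sqrt (real n + 2)) \<longlonglongrightarrow> 0" by (rule real_tendsto_divide_at_top[OF tendsto_const])
  qed
  have "G.prob {\<omega> \<in> space N. \<forall>n. GP (s n) \<omega> \<le> 0} = 0"
    using G.prob_all_nonpositive_eq_0[OF s(1) Kpos lim] .
  moreover have [measurable]: "GP (s n) \<in> borel_measurable N" for n using s by (auto intro: G.GP_measurable)
  moreover have "{\<omega> \<in> space N. \<exists>n. GP (s n) \<omega> > 0} = space N - {\<omega> \<in> space N. \<forall>n. GP (s n) \<omega> \<le> 0}"
    unfolding not_le[symmetric] by blast
  ultimately have "G.prob {\<omega> \<in> space N. \<exists>n. GP (s n) \<omega> > 0} = 1"
    using G.prob_compl[of "{\<omega> \<in> space N. \<forall>n. GP (s n) \<omega> \<le> 0}"] by simp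
  then show ?thesis using s(1) by blast
qed

text \<open>The contact set \<open>{surv_diff = 0}\<close> alone contributes to the limit: off its neighbourhood the drift
  \<open>sqrt n * surv_diff\<close> tends to \<open>- \<infinity>\<close>, and beyond a late time \<open>T0\<close> the empirical process is small.\<close>

lemma exceedance_approx:
  assumes GP: "gaussian_process N GP cov" and H: "\<And>t. 0 \<le> t \<Longrightarrow> surv_diff t \<le> 0"
    and c: "0 < c" and e: "0 < e"
    and q: "\<And>T. finite T \<Longrightarrow> T \<subseteq> {0..} \<Longrightarrow> measure N {\<omega> \<in> space N. \<exists>t\<in>T. c < GP t \<omega>} \<le> q"
  obtains r where "r \<le> q"
    "eventually (\<lambda>n. \<bar>prob {\<omega> \<in> space M. \<exists>t\<ge>0. c < signed_sum n t \<omega>} - r\<bar> \<le> e) sequentially"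
proof -
  interpret G: gaussian_process N GP cov by fact
  \<comment> \<open>Five losses: three exceptional events, the passage to the Gaussian limit, and
    the anticoncentration error \<open>R_diff\<close>.\<close>
  define \<epsilon> where "\<epsilon> = e / 5"
  have \<epsilon>: "0 < \<epsilon>" using e by (simp add: \<epsilon>_def)
  obtain \<delta>a na where A: "0 < \<delta>a" "\<And>n. n \<ge> na \<Longrightarrow> \<exists>B\<in>events. prob B \<le> \<epsilon> \<and>
    (\<forall>\<omega>\<in>space M - B. (\<forall>s t. \<bar>surv_sum s - surv_sum t\<bar> \<le> \<delta>a \<longrightarrow> \<bar>diff_process n s \<omega> - diff_process n t \<omega>\<bar> \<le> c / 2)
       \<and> (\<forall>s. surv_sum s \<le> \<delta>a \<longrightarrow> \<bar>diff_process n s \<omega>\<bar> \<le> c / 2))"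
    using diff_process_oscillation[of "c / 2" \<epsilon>] c \<epsilon> by (metis half_gt_zero)
  \<comment> \<open>u \<le> \<delta>a keeps the process within c / 2 beyond T0 off an exceptional
    event, and u \<le> 1/2 makes the variance of \<open>GP T0\<close> positive.\<close>
  define u where "u = min \<delta>a (1 / 2)"
  have u: "0 < u" "u \<le> \<delta>a" "u \<le> 1 / 2" using A(1) by (auto simp: u_def)
  obtain T0 where T0: "0 \<le> T0" "surv_sum T0 = u" using surv_sum_surj[of u] u by auto
  have "T0 \<noteq> 0" using T0 u surv_sum_0 by auto
  then have T0pos: "0 < T0" using T0(1) by simp
  have "u * u \<le> u * (1 / 2)" using u by (intro mult_left_mono) auto
  then have K: "0 < cov T0 T0" using cov_bounds(1)[of T0] u unfolding T0(2) power2_eq_square by linarith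
  \<comment> \<open>Solves 3 h sqrt (cov T0 T0) / u = \<epsilon>: the anticoncentration bound with d
    = 2 h and common covariance u.\<close>
  define h where "h = \<epsilon> * u / (3 * sqrt (cov T0 T0))"
  have h: "0 < h" "(2 * h + h) * sqrt (cov T0 T0) / u = \<epsilon>" using \<epsilon> u K by (auto simp: h_def)
  obtain \<delta>b nb where B: "0 < \<delta>b" "\<And>n. n \<ge> nb \<Longrightarrow> \<exists>B\<in>events. prob B \<le> \<epsilon> \<and>
    (\<forall>\<omega>\<in>space M - B. (\<forall>s t. \<bar>surv_sum s - surv_sum t\<bar> \<le> \<delta>b \<longrightarrow> \<bar>diff_process n s \<omega> - diff_process n t \<omega>\<bar> \<le> h)
       \<and> (\<forall>s. surv_sum s \<le> \<delta>b \<longrightarrow> \<bar>diff_process n s \<omega>\<bar> \<le> h))"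
    using diff_process_oscillation[OF h(1) \<epsilon>] by metis
  have "uniformly_continuous_on {0..T0} surv_sum"
    by (intro compact_uniformly_continuous continuous_surv_sum) simp
  then obtain \<rho> where \<rho>: "0 < \<rho>"
    "\<And>s t. s \<in> {0..T0} \<Longrightarrow> t \<in> {0..T0} \<Longrightarrow> \<bar>t - s\<bar> < \<rho> \<Longrightarrow> \<bar>surv_sum t - surv_sum s\<bar> < \<delta>b"
    using B(1) unfolding uniformly_continuous_on_def dist_real_def by metis
  obtain m0 where m0: "T0 / \<rho> < real m0" using reals_Archimedean2 by blast
  define m where "m = Suc m0"
  have m: "0 < m" "T0 / m < \<rho>"
  proof -
    have "T0 < m * \<rho>" using m0 \<rho>(1) by (simp add: m_def field_simps)
    then show "T0 / m < \<rho>" by (simp add: m_def field_simps)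
  qed (simp add: m_def)
  define cell where "cell j = {real j * (T0 / m)..real (Suc j) * (T0 / m)}" for j
  have cell0: "cell j \<subseteq> {0..T0}" if "j < m" for j
  proof -
    have "real (Suc j) * (T0 / m) \<le> real m * (T0 / m)" using that T0 by (intro mult_right_mono) auto
    then show ?thesis using m(1) T0 by (auto simp: cell_def intro: order_trans[rotated])
  qed
  have osc_cell: "\<bar>surv_sum t - surv_sum s\<bar> \<le> \<delta>b" if "j < m" "s \<in> cell j" "t \<in> cell j" for j s t
  proof -
    have "real (Suc j) * (T0 / m) = real j * (T0 / m) + T0 / m" by (simp only: of_nat_Suc distrib_right mult_1)
    then have "\<bar>t - s\<bar> \<le> T0 / m" using that(2,3) unfolding cell_def atLeastAtMost_iff by linarith
    then have "\<bar>t - s\<bar> < \<rho>" using m(2) by linarith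
    moreover have "s \<in> {0..T0}" "t \<in> {0..T0}" using cell0[OF that(1)] that(2,3) by blast+
    ultimately show ?thesis using \<rho>(2)[of s t] by (intro less_imp_le) blast
  qed
  define E where "E = {t. surv_diff t = 0}"
  \<comment> \<open>A cell that meets the contact set is represented by a contact point, where the
    drift vanishes. The remaining cells form a compact set on which the drift is bounded away from
    0.\<close>
  define J where "J = {j. j < m \<and> cell j \<inter> E \<noteq> {}}"
  define J' where "J' = {j. j < m \<and> cell j \<inter> E = {}}"
  have fin: "finite J" "finite J'" by (auto simp: J_def J'_def)
  define pick where "pick j = (SOME t. t \<in> cell j \<inter> E)" for j
  have pick: "pick j \<in> cell j" "surv_diff (pick j) = 0" if "j \<in> J" for j
  proof -
    have "pick j \<in> cell j \<inter> E" unfolding pick_def by (rule someI_ex) (use that in \<open>auto simp: J_def\<close>)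
    then show "pick j \<in> cell j" "surv_diff (pick j) = 0" by (auto simp: E_def)
  qed
  define T where "T = pick ` J"
  have T: "finite T" "T \<subseteq> {0..T0}" "T \<subseteq> {0..}" "\<And>t. t \<in> T \<Longrightarrow> surv_diff t = 0"
  proof -
    show "finite T" using fin by (simp add: T_def)
    have "pick j \<in> {0..T0}" if "j \<in> J" for j
      using pick(1)[OF that] cell0[of j] that by (auto simp: J_def)
    then show "T \<subseteq> {0..T0}" unfolding T_def by blast
    then show "T \<subseteq> {0..}" by auto
    show "surv_diff t = 0" if "t \<in> T" for t using that pick(2) unfolding T_def by blast
  qed
  have compact: "compact (\<Union>j\<in>J'. cell j)" using fin by (intro compact_UN) (auto simp: cell_def)
  have neg: "surv_diff x < 0" if x: "x \<in> (\<Union>j\<in>J'. cell j)" for x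
  proof -
    obtain j where "j \<in> J'" "x \<in> cell j" using x by blast
    then have "0 \<le> x" "surv_diff x \<noteq> 0" using cell0[of j] by (auto simp: J'_def E_def)
    then show ?thesis using H[of x] by simp
  qed
  obtain b where b: "b < 0" "\<And>x. x \<in> (\<Union>j\<in>J'. cell j) \<Longrightarrow> surv_diff x \<le> b"
    using compact_negative_bound[OF compact continuous_surv_diff neg] by blast
  \<comment> \<open>Chebyshev's inequality at the left ends of the m cells, with \<epsilon> split
    evenly among them.\<close>
  obtain L where L: "0 < L" "4 / L\<^sup>2 \<le> \<epsilon> / m" using exists_tail_bound[of "\<epsilon> / m" 4] \<epsilon> m(1) by auto
  have "filterlim (\<lambda>n. sqrt (real n)) at_top sequentially"
    by (rule filterlim_compose[OF sqrt_at_top filterlim_real_sequentially])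
  then have "filterlim (\<lambda>n. (- b) * sqrt (real n)) at_top sequentially"
    using b(1) by (intro filterlim_tendsto_pos_mult_at_top[OF tendsto_const]) auto
  \<comment> \<open>From here on the drift in a cell off the contact set outweighs both the value at
    its left end and the oscillation within the cell.\<close>
  then have ev1: "eventually (\<lambda>n. L + h \<le> (- b) * sqrt (real n)) sequentially"
    by (simp add: filterlim_at_top)
  define R where "R c = G.expectation (\<lambda>\<omega>. \<Prod>t\<in>T. ramp c h (GP t \<omega>))" for c
  define Rn where "Rn n c = expectation (\<lambda>\<omega>. \<Prod>t\<in>T. ramp c h (diff_process n t \<omega>))" for n c
  have lim: "(\<lambda>n. Rn n c) \<longlonglongrightarrow> R c" for c
    unfolding Rn_def R_def
    by (rule diff_process_tendsto_prod[OF GP T(1,3)]) (auto simp: ramp_range intro: continuous_ramp h)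
  have intn: "integrable M (\<lambda>\<omega>. \<Prod>t\<in>T. ramp c h (diff_process n t \<omega>))" for c n
    by (rule integrable_const_bound[where B=1]) (auto simp: prod_ramp_range)
  have GPm[measurable]: "t \<in> T \<Longrightarrow> GP t \<in> borel_measurable N" for t using T by (auto intro: G.GP_measurable)
  have R_diff: "R c - R (c - 2 * h) \<le> \<epsilon>"
  proof (cases "T = {}")
    case True
    then show ?thesis using \<epsilon> by (simp add: R_def)
  next
    case False
    have "R c - R (c - 2 * h) \<le> (2 * h + h) * sqrt (cov T0 T0) / u"
      unfolding R_def
    proof (rule G.max_anticoncentration[OF T(1) False T(3) T0(1) K u(1) _ h(1)])
      \<comment> \<open>At a contact point t \<le> T0 the product of drifts is 0, and only
        \<open>surv_sum T0\<close> remains of the covariance.\<close>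
      show "cov t T0 = u" if "t \<in> T" for t
        using that T by (auto simp: cov_def T0(2) max_absorb2 subset_iff)
    qed (use h in simp)
    then show ?thesis unfolding h(2) .
  qed
  define r where "r = 1 - R c"
  have "r \<le> q"
  proof -
    have "G.expectation (indicator {\<omega> \<in> space N. \<forall>t\<in>T. GP t \<omega> \<le> c}) \<le> R c"
      unfolding R_def
    proof (rule integral_mono)
      show "integrable N (indicator {\<omega> \<in> space N. \<forall>t\<in>T. GP t \<omega> \<le> c} :: _ \<Rightarrow> real)"
        using T(1) by (intro G.integrable_const_bound[where B=1]) auto
      show "integrable N (\<lambda>\<omega>. \<Prod>t\<in>T. ramp c h (GP t \<omega>))"
        by (rule G.integrable_const_bound[where B=1]) (auto simp: prod_ramp_range)
      fix \<omega> assume "\<omega> \<in> space N"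
      show "indicator {\<omega> \<in> space N. \<forall>t\<in>T. GP t \<omega> \<le> c} \<omega> \<le> (\<Prod>t\<in>T. ramp c h (GP t \<omega>))"
      proof (cases "\<forall>t\<in>T. GP t \<omega> \<le> c")
        case True
        then have "(\<Prod>t\<in>T. ramp c h (GP t \<omega>)) = 1" using h by (intro prod.neutral) (auto intro: ramp_eq_1)
        then show ?thesis by (simp add: indicator_def)
      qed (simp add: prod_ramp_range)
    qed
    then have "G.prob {\<omega> \<in> space N. \<forall>t\<in>T. GP t \<omega> \<le> c} \<le> R c"
      by (simp add: Int_absorb2 Collect_restrict)
    moreover have "{\<omega> \<in> space N. \<exists>t\<in>T. c < GP t \<omega>} = space N - {\<omega> \<in> space N. \<forall>t\<in>T. GP t \<omega> \<le> c}"
      by (auto simp: not_le)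
    moreover have "{\<omega> \<in> space N. \<forall>t\<in>T. GP t \<omega> \<le> c} \<in> G.events" using T(1) by measurable
    ultimately show ?thesis using q[OF T(1,3)] G.prob_compl by (simp add: r_def)
  qed
  moreover have "eventually (\<lambda>n. \<bar>prob {\<omega> \<in> space M. \<exists>t\<ge>0. c < signed_sum n t \<omega>} - r\<bar> \<le> e) sequentially"
    using eventually_ge_at_top[of na] eventually_ge_at_top[of nb] ev1
      order_tendstoD(2)[OF lim[of c], of "R c + \<epsilon>", simplified, OF \<epsilon>]
      order_tendstoD(1)[OF lim[of "c - 2 * h"], of "R (c - 2 * h) - \<epsilon>", simplified, OF \<epsilon>]
  proof eventually_elim
    case (elim n)
    let ?P = "{\<omega> \<in> space M. \<exists>t\<ge>0. c < signed_sum n t \<omega>}"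
    have [measurable]: "?P \<in> events" by (rule signed_sum_exceeds_event)
    \<comment> \<open>At the points of T the drift is 0, so an outcome outside \<open>?P\<close> has
      the centred process at most c on T.\<close>
    have "1 - prob ?P = prob (space M - ?P)" by (simp add: prob_compl)
    also have "\<dots> = expectation (indicator (space M - ?P))" by simp
    also have "\<dots> \<le> Rn n c"
      unfolding Rn_def
    proof (rule integral_mono[OF _ intn])
      show "integrable M (indicator (space M - ?P) :: _ \<Rightarrow> real)"
        by (rule integrable_const_bound[where B=1]) auto
      fix \<omega> assume "\<omega> \<in> space M"
      show "indicator (space M - ?P) \<omega> \<le> (\<Prod>t\<in>T. ramp c h (diff_process n t \<omega>))"
      proof (cases "\<omega> \<in> ?P")
        case False
        then have "diff_process n t \<omega> \<le> c" if "t \<in> T" for t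
          using that T \<open>\<omega> \<in> space M\<close> by (force simp: signed_sum_eq not_less)
        then have "(\<Prod>t\<in>T. ramp c h (diff_process n t \<omega>)) = 1"
          using h by (intro prod.neutral) (auto intro: ramp_eq_1)
        then show ?thesis by (simp add: indicator_def)
      qed (simp add: prod_ramp_range)
    qed
    finally have lower: "r - \<epsilon> \<le> prob ?P" using elim(4) by (simp add: r_def)
    obtain B1 where B1: "B1 \<in> events" "prob B1 \<le> \<epsilon>"
      "\<And>\<omega> s. \<omega> \<in> space M - B1 \<Longrightarrow> surv_sum s \<le> \<delta>a \<Longrightarrow> \<bar>diff_process n s \<omega>\<bar> \<le> c / 2"
      using A(2)[OF elim(1)] by blast
    obtain B2 where B2: "B2 \<in> events" "prob B2 \<le> \<epsilon>"
      "\<And>\<omega> s t. \<omega> \<in> space M - B2 \<Longrightarrow> \<bar>surv_sum s - surv_sum t\<bar> \<le> \<delta>b \<Longrightarrow> \<bar>diff_process n s \<omega> - diff_process n t \<omega>\<bar> \<le> h"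
      using B(2)[OF elim(2)] by blast
    define B3 where "B3 = (\<Union>j<m. {\<omega> \<in> space M. \<bar>diff_process n (real j * (T0 / m)) \<omega>\<bar> > L})"
    have B3e[measurable]: "B3 \<in> events" unfolding B3_def by measurable
    have "prob B3 \<le> (\<Sum>j<m. prob {\<omega> \<in> space M. \<bar>diff_process n (real j * (T0 / m)) \<omega>\<bar> > L})"
      unfolding B3_def by (intro finite_measure_subadditive_finite) auto
    also have "\<dots> \<le> (\<Sum>j<m. \<epsilon> / m)"
      by (intro sum_mono order_trans[OF diff_process_tail[OF L(1)] L(2)])
    also have "\<dots> = \<epsilon>" using m(1) by simp
    finally have B3: "prob B3 \<le> \<epsilon>" .
    \<comment> \<open>Off the exceptional events, exceeding c forces some contact point in T above c
      - h. \<open>ramp (c - 2 * h) h\<close> vanishes from c - h on, which is why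
      \<open>R_diff\<close> compares c with c - 2 * h.\<close>
    define W where "W = {\<omega> \<in> space M. \<exists>t\<in>T. c - h < diff_process n t \<omega>}"
    have We[measurable]: "W \<in> events" unfolding W_def using T(1) by measurable
    have sub: "?P \<subseteq> W \<union> (B1 \<union> (B2 \<union> B3))"
    proof
      fix \<omega> assume "\<omega> \<in> ?P"
      then obtain t where \<omega>: "\<omega> \<in> space M" and t: "0 \<le> t" "c < signed_sum n t \<omega>" by blast
      show "\<omega> \<in> W \<union> (B1 \<union> (B2 \<union> B3))"
      proof (rule ccontr)
        assume "\<not> ?thesis"
        then have nB: "\<omega> \<in> space M - B1" "\<omega> \<in> space M - B2" "\<omega> \<notin> B3" "\<omega> \<notin> W" using \<omega> by auto
        have sq: "sqrt n * surv_diff t \<le> 0" using H[OF t(1)] by (simp add: mult_nonneg_nonpos)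
        have "t < T0"
        proof (rule ccontr)
          assume "\<not> t < T0"
          then have "surv_sum t \<le> \<delta>a" using surv_sum_antimono[of T0 t] T0(2) u by linarith
          then have "\<bar>diff_process n t \<omega>\<bar> \<le> c / 2" by (rule B1(3)[OF nB(1)])
          then show False using t(2) sq c unfolding signed_sum_eq by linarith
        qed
        define j where "j = nat \<lfloor>t / (T0 / m)\<rfloor>"
        have d: "0 < T0 / m" using T0pos m(1) by simp
        have "real j \<le> t / (T0 / m)" "t / (T0 / m) < real j + 1"
        proof -
          have "0 \<le> t / (T0 / m)" using t(1) d by (rule divide_nonneg_pos)
          then have "real j = of_int \<lfloor>t / (T0 / m)\<rfloor>" unfolding j_def by (simp only: of_nat_nat zero_le_floor)
          then show "real j \<le> t / (T0 / m)" "t / (T0 / m) < real j + 1"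
            by (simp_all only: of_int_floor_le real_of_int_floor_add_one_gt)
        qed
        then have jt: "real j * (T0 / m) \<le> t" "t < (real j + 1) * (T0 / m)"
          by (simp_all only: pos_le_divide_eq[OF d] pos_divide_less_eq[OF d])
        have "real (Suc j) = real j + 1" by simp
        then have tj: "t \<in> cell j" using jt unfolding cell_def by (simp only: atLeastAtMost_iff less_imp_le simp_thms)
        have "real m * (T0 / m) = T0" using m(1) by simp
        then have "real j * (T0 / m) < real m * (T0 / m)" using \<open>t < T0\<close> jt(1) by linarith
        then have "real j < real m" using d by (simp only: mult_less_cancel_right_pos)
        then have j: "j < m" by simp
        show False
        proof (cases "j \<in> J")
          case True
          have "\<bar>diff_process n t \<omega> - diff_process n (pick j) \<omega>\<bar> \<le> h"
            by (rule B2(3)[OF nB(2)], rule osc_cell[OF j pick(1)[OF True] tj])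
          then have "c - h < diff_process n (pick j) \<omega>" using t(2) sq unfolding signed_sum_eq by linarith
          then show False using nB(4) \<omega> True by (auto simp: W_def T_def)
        next
          case False
          then have jJ: "j \<in> J'" using j by (auto simp: J_def J'_def)
          have left: "real j * (T0 / m) \<in> cell j" using d unfolding cell_def atLeastAtMost_iff by (intro conjI order_refl mult_right_mono) auto
          have "\<bar>diff_process n t \<omega> - diff_process n (real j * (T0 / m)) \<omega>\<bar> \<le> h"
            by (rule B2(3)[OF nB(2)], rule osc_cell[OF j left tj])
          moreover have "\<bar>diff_process n (real j * (T0 / m)) \<omega>\<bar> \<le> L"
            using nB(3) \<omega> j by (auto simp: B3_def not_less)
          moreover have "sqrt n * surv_diff t \<le> sqrt n * b" using b(2) jJ tj by (intro mult_left_mono) auto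
          ultimately show False using t(2) c elim(3) unfolding signed_sum_eq by (simp add: mult.commute)
        qed
      qed
    qed
    have "prob ?P \<le> prob (W \<union> (B1 \<union> (B2 \<union> B3)))" using sub B1(1) B2(1) by (intro finite_measure_mono) auto
    also have "\<dots> \<le> prob W + (prob B1 + (prob B2 + prob B3))"
    proof -
      have "B2 \<union> B3 \<in> events" "B1 \<union> (B2 \<union> B3) \<in> events" using B1(1) B2(1) B3e by auto
      then show ?thesis
        using measure_Un_le[OF We, of "B1 \<union> (B2 \<union> B3)"] measure_Un_le[OF B1(1), of "B2 \<union> B3"]
          measure_Un_le[OF B2(1) B3e] by linarith
    qed
    finally have "prob ?P \<le> prob W + 3 * \<epsilon>" using B1(2) B2(2) B3 by linarith
    moreover have "Rn n (c - 2 * h) \<le> 1 - prob W"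
    proof -
      have "Rn n (c - 2 * h) \<le> expectation (indicator (space M - W))"
        unfolding Rn_def
      proof (rule integral_mono[OF intn])
        show "integrable M (indicator (space M - W) :: _ \<Rightarrow> real)"
          by (rule integrable_const_bound[where B=1]) auto
        fix \<omega> assume \<omega>: "\<omega> \<in> space M"
        show "(\<Prod>t\<in>T. ramp (c - 2 * h) h (diff_process n t \<omega>)) \<le> indicator (space M - W) \<omega>"
        proof (cases "\<omega> \<in> W")
          case True
          then obtain t where t: "t \<in> T" "c - h < diff_process n t \<omega>" by (auto simp: W_def)
          then have "ramp (c - 2 * h) h (diff_process n t \<omega>) = 0" using h by (intro ramp_eq_0) auto
          then have "(\<Prod>t\<in>T. ramp (c - 2 * h) h (diff_process n t \<omega>)) = 0" using T(1) t(1) by (meson prod_zero)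
          then show ?thesis by simp
        next
          case False
          then show ?thesis using \<omega> by (simp add: prod_ramp_range)
        qed
      qed
      also have "\<dots> = 1 - prob W" by (simp add: prob_compl)
      finally show ?thesis .
    qed
    ultimately have "prob ?P \<le> r + 5 * \<epsilon>" using elim(5) R_diff by (simp add: r_def)
    then show ?case using lower \<epsilon> by (simp add: \<epsilon>_def abs_le_iff)
  qed
  ultimately show thesis using that by blast
qed

end

section \<open>Translation of the sample, the statistic and the supremum\<close>

lemma paired_sample_paired_differences:
  assumes "prob_space M" "X \<in> borel_measurable M" "Y \<in> borel_measurable M"
    and "continuous_on UNIV (cdf (distr M borel (\<lambda>\<omega>. X \<omega> - Y \<omega>)))"
    and ps: "paired_sample M X Y Xs Ys"
  shows "paired_differences M (\<lambda>i \<omega>. Xs (Suc i) \<omega> - Ys (Suc i) \<omega>) (distr M borel (\<lambda>\<omega>. X \<omega> - Y \<omega>))"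
proof -
  interpret prob_space M by fact
  note [measurable] = assms(2,3)
  have ind: "indep_vars (\<lambda>_. borel) (\<lambda>i \<omega>. (Xs (Suc i) \<omega>, Ys (Suc i) \<omega>)) UNIV"
    using ps unfolding paired_sample_def by (intro indep_vars_Suc[where X="\<lambda>i \<omega>. (Xs i \<omega>, Ys i \<omega>)"]) auto
  have diff[measurable]: "(\<lambda>z :: real \<times> real. fst z - snd z) \<in> borel_measurable borel"
    by (intro borel_measurable_continuous_onI continuous_intros)
  show ?thesis
  proof
    show "indep_vars (\<lambda>_. borel) (\<lambda>i \<omega>. Xs (Suc i) \<omega> - Ys (Suc i) \<omega>) UNIV"
      using indep_vars_compose2[OF ind, of "\<lambda>_ z. fst z - snd z" "\<lambda>_. borel"] by simp
    fix i
    have [measurable]: "(\<lambda>\<omega>. (Xs (Suc i) \<omega>, Ys (Suc i) \<omega>)) \<in> borel_measurable M"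
      using ind by (simp add: indep_vars_def2)
    have "distr M borel (\<lambda>\<omega>. Xs (Suc i) \<omega> - Ys (Suc i) \<omega>)
       = distr (distr M borel (\<lambda>\<omega>. (Xs (Suc i) \<omega>, Ys (Suc i) \<omega>))) borel (\<lambda>z. fst z - snd z)"
      by (subst distr_distr) (auto simp: comp_def)
    also have "distr M borel (\<lambda>\<omega>. (Xs (Suc i) \<omega>, Ys (Suc i) \<omega>)) = distr M borel (\<lambda>\<omega>. (X \<omega>, Y \<omega>))"
      using ps unfolding paired_sample_def by simp
    also have "distr (distr M borel (\<lambda>\<omega>. (X \<omega>, Y \<omega>))) borel (\<lambda>z. fst z - snd z) = distr M borel (\<lambda>\<omega>. X \<omega> - Y \<omega>)"
      by (subst distr_distr) (auto simp: comp_def)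
    finally show "distr M borel (\<lambda>\<omega>. Xs (Suc i) \<omega> - Ys (Suc i) \<omega>) = distr M borel (\<lambda>\<omega>. X \<omega> - Y \<omega>)" .
  qed fact
qed

text \<open>The real \<open>SUP\<close> is governed by its elements once the family is bounded
  above, here by 1; exceedance of the supremum is then exceedance at some t.\<close>

lemma S_wj_gt_iff:
  assumes "0 < n"
  shows "c < S_wj Xs Ys n \<omega> \<longleftrightarrow> (\<exists>t\<ge>0. c < (\<Sum>i<n. indicator {t<..} (Xs (Suc i) \<omega> - Ys (Suc i) \<omega>)
     - indicator {..<- t} (Xs (Suc i) \<omega> - Ys (Suc i) \<omega>)) / sqrt n)"
proof -
  define f :: "real \<Rightarrow> real" where "f t = (\<Sum>i<n. indicator {t<..} (Xs (Suc i) \<omega> - Ys (Suc i) \<omega>)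
     - indicator {..<- t} (Xs (Suc i) \<omega> - Ys (Suc i) \<omega>))" for t
  have swap: "indicator {t<..} (Ys i \<omega> - Xs i \<omega>) = (indicator {..<- t} (Xs i \<omega> - Ys i \<omega>) :: real)" for i t
    by (auto simp: indicator_def)
  have g: "emp_surv Xs Ys n \<omega> t - emp_surv Ys Xs n \<omega> t = f t / n" for t
    unfolding emp_surv_def f_def swap
    by (simp add: sum.atLeast1_atMost_eq sum_subtractf diff_divide_distrib)
  have "f t \<le> (\<Sum>i<n. 1)" for t unfolding f_def by (intro sum_mono) (auto simp: indicator_def)
  then have "bdd_above ((\<lambda>t. f t / n) ` {0..})"
    using assms by (intro bdd_aboveI2[of _ _ 1]) (auto simp: field_simps)
  then have "c / sqrt n < (SUP t\<in>{0..}. f t / n) \<longleftrightarrow> (\<exists>t\<in>{0..}. c / sqrt n < f t / n)"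
    by (intro less_cSUP_iff) auto
  moreover have "c < S_wj Xs Ys n \<omega> \<longleftrightarrow> c / sqrt n < (SUP t\<in>{0..}. f t / n)"
    unfolding S_wj_def g using assms by (simp add: pos_divide_less_eq mult.commute)
  moreover have "c / sqrt n < f t / n \<longleftrightarrow> c < f t / sqrt n" for t
  proof -
    have "f t / sqrt n = sqrt n * (f t / n)" using assms by (simp add: field_simps)
    then show ?thesis using assms by (simp add: pos_divide_less_eq mult.commute)
  qed
  ultimately show ?thesis unfolding f_def by auto
qed

text \<open>Taken in \<open>ereal\<close>, the supremum may be infinite without spoiling the
  equivalence. Right-continuity of the paths reduces the event to rational times, hence its
  measurability.\<close>

lemma SUP_cadlag_event:
  assumes "is_GP M X Y N GP" "gaussian_process N GP K"
  shows "{\<omega> \<in> space N. (SUP t\<in>{0..}. ereal (GP t \<omega>)) > ereal c} = {\<omega> \<in> space N. \<exists>t\<ge>0. c < GP t \<omega>}"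
    and "{\<omega> \<in> space N. \<exists>t\<ge>0. c < GP t \<omega>} \<in> sets N"
proof -
  interpret G: gaussian_process N GP K by fact
  show "{\<omega> \<in> space N. (SUP t\<in>{0..}. ereal (GP t \<omega>)) > ereal c} = {\<omega> \<in> space N. \<exists>t\<ge>0. c < GP t \<omega>}"
    by (auto simp: less_SUP_iff)
  have "(\<exists>t\<ge>0. c < GP t \<omega>) \<longleftrightarrow> (\<exists>t\<in>\<rat> \<inter> {0..}. c < GP t \<omega>)" if "\<omega> \<in> space N" for \<omega>
  proof
    assume "\<exists>t\<ge>0. c < GP t \<omega>"
    then obtain t where t: "0 \<le> t" "c < GP t \<omega>" by blast
    then have "((\<lambda>t. GP t \<omega>) \<longlongrightarrow> GP t \<omega>) (at_right t)"
      using assms(1) that by (simp add: is_GP_def cadlag_def)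
    from order_tendstoD(1)[OF this t(2)] obtain r where "r \<in> \<rat>" "t < r" "c < GP r \<omega>"
      by (rule eventually_at_right_rational)
    then show "\<exists>t\<in>\<rat> \<inter> {0..}. c < GP t \<omega>" using t by (intro bexI[of _ r]) auto
  qed auto
  then have "{\<omega> \<in> space N. \<exists>t\<ge>0. c < GP t \<omega>} = {\<omega> \<in> space N. \<exists>t\<in>\<rat> \<inter> {0..}. c < GP t \<omega>}" by blast
  also have "\<dots> \<in> sets N"
  proof -
    have "countable (\<rat> \<inter> {0..} :: real set)" using countable_rat by (rule countable_subset[rotated]) auto
    moreover have [measurable]: "t \<in> \<rat> \<inter> {0..} \<Longrightarrow> GP t \<in> borel_measurable N" for t by (auto intro: G.GP_measurable)
    ultimately show ?thesis by measurable
  qed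
  finally show "{\<omega> \<in> space N. \<exists>t\<ge>0. c < GP t \<omega>} \<in> sets N" .
qed

text \<open>The number r may change with e, so no candidate for the limit is required: closeness to
  r makes the sequence Cauchy, and r \<le> q for every e bounds its limit.\<close>

lemma convergent_approx_le:
  fixes p :: "nat \<Rightarrow> real"
  assumes "\<And>e. 0 < e \<Longrightarrow> \<exists>r\<le>q. eventually (\<lambda>n. \<bar>p n - r\<bar> \<le> e) sequentially"
  shows "convergent p \<and> lim p \<le> q"
proof -
  have "Cauchy p"
  proof (rule metric_CauchyI)
    fix e :: real assume "0 < e"
    then obtain r where "eventually (\<lambda>n. \<bar>p n - r\<bar> \<le> e / 3) sequentially" using assms[of "e / 3"] by auto
    then obtain n0 where n0: "\<And>n. n \<ge> n0 \<Longrightarrow> \<bar>p n - r\<bar> \<le> e / 3" by (auto simp: eventually_sequentially)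
    have "dist (p m) (p n) < e" if "m \<ge> n0" "n \<ge> n0" for m n
      using n0[OF that(1)] n0[OF that(2)] \<open>0 < e\<close> unfolding dist_real_def by linarith
    then show "\<exists>M. \<forall>m\<ge>M. \<forall>n\<ge>M. dist (p m) (p n) < e" by blast
  qed
  then have c: "convergent p" by (simp add: Cauchy_convergent_iff)
  then have lim: "p \<longlonglongrightarrow> lim p" by (simp add: convergent_LIMSEQ_iff)
  have "lim p \<le> q"
  proof (rule field_le_epsilon)
    fix e :: real assume "0 < e"
    then obtain r where r: "r \<le> q" "eventually (\<lambda>n. \<bar>p n - r\<bar> \<le> e) sequentially" using assms by blast
    from r(2) have "eventually (\<lambda>n. p n \<le> q + e) sequentially" by eventually_elim (use r(1) in linarith)
    then show "lim p \<le> q + e" by (intro tendsto_upperbound[OF lim]) auto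
  qed
  with c show ?thesis by blast
qed

text \<open>For c > 0 the limit comes from the contact set; for c < 0 both probabilities are 1 (the
  first for n > 0). At c = 0 the statistic may converge to its lower bound 0, and convergence in law
  then does not decide P(S_n > 0); there the bound on the limit superior follows from q = 1.\<close>

theorem proposition14:
  fixes M :: "'a measure" and N :: "'b measure"
    and X Y :: "'a \<Rightarrow> real" and Xs Ys :: "nat \<Rightarrow> 'a \<Rightarrow> real"
    and GP :: "real \<Rightarrow> 'b \<Rightarrow> real" and c :: real
  assumes "prob_space M" and "prob_space N"
    and "X \<in> borel_measurable M" and "Y \<in> borel_measurable M"
    and "continuous_on UNIV (cdf (distr M borel (\<lambda>\<omega>. X \<omega> - Y \<omega>)))"
    and "paired_sample M X Y Xs Ys"
    and "st_wj_le M X Y"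
    and "is_GP M X Y N GP"
  defines "p \<equiv> \<lambda>n. measure M {\<omega> \<in> space M. S_wj Xs Ys n \<omega> > c}"
    and "q \<equiv> measure N {\<omega> \<in> space N. (SUP t\<in>{0..}. ereal (GP t \<omega>)) > ereal c}"
  shows "(c \<noteq> 0 \<longrightarrow> convergent p \<and> lim p \<le> q) \<and> limsup (\<lambda>n. ereal (p n)) \<le> ereal q"
proof -
  let ?D = "distr M borel (\<lambda>\<omega>. X \<omega> - Y \<omega>)"
  interpret paired_differences M "\<lambda>i \<omega>. Xs (Suc i) \<omega> - Ys (Suc i) \<omega>" ?D
    by (rule paired_sample_paired_differences) fact+
  note [measurable] = assms(3,4)
  have F: "diff_surv M X Y t = measure ?D {t<..}" for t
    unfolding diff_surv_def by (subst measure_distr) (auto intro!: arg_cong[where f=prob])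
  have G: "diff_surv M Y X t = measure ?D {..<- t}" for t
    unfolding diff_surv_def by (subst measure_distr) (auto intro!: arg_cong[where f=prob])
  have cov: "GP_cov M X Y = cov"
    by (simp add: fun_eq_iff GP_cov_def cov_def surv_sum_def surv_diff_def F G)
  have gp: "gaussian_process N GP cov" using is_GP_gaussian_process[OF assms(2,8)] unfolding cov .
  interpret G: gaussian_process N GP cov by fact
  have H: "surv_diff t \<le> 0" for t using assms(7) by (simp add: st_wj_le_def F G surv_diff_def)
  have q: "q = G.prob {\<omega> \<in> space N. \<exists>t\<ge>0. c < GP t \<omega>}"
    unfolding q_def SUP_cadlag_event(1)[OF assms(8) gp] ..
  have p: "p n = prob {\<omega> \<in> space M. \<exists>t\<ge>0. c < signed_sum n t \<omega>}" if "0 < n" for n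
    unfolding p_def S_wj_gt_iff[OF that] signed_sum_def sgn_above_def ..
  have q1: "q = 1" if "c \<le> 0"
  proof -
    obtain s where s: "\<forall>n::nat. 0 \<le> s n" "G.prob {\<omega> \<in> space N. \<exists>n. GP (s n) \<omega> > 0} = 1"
      using prob_exists_GP_positive[OF gp] by (elim exE conjE)
    have "{\<omega> \<in> space N. \<exists>n. GP (s n) \<omega> > 0} \<subseteq> {\<omega> \<in> space N. \<exists>t\<ge>0. c < GP t \<omega>}"
      using s(1) le_less_trans[OF that] by blast
    then have "G.prob {\<omega> \<in> space N. \<exists>n. GP (s n) \<omega> > 0} \<le> q"
      unfolding q by (intro G.finite_measure_mono SUP_cadlag_event(2)[OF assms(8) gp])
    then show ?thesis using s(2) G.prob_le_1[of "{\<omega> \<in> space N. \<exists>t\<ge>0. c < GP t \<omega>}"] unfolding q by linarith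
  qed
  have conv: "convergent p \<and> lim p \<le> q" if "c \<noteq> 0"
  proof (rule convergent_approx_le)
    fix e :: real assume "0 < e"
    show "\<exists>r\<le>q. eventually (\<lambda>n. \<bar>p n - r\<bar> \<le> e) sequentially"
    proof (cases "0 < c")
      case True
      have "G.prob {\<omega> \<in> space N. \<exists>t\<in>T. c < GP t \<omega>} \<le> q" if "T \<subseteq> {0..}" for T
        unfolding q using that by (intro G.finite_measure_mono SUP_cadlag_event(2)[OF assms(8) gp]) auto
      then obtain r where r: "r \<le> q"
        "eventually (\<lambda>n. \<bar>prob {\<omega> \<in> space M. \<exists>t\<ge>0. c < signed_sum n t \<omega>} - r\<bar> \<le> e) sequentially"
        using exceedance_approx[OF gp H True \<open>0 < e\<close>, of q] by blast
      from r(2) eventually_gt_at_top[of 0] have "eventually (\<lambda>n. \<bar>p n - r\<bar> \<le> e) sequentially"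
        by eventually_elim (simp add: p)
      then show ?thesis using r(1) by blast
    next
        case False
      then have "c < 0" using that by simp
      have "p n = 1" if "0 < n" for n
      proof -
        have "\<exists>t\<ge>0. c < signed_sum n t \<omega>" for \<omega>
          using signed_sum_nonneg[of n \<omega>] \<open>c < 0\<close> by metis
        then show ?thesis unfolding p[OF that] by (simp add: prob_space)
      qed
      then have "eventually (\<lambda>n. \<bar>p n - 1\<bar> \<le> e) sequentially"
        using \<open>0 < e\<close> by (intro eventually_sequentiallyI[of 1]) simp
      then show ?thesis using q1 \<open>c < 0\<close> by (intro exI[of _ 1]) simp
    qed
  qed
  have "limsup (\<lambda>n. ereal (p n)) \<le> ereal q"
  proof (cases "c = 0")
    case True
    have "p n \<le> q" for n using q1 True unfolding p_def by simp
    then show ?thesis by (intro Limsup_bounded) simp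
  next
    case False
    then have "(\<lambda>n. ereal (p n)) \<longlonglongrightarrow> ereal (lim p)"
      using conv by (simp add: convergent_LIMSEQ_iff)
    then have "limsup (\<lambda>n. ereal (p n)) = ereal (lim p)" by (intro lim_imp_Limsup) simp
    then show ?thesis using conv[OF False] by simp
  qed
  then show ?thesis using conv by blast
qed

end
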